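(* Suppose $\phi\colon X\to X'$ is a quasi-isometric embedding between proper geodesic metric spaces. If $\phi$ takes contracting quasi-geodesics to contracting quasi-geodesics, then it induces an injection $\partial_c\phi\colon\partial_c^{\mathcal{FQ}}X\to\partial_c^{\mathcal{FQ}}X'$ that is an open mapping onto its image with the subspace topology. If $\phi(X)$ is a contracting subset of $X'$ then $\partial_c\phi$ is continuous.
   Context: A function $\rho\colon[0,\infty)\to\mathbb{R}$ is sublinear if it is non-decreasing, eventually non-negative, and $\lim_{r\to\infty}\rho(r)/r=0$. Let $X$ be a proper (closed balls are compact) geodesic metric space with metric $d$. For a closed subset $Z\subset X$ let $\pi_Z(x):=\{z\in Z\mid d(x,z)=d(x,Z)\}$. For sublinear $\rho$, $Z$ is $\rho$-contracting if for all $x,y\in X$: $d(x,y)\le d(x,Z)$ implies $\operatorname{diam}(\pi_Z(x)\cup\pi_Z(y))\le\rho(d(x,Z))$. $Z$ is contracting if it is $\rho$-contracting for some sublinear $\rho$. A subset that is not closed is called contracting if its closure is. For $L\ge1$, $A\ge0$, a map $\phi$ is an $(L,A)$-quasi-isometric embedding if $\frac1L d(x,y)-A\le d(\phi(x),\phi(y))\le Ld(x,y)+A$ for all $x,y$. A geodesic is an isometric embedding of an interval, and an $(L,A)$-quasi-geodesic is an $(L,A)$-quasi-isometric embedding (not necessarily continuous) of an interval; a ray has domain $[0,\infty)$. Quasi-geodesics are conflated with their images, and a quasi-geodesic is contracting if its image is. Fix a basepoint $o\in X$. $\partial_cX$ is the set of contracting quasi-geodesic rays based at $o$ modulo finite Hausdorff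 distance. Every $\zeta\in\partial_cX$ contains a geodesic ray based at $o$; the function $\rho_\zeta(r):=\sup\operatorname{diam}(\pi_\alpha(x)\cup\pi_\alpha(y))$, with supremum over geodesic rays $\alpha\in\zeta$ (based at $o$) and points $x,y$ with $d(x,y)\le d(x,\alpha)\le r$, is sublinear and every geodesic in $\zeta$ is $\rho_\zeta$-contracting. For each $\zeta$ fix a geodesic ray $\alpha^\zeta\in\zeta$. For sublinear $\rho$, $L\ge1$, $A\ge0$ set $\kappa(\rho,L,A):=\max\{3A,\,3L^2,\,1+\inf\{R>0\mid\forall r\ge R,\ 3L^2\rho(r)\le r\}\}$. For $r\ge1$, $U(\zeta,r)$ is the set of $\eta\in\partial_cX$ such that for all $L\ge1$, $A\ge0$ and every continuous $(L,A)$-quasi-geodesic ray $\beta\in\eta$ (based at $o$) we have $d(\beta,\{x\in\alpha^\zeta\mid d(x,o)\ge r\})\le\kappa(\rho_\zeta,L,A)$. The topology of fellow-travelling quasi-geodesics is $\mathcal{FQ}:=\{U\subset\partial_cX\mid\forall\zeta\in U\ \exists r\ge1,\ U(\zeta,r)\subset U\}$, and $\partial_c^{\mathcal{FQ}}X$ is $\partial_cX$ with this topology (it does not depend, up to the natural identification, on the basepoint or on the chosen $\alpha^\zeta$). Take the basepoint of $X'$ to be $\phi(o)$. The induced map $\partial_c\phi$ sends the class of a contracting quasi-geodesic ray $\gamma$ to the class of $\phi\circ\gamma$. (When $\phi(X)$ is contracting, $\phi$ takes contracting quasi-geodesics to contracting quasi-geodesics, so $\partial_c\phi$ is defined.) 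*)

theory Defs
  imports "HOL-Analysis.Analysis"
begin

section \<open>Proper geodesic spaces and quasi-geodesics\<close>

definition geodesic_on :: "real set \<Rightarrow> (real \<Rightarrow> 'a::metric_space) \<Rightarrow> bool" where
  "geodesic_on I \<gamma> \<longleftrightarrow> (\<forall>s\<in>I. \<forall>t\<in>I. dist (\<gamma> s) (\<gamma> t) = dist s t)"

definition proper_geodesic_space :: "'a::metric_space itself \<Rightarrow> bool" where
  "proper_geodesic_space _ \<longleftrightarrow>
     (\<forall>(x::'a) r. compact (cball x r)) \<and>
     (\<forall>x y::'a. \<exists>\<gamma> a b. a \<le> b \<and> geodesic_on {a..b} \<gamma> \<and> \<gamma> a = x \<and> \<gamma> b = y)"

definition qi_embedding_on ::
    "real \<Rightarrow> real \<Rightarrow> 'a::metric_space set \<Rightarrow> ('a \<Rightarrow> 'b::metric_space) \<Rightarrow> bool" where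
  "qi_embedding_on L A S f \<longleftrightarrow>
     (\<forall>x\<in>S. \<forall>y\<in>S. 1 / L * dist x y - A \<le> dist (f x) (f y) \<and>
                    dist (f x) (f y) \<le> L * dist x y + A)"

definition quasi_isometric_embedding :: "('a::metric_space \<Rightarrow> 'b::metric_space) \<Rightarrow> bool" where
  "quasi_isometric_embedding f \<longleftrightarrow> (\<exists>L\<ge>1. \<exists>A\<ge>0. qi_embedding_on L A UNIV f)"

definition quasi_geodesic_on :: "real set \<Rightarrow> (real \<Rightarrow> 'a::metric_space) \<Rightarrow> bool" where
  "quasi_geodesic_on I \<gamma> \<longleftrightarrow> is_interval I \<and> (\<exists>L\<ge>1. \<exists>A\<ge>0. qi_embedding_on L A I \<gamma>)"


section \<open>Contracting sets\<close>

text \<open>Functions on \<open>[0,\<infinity>)\<close> are represented by functions on the reals whose values on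
  negative arguments play no role.\<close>

definition sublinear :: "(real \<Rightarrow> real) \<Rightarrow> bool" where
  "sublinear \<rho> \<longleftrightarrow> mono_on {0..} \<rho> \<and> (\<forall>\<^sub>F r in at_top. 0 \<le> \<rho> r) \<and>
     ((\<lambda>r. \<rho> r / r) \<longlongrightarrow> 0) at_top"

definition closest_proj :: "'a::metric_space set \<Rightarrow> 'a \<Rightarrow> 'a set" where
  "closest_proj Z x = {z\<in>Z. dist x z = infdist x Z}"

definition rho_contracting :: "(real \<Rightarrow> real) \<Rightarrow> 'a::metric_space set \<Rightarrow> bool" where
  "rho_contracting \<rho> Z \<longleftrightarrow>
     (\<forall>x y. dist x y \<le> infdist x Z \<longrightarrow>
        diameter (closest_proj Z x \<union> closest_proj Z y) \<le> \<rho> (infdist x Z))"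

definition contracting :: "'a::metric_space set \<Rightarrow> bool" where
  "contracting Z \<longleftrightarrow> (\<exists>\<rho>. sublinear \<rho> \<and> rho_contracting \<rho> (closure Z))"

definition preserves_contracting_quasi_geodesics ::
    "('a::metric_space \<Rightarrow> 'b::metric_space) \<Rightarrow> bool" where
  "preserves_contracting_quasi_geodesics \<phi> \<longleftrightarrow>
     (\<forall>I \<gamma>. quasi_geodesic_on I \<gamma> \<and> contracting (\<gamma> ` I) \<longrightarrow>
        quasi_geodesic_on I (\<phi> \<circ> \<gamma>) \<and> contracting ((\<phi> \<circ> \<gamma>) ` I))"


section \<open>The contracting boundary\<close>

definition hausdorff_distance :: "'a::metric_space set \<Rightarrow> 'a set \<Rightarrow> ereal" where
  "hausdorff_distance S T =
     Inf {ereal C | C. 0 \<le> C \<and> S \<subseteq> (\<Union>y\<in>T. cball y C) \<and> T \<subseteq> (\<Union>x\<in>S. cball x C)}"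

definition contracting_rays :: "'a::metric_space \<Rightarrow> (real \<Rightarrow> 'a) set" where
  "contracting_rays p = {\<gamma>. quasi_geodesic_on {0..} \<gamma> \<and> \<gamma> 0 = p \<and> contracting (\<gamma> ` {0..})}"

definition ray_rel :: "'a::metric_space \<Rightarrow> ((real \<Rightarrow> 'a) \<times> (real \<Rightarrow> 'a)) set" where
  "ray_rel p = {(\<beta>, \<gamma>). \<beta> \<in> contracting_rays p \<and> \<gamma> \<in> contracting_rays p \<and>
     hausdorff_distance (\<beta> ` {0..}) (\<gamma> ` {0..}) < \<infinity>}"

text \<open>A boundary point contains every real function that restricts on \<open>[0,\<infinity>)\<close> to one of its
  rays, so the arbitrary values on negative arguments do not create additional points.\<close>

definition contracting_boundary :: "'a::metric_space \<Rightarrow> (real \<Rightarrow> 'a) set set" where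
  "contracting_boundary p = contracting_rays p // ray_rel p"

definition geodesic_choice ::
    "'a::metric_space \<Rightarrow> ((real \<Rightarrow> 'a) set \<Rightarrow> real \<Rightarrow> 'a) \<Rightarrow> bool" where
  "geodesic_choice p \<alpha> \<longleftrightarrow>
     (\<forall>\<zeta>\<in>contracting_boundary p. \<alpha> \<zeta> \<in> \<zeta> \<and> geodesic_on {0..} (\<alpha> \<zeta>))"


section \<open>The topology of fellow-travelling quasi-geodesics\<close>

text \<open>For \<open>r \<ge> 0\<close> and a boundary point \<open>\<zeta>\<close> the supremum is over a nonempty set bounded by \<open>4 * r\<close>.\<close>

definition rho_bd :: "(real \<Rightarrow> 'a::metric_space) set \<Rightarrow> real \<Rightarrow> real" where
  "rho_bd \<zeta> r = Sup {diameter (closest_proj (\<alpha> ` {0..}) x \<union> closest_proj (\<alpha> ` {0..}) y) | \<alpha> x y.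
     \<alpha> \<in> \<zeta> \<and> geodesic_on {0..} \<alpha> \<and>
     dist x y \<le> infdist x (\<alpha> ` {0..}) \<and> infdist x (\<alpha> ` {0..}) \<le> r}"

definition kappa :: "(real \<Rightarrow> real) \<Rightarrow> real \<Rightarrow> real \<Rightarrow> real" where
  "kappa \<rho> L A =
     Max {3 * A, 3 * L\<^sup>2, 1 + Inf {R. R > 0 \<and> (\<forall>r\<ge>R. 3 * L\<^sup>2 * \<rho> r \<le> r)}}"

definition FQ_nbhd ::
    "'a::metric_space \<Rightarrow> ((real \<Rightarrow> 'a) set \<Rightarrow> real \<Rightarrow> 'a) \<Rightarrow> (real \<Rightarrow> 'a) set \<Rightarrow> real \<Rightarrow>
     (real \<Rightarrow> 'a) set set" where
  "FQ_nbhd p \<alpha> \<zeta> r = {\<eta> \<in> contracting_boundary p.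
     \<forall>L\<ge>1. \<forall>A\<ge>0. \<forall>\<beta>\<in>\<eta>. continuous_on {0..} \<beta> \<and> qi_embedding_on L A {0..} \<beta> \<longrightarrow>
       setdist (\<beta> ` {0..}) {x \<in> \<alpha> \<zeta> ` {0..}. dist x p \<ge> r} \<le> kappa (rho_bd \<zeta>) L A}"

definition FQ_open ::
    "'a::metric_space \<Rightarrow> ((real \<Rightarrow> 'a) set \<Rightarrow> real \<Rightarrow> 'a) \<Rightarrow> (real \<Rightarrow> 'a) set set \<Rightarrow> bool" where
  "FQ_open p \<alpha> U \<longleftrightarrow>
     U \<subseteq> contracting_boundary p \<and> (\<forall>\<zeta>\<in>U. \<exists>r\<ge>1. FQ_nbhd p \<alpha> \<zeta> r \<subseteq> U)"

definition FQ_topology ::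
    "'a::metric_space \<Rightarrow> ((real \<Rightarrow> 'a) set \<Rightarrow> real \<Rightarrow> 'a) \<Rightarrow> (real \<Rightarrow> 'a) set topology" where
  "FQ_topology p \<alpha> = topology (FQ_open p \<alpha>)"

lemma FQ_nbhd_antimono:
  assumes "geodesic_choice p \<alpha>" "\<zeta> \<in> contracting_boundary p" "0 \<le> r" "r \<le> s"
  shows "FQ_nbhd p \<alpha> \<zeta> s \<subseteq> FQ_nbhd p \<alpha> \<zeta> r"
proof -
  have a: "\<alpha> \<zeta> \<in> \<zeta>" "geodesic_on {0..} (\<alpha> \<zeta>)"
    using assms(1,2) by (auto simp: geodesic_choice_def)
  have "\<zeta> \<subseteq> contracting_rays p"
    using assms(2) by (auto simp: contracting_boundary_def quotient_def ray_rel_def)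
  with a have "\<alpha> \<zeta> 0 = p"
    by (auto simp: contracting_rays_def)
  then have "dist (\<alpha> \<zeta> s) p = s"
    using a(2) assms(3,4) by (force simp: geodesic_on_def dist_real_def)
  then have ne: "{x \<in> \<alpha> \<zeta> ` {0..}. dist x p \<ge> s} \<noteq> {}"
    using assms(3,4) by (auto intro!: bexI[of _ s])
  have "setdist B {x \<in> \<alpha> \<zeta> ` {0..}. dist x p \<ge> r} \<le> setdist B {x \<in> \<alpha> \<zeta> ` {0..}. dist x p \<ge> s}" for B
    using ne assms(4) by (intro setdist_subset_right) auto
  then show ?thesis
    unfolding FQ_nbhd_def by (blast intro: order_trans)
qed

lemma istopology_FQ_open:
  assumes "geodesic_choice p \<alpha>"
  shows "istopology (FQ_open p \<alpha>)"
  unfolding istopology_def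
proof (intro conjI allI impI)
  fix S T assume S: "FQ_open p \<alpha> S" and T: "FQ_open p \<alpha> T"
  have "\<exists>r\<ge>1. FQ_nbhd p \<alpha> \<zeta> r \<subseteq> S \<inter> T" if z: "\<zeta> \<in> S \<inter> T" for \<zeta>
  proof -
    obtain r s where rs: "r \<ge> 1" "FQ_nbhd p \<alpha> \<zeta> r \<subseteq> S" "s \<ge> 1" "FQ_nbhd p \<alpha> \<zeta> s \<subseteq> T"
      using S T z unfolding FQ_open_def by blast
    have zb: "\<zeta> \<in> contracting_boundary p"
      using S z unfolding FQ_open_def by blast
    have "FQ_nbhd p \<alpha> \<zeta> (max r s) \<subseteq> S \<inter> T"
      using FQ_nbhd_antimono[OF assms zb, of r "max r s"]
        FQ_nbhd_antimono[OF assms zb, of s "max r s"] rs by auto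
    then show ?thesis
      using rs(1) by (intro exI[of _ "max r s"]) auto
  qed
  then show "FQ_open p \<alpha> (S \<inter> T)"
    using S unfolding FQ_open_def by blast
next
  fix \<K> assume "\<forall>K\<in>\<K>. FQ_open p \<alpha> K"
  then show "FQ_open p \<alpha> (\<Union>\<K>)"
    unfolding FQ_open_def by (meson Sup_upper UnionE Union_least order_trans)
qed

lemma openin_FQ_topology:
  "geodesic_choice p \<alpha> \<Longrightarrow> openin (FQ_topology p \<alpha>) = FQ_open p \<alpha>"
  by (simp add: FQ_topology_def istopology_FQ_open topology_inverse')

lemma topspace_FQ_topology:
  assumes "geodesic_choice p \<alpha>"
  shows "topspace (FQ_topology p \<alpha>) = contracting_boundary p"
proof -
  have "FQ_nbhd p \<alpha> \<zeta> 1 \<subseteq> contracting_boundary p" for \<zeta>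
    by (auto simp: FQ_nbhd_def)
  then have "FQ_open p \<alpha> (contracting_boundary p)"
    unfolding FQ_open_def by blast
  then show ?thesis
    unfolding topspace_def openin_FQ_topology[OF assms] by (auto simp: FQ_open_def)
qed


section \<open>The induced map\<close>

text \<open>The union is the single class of \<open>\<phi> \<circ> \<gamma>\<close> when that class does not depend on the
  representative \<open>\<gamma>\<close>; \<open>induces_boundary_map\<close> below says that this is the case.\<close>

definition boundary_map ::
    "'a::metric_space \<Rightarrow> ('a \<Rightarrow> 'b::metric_space) \<Rightarrow> (real \<Rightarrow> 'a) set \<Rightarrow> (real \<Rightarrow> 'b) set" where
  "boundary_map p \<phi> \<zeta> = (\<Union>\<gamma>\<in>\<zeta>. ray_rel (\<phi> p) `` {\<phi> \<circ> \<gamma>})"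

definition induces_boundary_map :: "'a::metric_space \<Rightarrow> ('a \<Rightarrow> 'b::metric_space) \<Rightarrow> bool" where
  "induces_boundary_map p \<phi> \<longleftrightarrow>
     (\<forall>\<gamma>\<in>contracting_rays p. \<phi> \<circ> \<gamma> \<in> contracting_rays (\<phi> p) \<and>
        boundary_map p \<phi> (ray_rel p `` {\<gamma>}) = ray_rel (\<phi> p) `` {\<phi> \<circ> \<gamma>})"

end

theory Submission
  imports Defs
begin

text \<open>
  A quasi-geodesic that stays far from a contracting set \<open>Z\<close> projects to \<open>Z\<close> too slowly to remain
  far for long. Hence a quasi-geodesic from \<open>p\<close> that comes within distance \<open>C\<close> of a point
  \<open>\<alpha> t\<close> of a contracting geodesic ray has a point within \<open>\<kappa>\<close> of \<open>\<alpha> u\<close>, where \<open>t - u\<close> is bounded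
  in terms of \<open>C\<close>. As \<open>\<kappa>(\<rho>, L, A)\<close> is at least \<open>r\<close> unless \<open>L\<close> and \<open>A\<close> are less than \<open>r\<close>, membership in
  \<open>U(\<zeta>, r)\<close> only has to be tested up to uniform errors. Such errors are all that \<open>\<phi>\<close> produces:
  quasi-geodesics of \<open>X\<close> are pushed forward for openness; for continuity, quasi-geodesics of \<open>X'\<close>
  stay uniformly near the contracting set \<open>\<phi>(X)\<close> and are pulled back.

  Openness in the subspace topology also uses that \<open>U(\<zeta>, r)\<close> is a neighbourhood of \<open>\<zeta>\<close>. If
  \<open>\<eta> \<in> U(\<zeta>, r')\<close> and a quasi-geodesic \<open>\<beta>\<close> follows \<open>\<alpha>\<^sup>\<eta>\<close> for long enough, then an initial part of \<open>\<beta>\<close>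
  continued to a ray in \<open>\<eta>\<close> is a quasi-geodesic with constants depending only on those of \<open>\<beta>\<close>,
  and it is the initial part that comes near \<open>\<alpha>\<^sup>\<zeta>\<close>.
\<close>

section \<open>Contracting sets\<close>

text \<open>Contraction is handled as a bound \<open>\<epsilon> * d + R\<close> for every
  \<open>\<epsilon> > 0\<close>. This form tolerates bounded errors and, with \<open>R\<close>
  common to all members, makes sense for a family of sets. That uniformity is needed because
  \<open>rho_bd \<zeta>\<close> is a supremum over all geodesic rays of \<open>\<zeta>\<close>; its
  sublinearity is what makes the infimum in \<open>kappa\<close> one over a nonempty set.

  The sets \<open>FQ_nbhd\<close> are not open by definition. For continuity it is enough to map
  neighbourhoods into neighbourhoods. For openness an open set of the target must be produced whose
  trace on the image of the boundary is the given one; it may contain points outside that image,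
  about which \<open>\<phi>\<close> says nothing. The neighbourhood property is therefore proved
  inside one space.

  Its difficulty is the order of constants: those of \<open>\<eta>\<close> are not bounded in terms
  of \<open>\<zeta>\<close>. The spliced ray must have constants that depend on \<open>r\<close>
  only, so the place of the splice has to be chosen with care; constants of \<open>\<eta>\<close>
  may enter only the radius about \<open>\<eta>\<close>.\<close>

lemma diameter_leI:
  assumes "\<And>u v. u \<in> S \<Longrightarrow> v \<in> S \<Longrightarrow> dist u v \<le> d" "0 \<le> d"
  shows "diameter S \<le> d"
proof (cases "S = {}")
  case False
  then show ?thesis
    unfolding diameter_def using assms by (auto intro!: cSUP_least)
qed (simp add: assms(2))

lemma geodesic_segment:
  fixes x y :: "'a::metric_space"
  assumes "proper_geodesic_space TYPE('a)"
  obtains g where "geodesic_on {0..dist x y} g" "g 0 = x" "g (dist x y) = y"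
proof -
  obtain \<gamma> a b where g: "a \<le> b" "geodesic_on {a..b} \<gamma>" "\<gamma> a = x" "\<gamma> b = y"
    using assms unfolding proper_geodesic_space_def by blast
  have "dist x y = dist a b"
    using g unfolding geodesic_on_def by force
  then have d: "dist x y = b - a"
    using g(1) by (simp add: dist_real_def)
  show thesis
  proof
    show "geodesic_on {0..dist x y} (\<lambda>t. \<gamma> (a + t))"
      using g(2) d unfolding geodesic_on_def by (auto simp: dist_real_def)
  qed (use g d in auto)
qed

lemma geodesic_point:
  fixes x y :: "'a::metric_space"
  assumes "proper_geodesic_space TYPE('a)" "0 \<le> s" "s \<le> dist x y"
  obtains m where "dist x m = s" "dist m y = dist x y - s"
proof -
  obtain g where g: "geodesic_on {0..dist x y} g" "g 0 = x" "g (dist x y) = y"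
    using geodesic_segment[OF assms(1)] by blast
  have "dist (g 0) (g s) = dist 0 s" "dist (g s) (g (dist x y)) = dist s (dist x y)"
    using g(1) assms(2,3) unfolding geodesic_on_def by auto
  then have "dist x (g s) = s" "dist (g s) y = dist x y - s"
    using g(2,3) assms(2,3) by (auto simp: dist_real_def)
  then show thesis
    using that by blast
qed

lemma closest_projD:
  assumes "u \<in> closest_proj Z x"
  shows "u \<in> Z" "dist x u = infdist x Z"
  using assms by (auto simp: closest_proj_def)

lemma closest_proj_exists:
  fixes Z :: "'a::metric_space set"
  assumes "proper_geodesic_space TYPE('a)" "closed Z" "Z \<noteq> {}"
  obtains u where "u \<in> closest_proj Z x"
proof -
  obtain z where z: "z \<in> Z"
    using assms(3) by blast
  define S where "S = Z \<inter> cball x (dist x z)"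
  have "compact (cball x (dist x z))"
    using assms(1) by (auto simp: proper_geodesic_space_def)
  then have "compact S"
    unfolding S_def using assms(2) by (rule closed_Int_compact[rotated])
  moreover have "z \<in> S"
    by (simp add: S_def z)
  ultimately obtain u where u: "u \<in> S" "\<And>v. v \<in> S \<Longrightarrow> dist x u \<le> dist x v"
    using continuous_attains_inf[of S "dist x"] continuous_on_dist[OF continuous_on_const continuous_on_id]
    by blast
  have "dist x u \<le> dist x v" if "v \<in> Z" for v
    using u that \<open>z \<in> S\<close> by (cases "dist x v \<le> dist x z") (force simp: S_def)+
  then have "dist x u \<le> infdist x Z"
    using assms(3) by (simp add: infdist_def cINF_greatest)
  moreover have "infdist x Z \<le> dist x u"
    using u(1) by (simp add: S_def infdist_le)
  ultimately have "u \<in> closest_proj Z x"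
    using u(1) by (auto simp: closest_proj_def S_def)
  then show thesis
    using that by blast
qed

lemma dist_closest_proj_le:
  assumes "u \<in> closest_proj Z x" "v \<in> closest_proj Z y"
  shows "dist u v \<le> infdist x Z + dist x y + infdist y Z"
proof -
  have "dist u v \<le> dist x u + dist x y + dist y v"
    by metric
  then show ?thesis
    using closest_projD[OF assms(1)] closest_projD[OF assms(2)] by simp
qed

text \<open>Lying below every line of positive slope up to a constant is sublinearity without a
  named gauge. The quantifier order matters: \<open>R\<close> is chosen after
  \<open>\<epsilon>\<close> but before \<open>Z\<close>.\<close>

definition uniformly_contracting :: "'a::metric_space set set \<Rightarrow> bool" where
  "uniformly_contracting \<Z> \<longleftrightarrow>
     (\<forall>\<epsilon>>0. \<exists>R\<ge>0. \<forall>Z\<in>\<Z>. \<forall>x y. \<forall>u\<in>closest_proj Z x. \<forall>v\<in>closest_proj Z y.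
        dist x y \<le> infdist x Z \<longrightarrow> dist u v \<le> \<epsilon> * infdist x Z + R)"

text \<open>The least gauge that serves all members at once; for the geodesic rays of a boundary
  point it is \<open>rho_bd\<close>. A real \<open>Sup\<close> is informative only for nonempty sets
  bounded above, so both have to be shown.\<close>

definition contraction_gauge :: "'a::metric_space set set \<Rightarrow> real \<Rightarrow> real" where
  "contraction_gauge \<Z> r = Sup {diameter (closest_proj Z x \<union> closest_proj Z y) | Z x y.
     Z \<in> \<Z> \<and> dist x y \<le> infdist x Z \<and> infdist x Z \<le> r}"

lemma bounded_closest_proj: "bounded (closest_proj Z x)"
  unfolding bounded_def by (rule exI[of _ x]) (auto simp: closest_proj_def)

text \<open>The limit gives slope \<open>\<epsilon>\<close> beyond a threshold, and monotonicity
  bounds the gauge below it by one value. That value may be negative, hence the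
  \<open>max 0\<close>.\<close>

lemma contracting_imp_uniformly_contracting:
  assumes "contracting W"
  shows "uniformly_contracting {closure W}"
  unfolding uniformly_contracting_def
proof (intro allI impI)
  fix \<epsilon> :: real assume e: "\<epsilon> > 0"
  obtain \<rho> where rho: "sublinear \<rho>" "rho_contracting \<rho> (closure W)"
    using assms by (auto simp: contracting_def)
  have "\<forall>\<^sub>F r in at_top. dist (\<rho> r / r) 0 < \<epsilon>"
    using rho(1) e unfolding sublinear_def by (intro tendstoD) auto
  then obtain R where R: "\<And>r. r \<ge> R \<Longrightarrow> dist (\<rho> r / r) 0 < \<epsilon>"
    by (auto simp: eventually_at_top_linorder)
  define R1 where "R1 = max R 1"
  have big: "\<rho> r \<le> \<epsilon> * r" if "r \<ge> R1" for r
  proof -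
    have "\<rho> r / r < \<epsilon>"
      using R[of r] that abs_ge_self[of "\<rho> r / r"] unfolding dist_real_def R1_def by linarith
    then show ?thesis
      using that by (simp add: R1_def field_simps)
  qed
  have small: "\<rho> r \<le> \<rho> R1" if "0 \<le> r" "r \<le> R1" for r
    using rho(1) that by (auto simp: sublinear_def mono_on_def)
  have all: "\<rho> r \<le> \<epsilon> * r + max 0 (\<rho> R1)" if "0 \<le> r" for r
    using big[of r] small[of r] that e mult_nonneg_nonneg[of \<epsilon> r] by linarith
  show "\<exists>R\<ge>0. \<forall>Z\<in>{closure W}. \<forall>x y. \<forall>u\<in>closest_proj Z x. \<forall>v\<in>closest_proj Z y.
        dist x y \<le> infdist x Z \<longrightarrow> dist u v \<le> \<epsilon> * infdist x Z + R"
  proof (intro exI[of _ "max 0 (\<rho> R1)"] conjI ballI allI impI)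
    fix Z x y u v
    assume H: "Z \<in> {closure W}" "u \<in> closest_proj Z x" "v \<in> closest_proj Z y"
      "dist x y \<le> infdist x Z"
    have "dist u v \<le> diameter (closest_proj Z x \<union> closest_proj Z y)"
      using H by (intro diameter_bounded_bound) (auto simp: bounded_closest_proj)
    also have "\<dots> \<le> \<rho> (infdist x Z)"
      using H rho(2) by (auto simp: rho_contracting_def)
    also have "\<dots> \<le> \<epsilon> * infdist x Z + max 0 (\<rho> R1)"
      by (intro all infdist_nonneg)
    finally show "dist u v \<le> \<epsilon> * infdist x Z + max 0 (\<rho> R1)" .
  qed auto
qed

text \<open>The union also contains pairs of projections of \<open>y\<close>, whose distance to
  \<open>Z\<close> can be twice that of \<open>x\<close>; starting from
  \<open>\<epsilon> / 2\<close> pays for this.\<close>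

lemma uniformly_contracting_diameter:
  assumes "uniformly_contracting \<Z>" "\<epsilon> > 0"
  obtains R where "R \<ge> 0"
    "\<And>Z x y. Z \<in> \<Z> \<Longrightarrow> dist x y \<le> infdist x Z \<Longrightarrow>
       diameter (closest_proj Z x \<union> closest_proj Z y) \<le> \<epsilon> * infdist x Z + R"
proof -
  obtain R where R: "R \<ge> 0" "\<And>Z x y u v. Z \<in> \<Z> \<Longrightarrow> u \<in> closest_proj Z x \<Longrightarrow> v \<in> closest_proj Z y \<Longrightarrow>
        dist x y \<le> infdist x Z \<Longrightarrow> dist u v \<le> \<epsilon> / 2 * infdist x Z + R"
    using assms(1)[unfolded uniformly_contracting_def, rule_format, OF half_gt_zero[OF assms(2)]] by blast
  show thesis
  proof
    fix Z x y
    assume H: "Z \<in> \<Z>" "dist x y \<le> infdist x Z"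
    have y: "infdist y Z \<le> 2 * infdist x Z"
      using infdist_triangle[of y Z x] H(2) by (simp add: dist_commute)
    have ey: "\<epsilon> / 2 * infdist y Z \<le> \<epsilon> * infdist x Z"
      using mult_left_mono[OF y, of "\<epsilon> / 2"] assms(2) by simp
    have ex: "\<epsilon> / 2 * infdist x Z \<le> \<epsilon> * infdist x Z"
      using assms(2) by (intro mult_right_mono) (auto simp: infdist_nonneg)
    have xx: "dist u v \<le> \<epsilon> / 2 * infdist x Z + R"
      if "u \<in> closest_proj Z x" "v \<in> closest_proj Z x \<union> closest_proj Z y" for u v
      using R(2)[OF H(1), of u x v x] R(2)[OF H(1), of u x v y] that H(2) infdist_nonneg[of x Z]
      by auto
    have yy: "dist u v \<le> \<epsilon> / 2 * infdist y Z + R"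
      if "u \<in> closest_proj Z y" "v \<in> closest_proj Z y" for u v
      using R(2)[OF H(1), of u y v y] that infdist_nonneg[of y Z] by auto
    have "dist u v \<le> \<epsilon> * infdist x Z + R"
      if "u \<in> closest_proj Z x \<union> closest_proj Z y" "v \<in> closest_proj Z x \<union> closest_proj Z y" for u v
      using that xx[of u v] xx[of v u] yy[of u v] ex ey by (auto simp: dist_commute)
    then show "diameter (closest_proj Z x \<union> closest_proj Z y) \<le> \<epsilon> * infdist x Z + R"
      using R(1) assms(2) by (intro diameter_leI) (auto simp: infdist_nonneg)
  qed (rule R(1))
qed

lemma contraction_gauge_upper:
  assumes "uniformly_contracting \<Z>" "Z \<in> \<Z>" "dist x y \<le> infdist x Z" "infdist x Z \<le> r"
  shows "diameter (closest_proj Z x \<union> closest_proj Z y) \<le> contraction_gauge \<Z> r"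
proof -
  obtain R where R: "R \<ge> 0"
    "\<And>Z x y. Z \<in> \<Z> \<Longrightarrow> dist x y \<le> infdist x Z \<Longrightarrow>
       diameter (closest_proj Z x \<union> closest_proj Z y) \<le> 1 * infdist x Z + R"
    using uniformly_contracting_diameter[OF assms(1), of 1] by auto
  have "bdd_above {diameter (closest_proj Z x \<union> closest_proj Z y) | Z x y.
     Z \<in> \<Z> \<and> dist x y \<le> infdist x Z \<and> infdist x Z \<le> r}"
    by (rule bdd_aboveI[of _ "r + R"]) (use R in force)
  then show ?thesis
    unfolding contraction_gauge_def using assms by (intro cSup_upper) auto
qed

lemma contraction_gauge_le:
  assumes "Z \<in> \<Z>" "Z \<noteq> {}" "0 \<le> r"
    and "\<And>Z x y. Z \<in> \<Z> \<Longrightarrow> dist x y \<le> infdist x Z \<Longrightarrow> infdist x Z \<le> r \<Longrightarrow>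
       diameter (closest_proj Z x \<union> closest_proj Z y) \<le> M"
  shows "contraction_gauge \<Z> r \<le> M"
proof -
  obtain z where "z \<in> Z"
    using assms(2) by blast
  then have "\<exists>x y. dist x y \<le> infdist x Z \<and> infdist x Z \<le> r"
    using assms(3) by (intro exI[of _ z]) auto
  then show ?thesis
    unfolding contraction_gauge_def using assms(1,4) by (intro cSup_least) blast+
qed

lemma contraction_gauge_sublinear:
  assumes "uniformly_contracting \<Z>" "Z \<in> \<Z>" "Z \<noteq> {}"
  shows "sublinear (contraction_gauge \<Z>)"
proof -
  have mono: "mono_on {0..} (contraction_gauge \<Z>)"
  proof (rule mono_onI)
    fix r s :: real assume "r \<in> {0..}" "s \<in> {0..}" "r \<le> s"
    then show "contraction_gauge \<Z> r \<le> contraction_gauge \<Z> s"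
      by (intro contraction_gauge_le[OF assms(2,3)] contraction_gauge_upper[OF assms(1)]) auto
  qed
  have nonneg: "0 \<le> contraction_gauge \<Z> r" if "0 \<le> r" for r
  proof -
    obtain z where "z \<in> Z"
      using assms(3) by blast
    then have "diameter (closest_proj Z z \<union> closest_proj Z z) \<le> contraction_gauge \<Z> r"
      using that by (intro contraction_gauge_upper[OF assms(1,2)]) auto
    then show ?thesis
      using diameter_ge_0[OF bounded_closest_proj[of Z z]] by simp
  qed
  have lim: "((\<lambda>r. contraction_gauge \<Z> r / r) \<longlongrightarrow> 0) at_top"
  proof (rule tendstoI)
    fix e :: real assume e: "e > 0"
    then obtain R where R: "R \<ge> 0"
      "\<And>Z x y. Z \<in> \<Z> \<Longrightarrow> dist x y \<le> infdist x Z \<Longrightarrow>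
         diameter (closest_proj Z x \<union> closest_proj Z y) \<le> e / 3 * infdist x Z + R"
      using uniformly_contracting_diameter[OF assms(1), of "e / 3"] by auto
    have "dist (contraction_gauge \<Z> r / r) 0 < e" if r: "r \<ge> 3 * R / e + 1" for r
    proof -
      have r0: "r > 0" using r R(1) e by (smt (verit) divide_nonneg_pos)
      have "R * 3 < r * e"
        using r e by (simp add: field_simps)
      then have rR: "R < e / 3 * r" by (simp add: field_simps)
      have "contraction_gauge \<Z> r \<le> e / 3 * r + R"
      proof (rule contraction_gauge_le[OF assms(2,3)])
        fix Z x y assume H: "Z \<in> \<Z>" "dist x y \<le> infdist x Z" "infdist x Z \<le> r"
        have "e / 3 * infdist x Z \<le> e / 3 * r"
          using H(3) e by (intro mult_left_mono) auto
        then show "diameter (closest_proj Z x \<union> closest_proj Z y) \<le> e / 3 * r + R"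
          using R(2)[OF H(1,2)] by linarith
      qed (use r0 in auto)
      also have "\<dots> < e / 3 * r + e / 3 * r"
        using rR by simp
      also have "\<dots> < e * r"
        using e r0 by simp
      finally have "contraction_gauge \<Z> r / r < e"
        using r0 by (simp add: field_simps)
      then show ?thesis
        using nonneg[of r] r0 by (simp add: dist_real_def)
    qed
    then show "\<forall>\<^sub>F r in at_top. dist (contraction_gauge \<Z> r / r) 0 < e"
      by (auto simp: eventually_at_top_linorder)
  qed
  show ?thesis
    unfolding sublinear_def
    by (intro conjI mono lim eventually_mono[OF eventually_ge_at_top[of 0] nonneg])
qed

lemma uniformly_contracting_imp_contracting:
  assumes "uniformly_contracting {closure W}" "W \<noteq> {}"
  shows "contracting W"
  unfolding contracting_def rho_contracting_def
proof (intro exI[of _ "contraction_gauge {closure W}"] conjI allI impI)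
  show "sublinear (contraction_gauge {closure W})"
    by (rule contraction_gauge_sublinear[OF assms(1), of "closure W"]) (use assms(2) in auto)
next
  fix x y assume "dist x y \<le> infdist x (closure W)"
  then show "diameter (closest_proj (closure W) x \<union> closest_proj (closure W) y)
      \<le> contraction_gauge {closure W} (infdist x (closure W))"
    by (intro contraction_gauge_upper[OF assms(1)]) auto
qed


section \<open>Coarse projections\<close>

text \<open>A coarse projection \<open>q\<close> that contracts on balls of radius \<open>c * d(x, W)\<close> with \<open>c < 1\<close>
  contracts on balls of radius \<open>d(x, W)\<close>: from \<open>x\<close> go towards \<open>y\<close>, each time covering the fraction
  \<open>c\<close> of the remaining distance. After boundedly many steps the remaining distance is small compared
  to \<open>d(x, W)\<close>, and there the linear bound on \<open>q\<close> suffices. The same holds for closest point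
  projection, because \<open>y\<close> may be a closest point of \<open>W\<close>.\<close>

lemma quasi_projection_steps:
  fixes W :: "'i \<Rightarrow> 'a::metric_space set" and q :: "'i \<Rightarrow> 'a \<Rightarrow> 'b::metric_space"
  assumes X: "proper_geodesic_space TYPE('a)"
    and c: "0 < c" "c \<le> 1"
    and contr: "\<And>\<epsilon>. \<epsilon> > 0 \<Longrightarrow> \<exists>R\<ge>0. \<forall>i\<in>I. \<forall>x y. dist x y \<le> c * infdist x (W i) \<longrightarrow>
        dist (q i x) (q i y) \<le> \<epsilon> * infdist x (W i) + R"
    and e: "\<epsilon> > 0"
  shows "\<exists>R\<ge>0. \<forall>i\<in>I. \<forall>x y. dist x y \<le> infdist x (W i) \<longrightarrow>
      (\<exists>x'. dist (q i x) (q i x') \<le> \<epsilon> * infdist x (W i) + R \<and>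
        dist x' y \<le> (1 - c) ^ k * infdist x (W i) \<and> dist x' y \<le> infdist x' (W i))"
  using e
proof (induction k arbitrary: \<epsilon>)
  case 0
  show ?case
    by (intro exI[of _ 0] conjI ballI allI impI) (use 0 in \<open>auto intro!: exI simp: infdist_nonneg\<close>)
next
  case (Suc k)
  \<comment> \<open>One half goes to the induction hypothesis. The new step starts at
    \<open>x'\<close>, which may be three times as far from \<open>W i\<close> as \<open>x\<close>,
    so slope \<open>\<epsilon> / 6\<close> there costs the other half.\<close>
  have e2: "\<epsilon> / 2 > 0" "\<epsilon> / 6 > 0"
    using Suc.prems by auto
  obtain R1 where R1: "R1 \<ge> 0" "\<And>i x y. i \<in> I \<Longrightarrow> dist x y \<le> infdist x (W i) \<Longrightarrow>
      (\<exists>x'. dist (q i x) (q i x') \<le> \<epsilon> / 2 * infdist x (W i) + R1 \<and>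
        dist x' y \<le> (1 - c) ^ k * infdist x (W i) \<and> dist x' y \<le> infdist x' (W i))"
    using Suc.IH[OF e2(1)] by blast
  obtain R2 where R2: "R2 \<ge> 0" "\<And>i x y. i \<in> I \<Longrightarrow> dist x y \<le> c * infdist x (W i) \<Longrightarrow>
      dist (q i x) (q i y) \<le> \<epsilon> / 6 * infdist x (W i) + R2"
    using contr[OF e2(2)] by blast
  show ?case
  proof (intro exI[of _ "R1 + R2"] conjI ballI allI impI)
    fix i x y assume i: "i \<in> I" and xy: "dist x y \<le> infdist x (W i)"
    obtain x' where x': "dist (q i x) (q i x') \<le> \<epsilon> / 2 * infdist x (W i) + R1"
      "dist x' y \<le> (1 - c) ^ k * infdist x (W i)" "dist x' y \<le> infdist x' (W i)"
      using R1(2)[OF i xy] by blast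
    have "0 \<le> c * dist x' y" "c * dist x' y \<le> dist x' y"
      using c mult_right_mono[OF c(2), of "dist x' y"] by auto
    then obtain m where m: "dist x' m = c * dist x' y" "dist m y = dist x' y - c * dist x' y"
      using geodesic_point[OF X] by blast
    have "(1 - c) ^ k \<le> 1"
      using c by (simp add: power_le_one)
    then have "(1 - c) ^ k * infdist x (W i) \<le> 1 * infdist x (W i)"
      by (intro mult_right_mono infdist_nonneg)
    then have x'y: "dist x' y \<le> infdist x (W i)"
      using x'(2) by linarith
    have "infdist x' (W i) \<le> infdist x (W i) + dist x' x"
      by (rule infdist_triangle)
    also have "\<dots> \<le> 3 * infdist x (W i)"
      using dist_triangle[of x' x y] x'y xy by (simp add: dist_commute)
    finally have x'W: "infdist x' (W i) \<le> 3 * infdist x (W i)" .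
    have "dist x' m \<le> c * infdist x' (W i)"
      unfolding m(1) using x'(3) c(1) by (intro mult_left_mono) auto
    then have "dist (q i x') (q i m) \<le> \<epsilon> / 6 * infdist x' (W i) + R2"
      by (rule R2(2)[OF i])
    also have "\<dots> \<le> \<epsilon> / 6 * (3 * infdist x (W i)) + R2"
      using x'W e2 by (intro add_right_mono mult_left_mono) auto
    finally have "dist (q i x) (q i m) \<le> \<epsilon> * infdist x (W i) + (R1 + R2)"
      using dist_triangle[of "q i x" "q i m" "q i x'"] x'(1) by (simp add: field_simps)
    moreover have "dist m y \<le> (1 - c) ^ Suc k * infdist x (W i)"
      using mult_left_mono[OF x'(2), of "1 - c"] c m(2) by (simp add: algebra_simps)
    \<comment> \<open>The invariant survives: the step lowers the distance to \<open>y\<close> by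
      its full length and the distance to \<open>W i\<close> by no more.\<close>
    moreover have "dist m y \<le> infdist m (W i)"
      using infdist_triangle[of x' "W i" m] m x'(3) by linarith
    ultimately show "\<exists>x'. dist (q i x) (q i x') \<le> \<epsilon> * infdist x (W i) + (R1 + R2) \<and>
        dist x' y \<le> (1 - c) ^ Suc k * infdist x (W i) \<and> dist x' y \<le> infdist x' (W i)"
      by blast
  qed (use R1(1) R2(1) in auto)
qed

lemma quasi_projection_full_contraction:
  fixes W :: "'i \<Rightarrow> 'a::metric_space set" and q :: "'i \<Rightarrow> 'a \<Rightarrow> 'a"
  assumes X: "proper_geodesic_space TYPE('a)"
    and W: "\<And>i. i \<in> I \<Longrightarrow> closed (W i)" "\<And>i. i \<in> I \<Longrightarrow> W i \<noteq> {}"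
    and C: "0 \<le> C" "\<And>i x w. i \<in> I \<Longrightarrow> w \<in> W i \<Longrightarrow> dist (q i x) w \<le> C * dist x w + C"
    and c: "0 < c" "c \<le> 1"
    and contr: "\<And>\<epsilon>. \<epsilon> > 0 \<Longrightarrow> \<exists>R\<ge>0. \<forall>i\<in>I. \<forall>x y. dist x y \<le> c * infdist x (W i) \<longrightarrow>
        dist (q i x) (q i y) \<le> \<epsilon> * infdist x (W i) + R"
    and e: "\<epsilon> > 0"
  shows "\<exists>R\<ge>0. \<forall>i\<in>I. \<forall>x y. dist x y \<le> infdist x (W i) \<longrightarrow>
        dist (q i x) (q i y) \<le> \<epsilon> * infdist x (W i) + R"
proof -
  \<comment> \<open>With \<open>\<delta> = (1 - c) ^ k\<close> this makes
    \<open>3 * C * \<delta> / c\<close> at most \<open>\<epsilon> / 2\<close>, the cost of the case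
    below in which contraction does not apply.\<close>
  have "\<exists>k. (1 - c) ^ k < \<epsilon> * c / (6 * (C + 1))"
    using c C(1) e by (intro real_arch_pow_inv) (auto intro!: divide_pos_pos)
  then obtain k where k: "(1 - c) ^ k < \<epsilon> * c / (6 * (C + 1))"
    by blast
  define \<delta> where "\<delta> = (1 - c) ^ k"
  have d0: "0 \<le> \<delta>" using c by (simp add: \<delta>_def)
  have "\<delta> * (6 * (C + 1)) \<le> \<epsilon> * c"
    using k C(1) by (simp add: \<delta>_def field_simps)
  then have d1: "6 * (C * \<delta>) \<le> \<epsilon> * c"
    using d0 by (simp add: algebra_simps)
  have e2: "\<epsilon> / 2 > 0" "\<epsilon> / 6 > 0"
    using e by auto
  obtain R1 where R1: "R1 \<ge> 0" "\<And>i x y. i \<in> I \<Longrightarrow> dist x y \<le> infdist x (W i) \<Longrightarrow>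
      (\<exists>x'. dist (q i x) (q i x') \<le> \<epsilon> / 2 * infdist x (W i) + R1 \<and>
        dist x' y \<le> \<delta> * infdist x (W i) \<and> dist x' y \<le> infdist x' (W i))"
    using quasi_projection_steps[OF X c contr e2(1), where k = k] unfolding \<delta>_def by blast
  obtain R2 where R2: "R2 \<ge> 0" "\<And>i x y. i \<in> I \<Longrightarrow> dist x y \<le> c * infdist x (W i) \<Longrightarrow>
      dist (q i x) (q i y) \<le> \<epsilon> / 6 * infdist x (W i) + R2"
    using contr[OF e2(2)] by blast
  show ?thesis
  proof (intro exI[of _ "R1 + R2 + 2 * C"] conjI ballI allI impI)
    fix i x y assume i: "i \<in> I" and xy: "dist x y \<le> infdist x (W i)"
    define r where "r = infdist x (W i)"
    have r0: "0 \<le> r" by (simp add: r_def infdist_nonneg)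
    obtain x' where x': "dist (q i x) (q i x') \<le> \<epsilon> / 2 * r + R1"
      "dist x' y \<le> \<delta> * r" "dist x' y \<le> infdist x' (W i)"
      using R1(2)[OF i xy] unfolding r_def by blast
    have d1r: "6 * (C * (\<delta> * r)) \<le> \<epsilon> * c * r"
      using mult_right_mono[OF d1 r0] by (simp add: algebra_simps)
    have "dist (q i x') (q i y) \<le> \<epsilon> / 2 * r + R2 + 2 * C"
    \<comment> \<open>If \<open>y\<close> is outside the small ball about \<open>x'\<close>, then
      \<open>x'\<close> is within \<open>\<delta> * r / c\<close> of \<open>W i\<close> and
      \<open>y\<close> within twice that of the same closest point \<open>w\<close>, so the linear
      bound puts both images near \<open>w\<close>.\<close>
    proof (cases "dist x' y \<le> c * infdist x' (W i)")
      case True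
      have "\<delta> \<le> 1" using c by (simp add: \<delta>_def power_le_one)
      then have "dist x' y \<le> r"
        using x'(2) mult_right_mono[of \<delta> 1 r] r0 by simp
      then have "infdist x' (W i) \<le> 3 * r"
        using infdist_triangle[of x' "W i" x] dist_triangle[of x' x y] xy
        by (simp add: r_def dist_commute)
      then have "\<epsilon> / 6 * infdist x' (W i) \<le> \<epsilon> / 6 * (3 * r)"
        using e2 by (intro mult_left_mono) auto
      then show ?thesis
        using R2(2)[OF i True] C(1) by (simp add: field_simps)
    next
      case False
      obtain w where w: "w \<in> closest_proj (W i) x'"
        using closest_proj_exists[OF X W(1)[OF i] W(2)[OF i]] by blast
      have w': "w \<in> W i" "dist x' w = infdist x' (W i)"
        using closest_projD[OF w] by auto
      have cw: "c * dist x' w \<le> \<delta> * r"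
        using False x'(2) w'(2) by simp
      have "c * dist y w \<le> c * dist x' y + c * dist x' w"
        using dist_triangle[of y w x'] c(1) mult_left_mono[of "dist y w" "dist x' y + dist x' w" c]
        by (simp add: dist_commute algebra_simps)
      also have "\<dots> \<le> 2 * (\<delta> * r)"
        using cw x'(2) mult_right_mono[OF c(2), of "dist x' y"] by simp
      finally have cy: "c * dist y w \<le> 2 * (\<delta> * r)" .
      have "c * (C * dist x' w + C * dist y w) = C * (c * dist x' w + c * dist y w)"
        by (simp add: algebra_simps)
      also have "\<dots> \<le> C * (3 * (\<delta> * r))"
        using cw cy C(1) by (intro mult_left_mono) auto
      also have "\<dots> \<le> c * (\<epsilon> / 2 * r)"
        using d1r by (simp add: algebra_simps)
      finally have "C * dist x' w + C * dist y w \<le> \<epsilon> / 2 * r"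
        using c(1) by simp
      then show ?thesis
        using C(2)[OF i w'(1), of x'] C(2)[OF i w'(1), of y]
          dist_triangle[of "q i x'" "q i y" w] R2(1) by (simp add: dist_commute)
    qed
    then show "dist (q i x) (q i y) \<le> \<epsilon> * infdist x (W i) + (R1 + R2 + 2 * C)"
      using x'(1) dist_triangle[of "q i x" "q i y" "q i x'"] unfolding r_def[symmetric]
      by (simp add: field_simps)
  qed (use R1(1) R2(1) C(1) in auto)
qed

text \<open>A closest point \<open>u\<close> to \<open>x\<close> lies at distance exactly
  \<open>infdist x (W i)\<close>, so full contraction compares \<open>q i x\<close> with
  \<open>q i u\<close>, and the linear bound at distance 0 puts \<open>q i u\<close> within
  \<open>C\<close> of \<open>u\<close>. The slopes add up: a quarter of \<open>\<epsilon>\<close> at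
  \<open>x\<close>, a quarter between, two quarters at \<open>y\<close>.\<close>

lemma quasi_projection_uniformly_contracting:
  fixes W :: "'i \<Rightarrow> 'a::metric_space set" and q :: "'i \<Rightarrow> 'a \<Rightarrow> 'a"
  assumes X: "proper_geodesic_space TYPE('a)"
    and W: "\<And>i. i \<in> I \<Longrightarrow> closed (W i)" "\<And>i. i \<in> I \<Longrightarrow> W i \<noteq> {}"
    and C: "0 \<le> C" "\<And>i x w. i \<in> I \<Longrightarrow> w \<in> W i \<Longrightarrow> dist (q i x) w \<le> C * dist x w + C"
    and c: "0 < c" "c \<le> 1"
    and contr: "\<And>\<epsilon>. \<epsilon> > 0 \<Longrightarrow> \<exists>R\<ge>0. \<forall>i\<in>I. \<forall>x y. dist x y \<le> c * infdist x (W i) \<longrightarrow>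
        dist (q i x) (q i y) \<le> \<epsilon> * infdist x (W i) + R"
  shows "uniformly_contracting (W ` I)"
  unfolding uniformly_contracting_def
proof (intro allI impI)
  fix \<epsilon> :: real assume "\<epsilon> > 0"
  then have e4: "\<epsilon> / 4 > 0" by simp
  obtain R where R: "R \<ge> 0" "\<And>i x y. i \<in> I \<Longrightarrow> dist x y \<le> infdist x (W i) \<Longrightarrow>
      dist (q i x) (q i y) \<le> \<epsilon> / 4 * infdist x (W i) + R"
    using quasi_projection_full_contraction[OF X W C c contr e4] by blast
  have near: "dist (q i x) u \<le> \<epsilon> / 4 * infdist x (W i) + R + C"
    if "i \<in> I" "u \<in> closest_proj (W i) x" for i x u
    using R(2)[OF that(1), of x u] closest_projD[OF that(2)] C(2)[OF that(1), of u u]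
      dist_triangle[of "q i x" u "q i u"] by simp
  have "dist u v \<le> \<epsilon> * infdist x (W i) + (3 * R + 2 * C)"
    if i: "i \<in> I" and uv: "u \<in> closest_proj (W i) x" "v \<in> closest_proj (W i) y"
      and xy: "dist x y \<le> infdist x (W i)" for i x y u v
  proof -
    have "infdist y (W i) \<le> 2 * infdist x (W i)"
      using infdist_triangle[of y "W i" x] xy by (simp add: dist_commute)
    then have "\<epsilon> / 4 * infdist y (W i) \<le> \<epsilon> / 4 * (2 * infdist x (W i))"
      using e4 by (intro mult_left_mono) auto
    moreover have "dist u v \<le> dist (q i x) u + dist (q i x) (q i y) + dist (q i y) v"
      by metric
    ultimately show ?thesis
      using near[OF i uv(1)] near[OF i uv(2)] R(2)[OF i xy] by (simp add: field_simps)
  qed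
  then show "\<exists>R\<ge>0. \<forall>Z\<in>W ` I. \<forall>x y. \<forall>u\<in>closest_proj Z x. \<forall>v\<in>closest_proj Z y.
        dist x y \<le> infdist x Z \<longrightarrow> dist u v \<le> \<epsilon> * infdist x Z + R"
    using R(1) C(1) by (intro exI[of _ "3 * R + 2 * C"]) auto
qed

section \<open>Invariance of contraction under finite Hausdorff distance\<close>

definition hausdorff_within :: "real \<Rightarrow> 'a::metric_space set \<Rightarrow> 'a set \<Rightarrow> bool" where
  "hausdorff_within D S T \<longleftrightarrow> (\<forall>x\<in>S. \<exists>y\<in>T. dist x y \<le> D) \<and> (\<forall>y\<in>T. \<exists>x\<in>S. dist y x \<le> D)"

lemma infdist_hausdorff_within:
  assumes "hausdorff_within D S T" "S \<noteq> {}"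
  shows "infdist x T \<le> infdist x S + D"
proof -
  have "infdist x T - D \<le> dist x s" if s: "s \<in> S" for s
  proof -
    obtain t where "t \<in> T" "dist s t \<le> D"
      using assms(1) s unfolding hausdorff_within_def by blast
    then show ?thesis
      using infdist_le[of t T x] dist_triangle[of x t s] by linarith
  qed
  then have "infdist x T - D \<le> infdist x S"
    using assms(2) by (simp add: infdist_def cINF_greatest)
  then show ?thesis by simp
qed

lemma hausdorff_within_sym: "hausdorff_within D S T \<Longrightarrow> hausdorff_within D T S"
  unfolding hausdorff_within_def by blast

lemma hausdorff_within_trans:
  assumes "hausdorff_within D S T" "hausdorff_within E T V"
  shows "hausdorff_within (D + E) S V"
proof -
  have *: "\<exists>v\<in>V. dist x v \<le> D + E"
    if H: "hausdorff_within D S T" "hausdorff_within E T V" "x \<in> S" for S T V :: "'a set" and x D E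
  proof -
    obtain y where y: "y \<in> T" "dist x y \<le> D"
      using H unfolding hausdorff_within_def by blast
    obtain v where v: "v \<in> V" "dist y v \<le> E"
      using H y(1) unfolding hausdorff_within_def by blast
    have "dist x v \<le> D + E"
      using dist_triangle[of x v y] y v by linarith
    then show ?thesis
      using v(1) by blast
  qed
  show ?thesis
    using *[OF assms] *[OF hausdorff_within_sym[OF assms(2)] hausdorff_within_sym[OF assms(1)]]
    unfolding hausdorff_within_def by (metis add.commute)
qed

text \<open>\<open>hausdorff_within\<close> asks for actual witnesses at distance at most
  \<open>D\<close>; approximating a point of the closure within 1 accounts for the added 1.\<close>

lemma hausdorff_within_closure:
  assumes "hausdorff_within D S T"
  shows "hausdorff_within (D + 1) (closure S) (closure T)"
proof -
  have *: "\<exists>y\<in>closure T. dist x y \<le> D + 1" if H: "hausdorff_within D S T" "x \<in> closure S"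
    for S T :: "'a set" and x
  proof -
    obtain s where s: "s \<in> S" "dist s x < 1"
      using \<open>x \<in> closure S\<close> by (meson closure_approachable zero_less_one)
    obtain t where "t \<in> T" "dist s t \<le> D"
      using H(1) s(1) unfolding hausdorff_within_def by blast
    then show ?thesis
      using s(2)
        dist_triangle[of x t s] closure_subset[of T] by (intro bexI[of _ t]) (auto simp: dist_commute)
  qed
  show ?thesis
    using *[OF assms] *[OF hausdorff_within_sym[OF assms]]
    unfolding hausdorff_within_def by blast
qed

lemma uniformly_contracting_hausdorff:
  fixes Z :: "'a::metric_space set"
  assumes X: "proper_geodesic_space TYPE('a)"
    and Z: "closed Z" "Z \<noteq> {}" "uniformly_contracting {Z}"
    and W: "\<And>w. w \<in> \<W> \<Longrightarrow> closed w" "\<And>w. w \<in> \<W> \<Longrightarrow> w \<noteq> {}"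
      "\<And>w. w \<in> \<W> \<Longrightarrow> hausdorff_within D Z w"
  shows "uniformly_contracting \<W>"
proof (cases "\<W> = {}")
  case True
  then show ?thesis
    by (auto simp: uniformly_contracting_def)
next
  case False
  obtain z w where "z \<in> Z" "w \<in> \<W>"
    using False Z(2) by blast
  then obtain v where "dist z v \<le> D"
    using W(3) unfolding hausdorff_within_def by blast
  then have D: "D \<ge> 0"
    using order_trans[OF zero_le_dist] by blast
  have "\<exists>u. u \<in> closest_proj Z x" for x
    using closest_proj_exists[OF X Z(1,2)] by blast
  then obtain q where q: "\<And>x. q x \<in> closest_proj Z x"
    by metis
  have near: "infdist x Z \<le> infdist x w + D" "infdist x w \<le> infdist x Z + D" if "w \<in> \<W>" for x w
    using infdist_hausdorff_within[OF W(3)[OF that] Z(2)]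
      infdist_hausdorff_within[OF hausdorff_within_sym[OF W(3)[OF that]] W(2)[OF that]] by auto
  have "uniformly_contracting ((\<lambda>w. w) ` \<W>)"
  proof (rule quasi_projection_uniformly_contracting[OF X W(1,2), where C = "D + 2" and c = "1/2"
        and q = "\<lambda>w. q"])
    show "dist (q x) v \<le> (D + 2) * dist x v + (D + 2)" if "w \<in> \<W>" "v \<in> w" for w x v
    proof -
      have "dist (q x) v \<le> infdist x Z + dist x v"
        using dist_triangle[of "q x" v x] closest_projD[OF q[of x]] by (simp add: dist_commute)
      also have "\<dots> \<le> 2 * dist x v + D"
        using near(1)[OF that(1), of x] infdist_le[OF that(2), of x] by linarith
      also have "\<dots> \<le> (D + 2) * dist x v + (D + 2)"
        using D by (simp add: algebra_simps)
      finally show ?thesis .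
    qed
  next
    fix \<epsilon> :: real assume e: "\<epsilon> > 0"
    have "\<exists>R\<ge>0. \<forall>x y. \<forall>u\<in>closest_proj Z x. \<forall>v\<in>closest_proj Z y.
        dist x y \<le> infdist x Z \<longrightarrow> dist u v \<le> \<epsilon> * infdist x Z + R"
      using Z(3) e unfolding uniformly_contracting_def by simp
    then obtain R where R: "R \<ge> 0" "\<And>x y. dist x y \<le> infdist x Z \<Longrightarrow>
        dist (q x) (q y) \<le> \<epsilon> * infdist x Z + R"
      using q by meson
    show "\<exists>R\<ge>0. \<forall>w\<in>\<W>. \<forall>x y. dist x y \<le> 1 / 2 * infdist x w \<longrightarrow>
        dist (q x) (q y) \<le> \<epsilon> * infdist x w + R"
    proof (intro exI[of _ "R + \<epsilon> * D + 4 * D"] conjI ballI allI impI)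
      fix w x y assume w: "w \<in> \<W>" and xy: "dist x y \<le> 1 / 2 * infdist x w"
      show "dist (q x) (q y) \<le> \<epsilon> * infdist x w + (R + \<epsilon> * D + 4 * D)"
      proof (cases "dist x y \<le> infdist x Z")
        case True
        have "\<epsilon> * infdist x Z \<le> \<epsilon> * (infdist x w + D)"
          using near(1)[OF w, of x] e by (intro mult_left_mono) auto
        then show ?thesis
          using R(2)[OF True] D by (simp add: algebra_simps)
      next
        case False
        then have "infdist x Z \<le> D" "dist x y \<le> D"
          using near(2)[OF w, of x] xy by auto
        then have "dist (q x) (q y) \<le> 4 * D"
          using dist_closest_proj_le[OF q q, of x y] infdist_triangle[of y Z x] by (simp add: dist_commute)
        moreover have "0 \<le> \<epsilon> * infdist x w" "0 \<le> \<epsilon> * D"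
          using e D by (auto simp: infdist_nonneg)
        ultimately show ?thesis
          using R(1) by linarith
      qed
    qed (use R(1) D e in auto)
  qed (use D in auto)
  then show ?thesis by simp
qed

lemma contracting_hausdorff:
  fixes S T :: "'a::metric_space set"
  assumes "proper_geodesic_space TYPE('a)" "contracting S" "hausdorff_within D S T" "S \<noteq> {}"
  shows "contracting T"
proof -
  have "T \<noteq> {}"
    using assms(3,4) by (auto simp: hausdorff_within_def)
  moreover have "uniformly_contracting {closure T}"
    by (rule uniformly_contracting_hausdorff[OF assms(1), of "closure S" _ "D + 1"])
      (use assms \<open>T \<noteq> {}\<close> hausdorff_within_closure[OF assms(3)] in
        \<open>auto simp: contracting_imp_uniformly_contracting\<close>)
  ultimately show ?thesis
    by (intro uniformly_contracting_imp_contracting)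
qed


section \<open>Quasi-isometric embeddings and contraction\<close>

lemma qi_embedding_onD:
  assumes "qi_embedding_on L A S f" "L \<ge> 1" "x \<in> S" "y \<in> S"
  shows "dist (f x) (f y) \<le> L * dist x y + A" "dist x y \<le> L * (dist (f x) (f y) + A)"
proof -
  have "1 / L * dist x y - A \<le> dist (f x) (f y)" "dist (f x) (f y) \<le> L * dist x y + A"
    using assms unfolding qi_embedding_on_def by blast+
  then show "dist (f x) (f y) \<le> L * dist x y + A" "dist x y \<le> L * (dist (f x) (f y) + A)"
    using assms(2) by (simp_all add: field_simps)
qed

lemma qi_embedding_onI:
  assumes "L \<ge> 1" "\<And>x y. x \<in> S \<Longrightarrow> y \<in> S \<Longrightarrow> dist (f x) (f y) \<le> L * dist x y + A"
    and "\<And>x y. x \<in> S \<Longrightarrow> y \<in> S \<Longrightarrow> dist x y \<le> L * (dist (f x) (f y) + A)"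
  shows "qi_embedding_on L A S f"
  unfolding qi_embedding_on_def
proof (intro ballI conjI)
  fix x y assume "x \<in> S" "y \<in> S"
  then show "dist (f x) (f y) \<le> L * dist x y + A" "1 / L * dist x y - A \<le> dist (f x) (f y)"
    using assms(2)[of x y] assms(3)[of x y] assms(1) by (simp_all add: field_simps)
qed

lemma closure_within_one:
  assumes "w \<in> closure S"
  obtains s where "s \<in> S" "dist s w \<le> 1"
  using assms closure_approachable[of w S] by (metis less_eq_real_def zero_less_one)

text \<open>The coarse projection of the target to \<open>\<phi> ` S\<close> is \<open>\<phi> (v x)\<close>: project \<open>x\<close> to \<open>z x\<close> in the image of
  \<open>\<phi>\<close>, lift to \<open>a x\<close>, and project to \<open>v x\<close> in \<open>S\<close>.\<close>

locale contracting_pair =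
  fixes \<phi> :: "'a::metric_space \<Rightarrow> 'b::metric_space" and L A :: real and S :: "'a set"
    and z :: "'b \<Rightarrow> 'b" and a :: "'b \<Rightarrow> 'a" and v :: "'b \<Rightarrow> 'a"
  assumes L: "L \<ge> 1" and A: "A \<ge> 0" and qi: "qi_embedding_on L A UNIV \<phi>"
    and S: "S \<noteq> {}"
    and z: "\<And>x. z x \<in> closest_proj (closure (range \<phi>)) x"
    and a: "\<And>x. dist (\<phi> (a x)) (z x) \<le> 1"
    and v: "\<And>x. v x \<in> closest_proj (closure S) (a x)"
begin

lemma qi_up: "dist (\<phi> s) (\<phi> t) \<le> L * dist s t + A"
  and qi_lo: "dist s t \<le> L * (dist (\<phi> s) (\<phi> t) + A)"
  using qi_embedding_onD[OF qi L] by auto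

text \<open>The closest point \<open>z x\<close> of the image is no farther from \<open>x\<close>
  than \<open>w\<close> is, so \<open>\<phi> (a x)\<close> and \<open>\<phi> s\<close> are both near
  \<open>x\<close>; the lower bound for \<open>\<phi>\<close> brings this back to the
  source.\<close>

lemma lift_near:
  assumes "s \<in> S" "dist (\<phi> s) w \<le> 1" "w \<in> closure (\<phi> ` S)"
  shows "dist (a x) s \<le> L * (2 * dist x w + 2 + A)"
proof -
  have "w \<in> closure (range \<phi>)"
    using assms(3) closure_mono[of "\<phi> ` S" "range \<phi>"] by auto
  then have "dist x (z x) \<le> dist x w"
    using closest_projD[OF z[of x]] infdist_le by metis
  then have "dist (\<phi> (a x)) (\<phi> s) \<le> 2 * dist x w + 2"
    using a[of x] assms(2) dist_triangle[of "\<phi> (a x)" "\<phi> s" "z x"] dist_triangle[of "z x" "\<phi> s" x]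
      dist_triangle[of x "\<phi> s" w] by (simp add: dist_commute)
  then have "L * (dist (\<phi> (a x)) (\<phi> s) + A) \<le> L * (2 * dist x w + 2 + A)"
    using L by (intro mult_left_mono) auto
  then show ?thesis
    using qi_lo order_trans by blast
qed

lemma projection_linear_bound:
  assumes w: "w \<in> closure (\<phi> ` S)"
  shows "dist (\<phi> (v x)) w \<le> (4 * L * L + 2 * L * L * (2 + A) + A + 1) * dist x w
      + (4 * L * L + 2 * L * L * (2 + A) + A + 1)"
proof -
  obtain s where s: "s \<in> S" "dist (\<phi> s) w \<le> 1"
    using closure_within_one[OF w] by auto
  have "dist (a x) (v x) \<le> dist (a x) s"
    using closest_projD[OF v[of x]] infdist_le[of s "closure S" "a x"] s(1) closure_subset[of S] by auto
  then have "dist (v x) s \<le> 2 * dist (a x) s"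
    using dist_triangle[of "v x" s "a x"] by (simp add: dist_commute)
  also have "\<dots> \<le> 2 * (L * (2 * dist x w + 2 + A))"
    using lift_near[OF s w, of x] by simp
  finally have "L * dist (v x) s \<le> L * (2 * (L * (2 * dist x w + 2 + A)))"
    using L by (intro mult_left_mono) auto
  then have "dist (\<phi> (v x)) w \<le> L * (2 * (L * (2 * dist x w + 2 + A))) + A + 1"
    using qi_up[of "v x" s] s(2) dist_triangle[of "\<phi> (v x)" w "\<phi> s"] by simp
  also have "\<dots> = 4 * L * L * dist x w + (2 * L * L * (2 + A) + A + 1)"
    by (simp add: algebra_simps)
  also have "\<dots> \<le> (4 * L * L + 2 * L * L * (2 + A) + A + 1) * dist x w
      + (4 * L * L + 2 * L * L * (2 + A) + A + 1)"
  proof -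
    have "0 \<le> (2 * L * L * (2 + A) + A + 1) * dist x w" "0 \<le> 4 * L * L"
      using L A by auto
    then show ?thesis
      unfolding distrib_right by linarith
  qed
  finally show ?thesis .
qed

text \<open>If \<open>a y\<close> is no farther from \<open>a x\<close> than \<open>S\<close> is,
  contraction of \<open>S\<close> applies. Otherwise the projections to \<open>S\<close> move at
  most four times as far as the lifts, and contraction of the image of \<open>\<phi>\<close>
  controls the lifts unless \<open>x\<close> is nearer to that image than to \<open>y\<close>. In
  this last case the lifts move linearly in \<open>dist x y\<close>, and the image of
  \<open>S\<close> is within about \<open>5 * L * L * dist x y\<close> of \<open>x\<close>; the
  factor 16 in the hypothesis then bounds \<open>dist x y\<close>.\<close>

lemma projection_step:
  assumes e: "\<epsilon> > 0" "R1 \<ge> 0" "R2 \<ge> 0"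
    and R1: "\<And>x y. dist x y \<le> infdist x (closure (range \<phi>)) \<Longrightarrow>
        dist (z x) (z y) \<le> \<epsilon> / (4 * L * L) * infdist x (closure (range \<phi>)) + R1"
    and R2: "\<And>x y. dist (a x) (a y) \<le> infdist (a x) (closure S) \<Longrightarrow>
        dist (v x) (v y) \<le> \<epsilon> / (2 * L * L) * infdist (a x) (closure S) + R2"
    and w: "w \<in> closest_proj (closure (\<phi> ` S)) x"
    and xy: "16 * L * L * dist x y \<le> infdist x (closure (\<phi> ` S))"
  shows "L * dist (v x) (v y) \<le> \<epsilon> * infdist x (closure (\<phi> ` S)) +
     (\<epsilon> * (2 + A) + L * R2 + 4 * L * L * (R1 + (2 + A)) + 8 * L * L * (2 + A) + 8 * (1 + A + L))"
proof -
  define r where "r = infdist x (closure (\<phi> ` S))"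
  define D where "D = infdist (a x) (closure S)"
  have r: "dist x w = r" "w \<in> closure (\<phi> ` S)" "r \<ge> 0"
    using closest_projD[OF w] by (auto simp: r_def infdist_nonneg)
  have LL: "L * L \<ge> 1"
    using L mult_mono[of 1 L 1 L] by simp
  have pos: "0 \<le> L * R2" "0 \<le> L * L * (R1 + (2 + A))" "0 \<le> \<epsilon> * (2 + A)" "0 \<le> \<epsilon> * r"
    "0 \<le> L * L * (2 + A)"
    using e A L r by auto
  define p1 p2 p3 where "p1 = \<epsilon> * (2 + A)" and "p2 = L * (L * (R1 + (2 + A)))" and "p3 = L * (L * (2 + A))"
  have zr: "infdist x (closure (range \<phi>)) \<le> r"
    unfolding r_def using S by (intro infdist_mono closure_mono) auto
  obtain s where s: "s \<in> S" "dist (\<phi> s) w \<le> 1"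
    using closure_within_one[OF r(2)] by auto
  have "D \<le> dist (a x) s"
    unfolding D_def using s(1) closure_subset by (intro infdist_le) auto
  also have "\<dots> \<le> L * (2 * r + 2 + A)"
    using lift_near[OF s r(2), of x] r(1) by simp
  finally have Dup: "D \<le> L * (2 * r + 2 + A)" .
  show ?thesis
    unfolding r_def[symmetric]
  proof (cases "dist (a x) (a y) \<le> D")
    case True
    have "L * dist (v x) (v y) \<le> L * (\<epsilon> / (2 * L * L) * D + R2)"
      using R2[of x y] True L unfolding D_def by (intro mult_left_mono) auto
    also have "\<dots> \<le> L * (\<epsilon> / (2 * L * L) * (L * (2 * r + 2 + A)) + R2)"
      using L e(1) Dup by (intro mult_left_mono add_right_mono) auto
    also have "\<dots> = \<epsilon> * r + \<epsilon> * (2 + A) / 2 + L * R2"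
      using L by (simp add: field_simps)
    also have "\<dots> \<le> \<epsilon> * r + \<epsilon> * (2 + A) + L * R2"
      using pos(3) by simp
    finally show "L * dist (v x) (v y) \<le> \<epsilon> * r + (\<epsilon> * (2 + A) + L * R2 + 4 * L * L * (R1 + (2 + A))
        + 8 * L * L * (2 + A) + 8 * (1 + A + L))"
      using pos A L unfolding mult.assoc p1_def[symmetric] p2_def[symmetric] p3_def[symmetric]
      unfolding distrib_left by linarith
  next
    case False
    have "infdist (a y) (closure S) \<le> D + dist (a x) (a y)"
      using infdist_triangle[of "a y" "closure S" "a x"] by (simp add: D_def dist_commute)
    then have "dist (v x) (v y) \<le> 4 * dist (a x) (a y)"
      using dist_closest_proj_le[OF v v, of x y] False by (simp add: D_def)
    then have vxy: "L * dist (v x) (v y) \<le> L * (4 * dist (a x) (a y))"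
      using L by (intro mult_left_mono) auto
    show "L * dist (v x) (v y) \<le> \<epsilon> * r + (\<epsilon> * (2 + A) + L * R2 + 4 * L * L * (R1 + (2 + A))
        + 8 * L * L * (2 + A) + 8 * (1 + A + L))"
    proof (cases "dist x y \<le> infdist x (closure (range \<phi>))")
      case True
      have "\<epsilon> / (4 * L * L) * infdist x (closure (range \<phi>)) \<le> \<epsilon> / (4 * L * L) * r"
        using zr e(1) L by (intro mult_left_mono) auto
      then have "dist (z x) (z y) \<le> \<epsilon> / (4 * L * L) * r + R1"
        using R1[OF True] by linarith
      then have "dist (\<phi> (a x)) (\<phi> (a y)) \<le> \<epsilon> / (4 * L * L) * r + R1 + 2"
        using a[of x] a[of y] dist_triangle[of "\<phi> (a x)" "\<phi> (a y)" "z x"]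
          dist_triangle[of "z x" "\<phi> (a y)" "z y"] by (simp add: dist_commute)
      then have "L * (dist (\<phi> (a x)) (\<phi> (a y)) + A) \<le> L * (\<epsilon> / (4 * L * L) * r + R1 + (2 + A))"
        using L by (intro mult_left_mono) auto
      then have "dist (a x) (a y) \<le> L * (\<epsilon> / (4 * L * L) * r + R1 + (2 + A))"
        using qi_lo order_trans by blast
      then have "L * (4 * dist (a x) (a y)) \<le> L * (4 * (L * (\<epsilon> / (4 * L * L) * r + R1 + (2 + A))))"
        using L by (intro mult_left_mono) auto
      also have "\<dots> = \<epsilon> * r + 4 * L * L * (R1 + (2 + A))"
        using L by (simp add: field_simps)
      finally show ?thesis
        using vxy pos A L unfolding mult.assoc p1_def[symmetric] p2_def[symmetric] p3_def[symmetric]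
      unfolding distrib_left by linarith
    next
      case False
      then have zx: "infdist x (closure (range \<phi>)) \<le> dist x y" by simp
      then have zy: "infdist y (closure (range \<phi>)) \<le> 2 * dist x y"
        using infdist_triangle[of y "closure (range \<phi>)" x] by (simp add: dist_commute)
      have "dist (\<phi> (a x)) (\<phi> (a y)) \<le> 1 + dist (z x) (z y) + 1"
        using a[of x] a[of y] dist_triangle[of "\<phi> (a x)" "\<phi> (a y)" "z x"]
          dist_triangle[of "z x" "\<phi> (a y)" "z y"] by (simp add: dist_commute)
      also have "\<dots> \<le> 4 * dist x y + 2"
        using dist_closest_proj_le[OF z z, of x y] zx zy by simp
      finally have "L * (dist (\<phi> (a x)) (\<phi> (a y)) + A) \<le> L * (4 * dist x y + 2 + A)"
        using L by (intro mult_left_mono) auto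
      then have axy: "dist (a x) (a y) \<le> L * (4 * dist x y + 2 + A)"
        using qi_lo order_trans by blast
      \<comment> \<open>A point of \<open>S\<close> itself near \<open>v x\<close>. Its image bounds
        \<open>r\<close> from above, since \<open>a x\<close> is nearer to \<open>S\<close> than to
        \<open>a y\<close>.\<close>
      obtain t where t: "t \<in> S" "dist t (v x) \<le> 1"
        using closure_within_one closest_projD(1)[OF v] by blast
      have "dist (a x) t \<le> D + 1"
        using dist_triangle[of "a x" t "v x"] t(2) closest_projD(2)[OF v[of x]]
        by (simp add: D_def dist_commute)
      then have "L * dist (a x) t \<le> L * (dist (a x) (a y) + 1)"
        using L \<open>\<not> dist (a x) (a y) \<le> D\<close> by (intro mult_left_mono) auto
      moreover have "L * dist (a x) (a y) \<le> L * (L * (4 * dist x y + 2 + A))"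
        using L axy by (intro mult_left_mono) auto
      moreover have "r \<le> dist x (\<phi> t)"
        unfolding r_def using t(1) closure_subset[of "\<phi> ` S"] by (intro infdist_le) auto
      moreover have "dist x (\<phi> t) \<le> dist x y + 1 + L * dist (a x) t + A"
        using dist_triangle[of x "\<phi> t" "z x"] dist_triangle[of "z x" "\<phi> t" "\<phi> (a x)"]
          qi_up[of "a x" t] a[of x] zx closest_projD(2)[OF z[of x]] by (simp add: dist_commute)
      ultimately have "r \<le> dist x y + 4 * (L * L * dist x y) + p3 + (L + 1 + A)"
        unfolding p3_def by (simp add: algebra_simps)
      moreover have "dist x y \<le> L * L * dist x y"
        using mult_right_mono[OF LL, of "dist x y"] by simp
      moreover have "16 * (L * L * dist x y) \<le> r"
        using xy by (simp add: r_def mult.assoc)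
      moreover have "0 \<le> p3" "0 \<le> L" "0 \<le> A"
        using L A by (auto simp: p3_def)
      ultimately have "16 * (L * L * dist x y) \<le> 2 * p3 + 2 * (L + 1 + A)"
        unfolding distrib_left by linarith
      moreover have "L * (4 * dist (a x) (a y)) \<le> L * (4 * (L * (4 * dist x y + 2 + A)))"
        using L axy by (intro mult_left_mono) auto
      moreover have "\<dots> = 16 * (L * L * dist x y) + 4 * p3"
        by (simp add: p3_def algebra_simps)
      ultimately have "L * (4 * dist (a x) (a y)) \<le> 6 * p3 + 2 * (L + 1 + A)"
        unfolding distrib_left by linarith
      then show ?thesis
        using vxy pos A L unfolding mult.assoc p1_def[symmetric] p2_def[symmetric] p3_def[symmetric]
      unfolding distrib_left by linarith
    qed
  qed
qed

end

text \<open>Contraction of \<open>S\<close> speaks only of points of the source; contraction of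
  \<open>range \<phi>\<close> controls how points of the target far from the image are lifted. The
  family consists of one set, indexed by \<open>unit\<close>.\<close>

lemma contracting_image:
  fixes \<phi> :: "'a::metric_space \<Rightarrow> 'b::metric_space"
  assumes X: "proper_geodesic_space TYPE('a)" "proper_geodesic_space TYPE('b)"
    and qi: "L \<ge> 1" "A \<ge> 0" "qi_embedding_on L A UNIV \<phi>"
    and im: "contracting (range \<phi>)" and SC: "contracting S" "S \<noteq> {}"
  shows "contracting (\<phi> ` S)"
proof -
  have "\<exists>z. z \<in> closest_proj (closure (range \<phi>)) x" for x
    using closest_proj_exists[OF X(2), of "closure (range \<phi>)"] by auto
  then obtain z where z: "\<And>x. z x \<in> closest_proj (closure (range \<phi>)) x"
    by metis
  have "\<exists>a. dist (\<phi> a) (z x) \<le> 1" for x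
    using closure_within_one[of "z x" "range \<phi>"] closest_projD(1)[OF z[of x]] by auto
  then obtain a where a: "\<And>x. dist (\<phi> (a x)) (z x) \<le> 1"
    by metis
  have "\<exists>v. v \<in> closest_proj (closure S) (a x)" for x
    using closest_proj_exists[OF X(1), of "closure S"] SC(2) by auto
  then obtain v where v: "\<And>x. v x \<in> closest_proj (closure S) (a x)"
    by metis
  interpret contracting_pair \<phi> L A S z a v
    by unfold_locales (use qi SC(2) z a v in auto)
  define C where "C = 4 * L * L + 2 * L * L * (2 + A) + A + 1"
  have "uniformly_contracting ((\<lambda>_::unit. closure (\<phi> ` S)) ` UNIV)"
  proof (rule quasi_projection_uniformly_contracting[OF X(2), where C = C and c = "1 / (16 * L * L)"
        and q = "\<lambda>_ x. \<phi> (v x)"])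
    show "dist (\<phi> (v x)) w \<le> C * dist x w + C" if "w \<in> closure (\<phi> ` S)" for x w
      unfolding C_def by (rule projection_linear_bound[OF that])
    show "0 \<le> C"
      unfolding C_def using L A by simp
    have "1 \<le> L * L"
      using L mult_mono[of 1 L 1 L] by simp
    then show "0 < 1 / (16 * L * L)" "1 / (16 * L * L) \<le> 1"
      using L by (simp_all add: field_simps)
  next
    fix \<epsilon> :: real assume e: "\<epsilon> > 0"
    have e1: "\<epsilon> / (4 * L * L) > 0" and e2: "\<epsilon> / (2 * L * L) > 0"
      using e L by auto
    obtain R1 where R1: "R1 \<ge> 0" "\<And>x y. dist x y \<le> infdist x (closure (range \<phi>)) \<Longrightarrow>
        dist (z x) (z y) \<le> \<epsilon> / (4 * L * L) * infdist x (closure (range \<phi>)) + R1"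
      using contracting_imp_uniformly_contracting[OF im, unfolded uniformly_contracting_def,
          rule_format, OF e1] z by blast
    obtain R2 where R2: "R2 \<ge> 0" "\<And>x y. dist (a x) (a y) \<le> infdist (a x) (closure S) \<Longrightarrow>
        dist (v x) (v y) \<le> \<epsilon> / (2 * L * L) * infdist (a x) (closure S) + R2"
      using contracting_imp_uniformly_contracting[OF SC(1), unfolded uniformly_contracting_def,
          rule_format, OF e2] v by blast
    define R where "R = \<epsilon> * (2 + A) + L * R2 + 4 * L * L * (R1 + (2 + A))
      + 8 * L * L * (2 + A) + 8 * (1 + A + L)"
    have "dist (\<phi> (v x)) (\<phi> (v y)) \<le> \<epsilon> * infdist x (closure (\<phi> ` S)) + (R + A)"
      if xy: "dist x y \<le> 1 / (16 * L * L) * infdist x (closure (\<phi> ` S))" for x y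
    proof -
      obtain w where w: "w \<in> closest_proj (closure (\<phi> ` S)) x"
        using closest_proj_exists[OF X(2), of "closure (\<phi> ` S)" x] SC(2) by auto
      have "16 * L * L * dist x y \<le> infdist x (closure (\<phi> ` S))"
        using xy L by (simp add: field_simps)
      then have "L * dist (v x) (v y) \<le> \<epsilon> * infdist x (closure (\<phi> ` S)) + R"
        unfolding R_def by (intro projection_step[OF e R1(1) R2(1) R1(2) R2(2) w])
      then show ?thesis
        using qi_up[of "v x" "v y"] by simp
    qed
    moreover have "0 \<le> R + A"
      unfolding R_def using e R1(1) R2(1) L A by auto
    ultimately show "\<exists>R\<ge>0. \<forall>i\<in>UNIV::unit set. \<forall>x y.
        dist x y \<le> 1 / (16 * L * L) * infdist x (closure (\<phi> ` S)) \<longrightarrow>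
        dist (\<phi> (v x)) (\<phi> (v y)) \<le> \<epsilon> * infdist x (closure (\<phi> ` S)) + R"
      by blast
  qed (use SC(2) in auto)
  then show ?thesis
    using SC(2) by (intro uniformly_contracting_imp_contracting) auto
qed


section \<open>Quasi-geodesics near contracting sets\<close>

text \<open>\<open>K\<close> is a scale beyond which the contraction of \<open>Z\<close> beats an \<open>(L, A)\<close>-quasi-geodesic.\<close>

definition contraction_scale :: "'a::metric_space set \<Rightarrow> real \<Rightarrow> real \<Rightarrow> real \<Rightarrow> bool" where
  "contraction_scale Z L A K \<longleftrightarrow> L \<ge> 1 \<and> A \<ge> 0 \<and> K \<ge> 3 * A \<and> K \<ge> 3 * L\<^sup>2 \<and>
     (\<forall>x y. \<forall>u\<in>closest_proj Z x. \<forall>v\<in>closest_proj Z y.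
        K \<le> infdist x Z \<longrightarrow> dist x y \<le> infdist x Z \<longrightarrow> 3 * L\<^sup>2 * dist u v \<le> infdist x Z)"

text \<open>With slope \<open>1 / (6 * L\<^sup>2)\<close> the contraction uses up half of the
  distance, and beyond \<open>6 * L\<^sup>2 * R\<close> the constant fits in the other half.\<close>

lemma contraction_scale_exists:
  assumes "uniformly_contracting {Z}" "L \<ge> 1" "A \<ge> 0"
  obtains K where "contraction_scale Z L A K"
proof -
  have e: "1 / (6 * L\<^sup>2) > 0"
    using assms(2) by simp
  obtain R where R: "R \<ge> 0" "\<And>x y u v. u \<in> closest_proj Z x \<Longrightarrow> v \<in> closest_proj Z y \<Longrightarrow>
      dist x y \<le> infdist x Z \<Longrightarrow> dist u v \<le> 1 / (6 * L\<^sup>2) * infdist x Z + R"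
    using assms(1)[unfolded uniformly_contracting_def, rule_format, OF e] by blast
  show thesis
  proof (rule that[of "max (max (3 * A) (3 * L\<^sup>2)) (6 * L\<^sup>2 * R)"])
    show "contraction_scale Z L A (max (max (3 * A) (3 * L\<^sup>2)) (6 * L\<^sup>2 * R))"
      unfolding contraction_scale_def
    proof (intro conjI allI ballI impI)
      fix x y u v
      assume uv: "u \<in> closest_proj Z x" "v \<in> closest_proj Z y" and xy: "dist x y \<le> infdist x Z"
        and "max (max (3 * A) (3 * L\<^sup>2)) (6 * L\<^sup>2 * R) \<le> infdist x Z"
      then have "6 * L\<^sup>2 * R \<le> infdist x Z" by simp
      moreover have "3 * L\<^sup>2 * dist u v \<le> 3 * L\<^sup>2 * (1 / (6 * L\<^sup>2) * infdist x Z + R)"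
        using R(2)[OF uv xy] by (intro mult_left_mono) auto
      moreover have "\<dots> = infdist x Z / 2 + 3 * L\<^sup>2 * R"
        using assms(2) by (simp add: field_simps)
      ultimately show "3 * L\<^sup>2 * dist u v \<le> infdist x Z"
        by simp
    qed (use assms in auto)
  qed
qed

lemma contraction_scale_mono: "contraction_scale Z L A K \<Longrightarrow> K \<le> H \<Longrightarrow> contraction_scale Z L A H"
  unfolding contraction_scale_def by (meson order_trans)

lemma qi_embedding_on_subset: "qi_embedding_on L A S f \<Longrightarrow> T \<subseteq> S \<Longrightarrow> qi_embedding_on L A T f"
  unfolding qi_embedding_on_def by blast

lemma qi_embedding_on_mono:
  assumes "qi_embedding_on L A S f" "1 \<le> L" "L \<le> L'" "A \<le> A'"
  shows "qi_embedding_on L' A' S f"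
proof (rule qi_embedding_onI)
  show "dist (f x) (f y) \<le> L' * dist x y + A'" if "x \<in> S" "y \<in> S" for x y
    using qi_embedding_onD(1)[OF assms(1,2) that] mult_right_mono[OF assms(3), of "dist x y"] assms(4)
    by simp
  show "dist x y \<le> L' * (dist (f x) (f y) + A')" if "x \<in> S" "y \<in> S" for x y
  proof -
    \<comment> \<open>The sign of \<open>A\<close> is unknown, so the factor multiplied by
      \<open>L\<close> is shown to be nonnegative from the lower bound itself.\<close>
    have "0 \<le> dist x y" by simp
    also have *: "\<dots> \<le> L * (dist (f x) (f y) + A)"
      using qi_embedding_onD(2)[OF assms(1,2) that] .
    finally have "0 \<le> dist (f x) (f y) + A"
      using assms(2) by (simp add: zero_le_mult_iff)
    then have "L * (dist (f x) (f y) + A) \<le> L' * (dist (f x) (f y) + A')"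
      using assms by (intro mult_mono) auto
    then show ?thesis
      using * by linarith
  qed
qed (use assms in auto)

text \<open>The quasi-geodesic is cut where it has moved by its distance to \<open>Z\<close>. On each piece the
  projection moves by at most \<open>1 / (2 * L)\<close> times the elapsed time, which is too slow to account for
  the distance between the endpoints.\<close>

lemma projection_advance:
  fixes \<beta> :: "real \<Rightarrow> 'a::metric_space"
  assumes X: "proper_geodesic_space TYPE('a)" and Z: "closed Z" "Z \<noteq> {}"
    and K: "contraction_scale Z L A K"
    and "a \<le> b" "continuous_on {a..b} \<beta>" "qi_embedding_on L A {a..b} \<beta>"
    and "\<And>t. t \<in> {a..b} \<Longrightarrow> K \<le> infdist (\<beta> t) Z"
    and "u \<in> closest_proj Z (\<beta> a)" "v \<in> closest_proj Z (\<beta> b)"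
  shows "6 * L * dist u v \<le> 3 * (b - a) + 2 * L * (infdist (\<beta> b) Z + A)"
proof -
  have L: "L \<ge> 1" and A: "A \<ge> 0" and KA: "K \<ge> 3 * A" and KL: "K \<ge> 3 * L\<^sup>2"
    and proj: "\<And>x y u v. u \<in> closest_proj Z x \<Longrightarrow> v \<in> closest_proj Z y \<Longrightarrow> K \<le> infdist x Z \<Longrightarrow>
      dist x y \<le> infdist x Z \<Longrightarrow> 3 * L\<^sup>2 * dist u v \<le> infdist x Z"
    using K unfolding contraction_scale_def by blast+
  \<comment> \<open>Induction over a natural number above the elapsed time: every cut advances by at
    least \<open>2 * L\<close>, because \<open>K\<close> is at least \<open>3 * A\<close> and
    \<open>3 * L\<^sup>2\<close>.\<close>
  have *: "6 * L * dist u v \<le> 3 * (b - a) + 2 * L * (infdist (\<beta> b) Z + A)"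
    if "b - a \<le> real n" "a \<le> b" "continuous_on {a..b} \<beta>" "qi_embedding_on L A {a..b} \<beta>"
      "\<And>t. t \<in> {a..b} \<Longrightarrow> K \<le> infdist (\<beta> t) Z"
      "u \<in> closest_proj Z (\<beta> a)" "v \<in> closest_proj Z (\<beta> b)" for n a u
    using that
  proof (induction n arbitrary: a u)
    case (0 a u)
    then have "a = b" by simp
    then have "3 * L\<^sup>2 * dist u v \<le> infdist (\<beta> b) Z"
      using proj[of u "\<beta> b" v "\<beta> b"] 0 infdist_nonneg[of "\<beta> b" Z] by auto
    moreover have "L * dist u v \<le> L\<^sup>2 * dist u v"
      using L by (intro mult_right_mono) (auto simp: power2_eq_square)
    moreover have "infdist (\<beta> b) Z \<le> L * (infdist (\<beta> b) Z + A)"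
      using mult_right_mono[OF L, of "infdist (\<beta> b) Z + A"] A infdist_nonneg[of "\<beta> b" Z] by simp
    ultimately show ?case
      using \<open>a = b\<close> by simp
  next
    case (Suc n a u)
    have ab: "a \<in> {a..b}" "b \<in> {a..b}"
      using Suc.prems(2) by auto
    have Ka: "K \<le> infdist (\<beta> a) Z"
      using Suc.prems(5)[OF ab(1)] .
    show ?case
    proof (cases "dist (\<beta> a) (\<beta> b) \<le> infdist (\<beta> a) Z")
      \<comment> \<open>The last piece may be too short for elapsed time to pay for its projection;
        the term with \<open>infdist (\<beta> b) Z\<close> covers the rest.\<close>
      case True
      have p: "3 * L\<^sup>2 * dist u v \<le> infdist (\<beta> a) Z"
        using proj[OF Suc.prems(6,7) Ka True] .
      have "infdist (\<beta> a) Z \<le> infdist (\<beta> b) Z + (L * (b - a) + A)"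
        using infdist_triangle[of "\<beta> a" Z "\<beta> b"] qi_embedding_onD(1)[OF Suc.prems(4) L ab]
          Suc.prems(2) by (simp add: dist_real_def)
      also have "\<dots> \<le> L * (infdist (\<beta> b) Z + A) + L * (b - a)"
        using mult_right_mono[OF L, of "infdist (\<beta> b) Z + A"] A infdist_nonneg[of "\<beta> b" Z] by simp
      finally have "L * (3 * L * dist u v) \<le> L * (infdist (\<beta> b) Z + A + (b - a))"
        using p by (simp add: power2_eq_square algebra_simps)
      then have "3 * L * dist u v \<le> infdist (\<beta> b) Z + A + (b - a)"
        using L by simp
      moreover have "infdist (\<beta> b) Z + A \<le> L * (infdist (\<beta> b) Z + A)"
        using mult_right_mono[OF L, of "infdist (\<beta> b) Z + A"] A infdist_nonneg[of "\<beta> b" Z] by simp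
      ultimately show ?thesis
        using Suc.prems(2) by (simp add: algebra_simps)
    next
      case False
      have "continuous_on {a..b} (\<lambda>t. dist (\<beta> a) (\<beta> t))"
        by (intro continuous_intros Suc.prems(3))
      then obtain t where t: "a \<le> t" "t \<le> b" "dist (\<beta> a) (\<beta> t) = infdist (\<beta> a) Z"
        using IVT'[of "\<lambda>t. dist (\<beta> a) (\<beta> t)" a "infdist (\<beta> a) Z" b] False Suc.prems(2)
        by (auto simp: infdist_nonneg)
      obtain w where w: "w \<in> closest_proj Z (\<beta> t)"
        using closest_proj_exists[OF X Z] by blast
      have tt: "t \<in> {a..b}" using t by simp
      have p: "3 * L\<^sup>2 * dist u w \<le> infdist (\<beta> a) Z"
        using proj[OF Suc.prems(6) w Ka] t(3) by simp
      have "infdist (\<beta> a) Z \<le> L * (t - a) + A"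
        using qi_embedding_onD(1)[OF Suc.prems(4) L ab(1) tt] t by (simp add: dist_real_def)
      \<comment> \<open>From \<open>K \<ge> 3 * A\<close>: at most a third of the distance covered
        is due to the additive error.\<close>
      then have d: "2 * infdist (\<beta> a) Z \<le> 3 * (L * (t - a))"
        using KA Ka by simp
      then have "L * (2 * L) \<le> L * (t - a)"
        using KL Ka by (simp add: power2_eq_square)
      then have "1 \<le> t - a"
        using L by simp
      then have "6 * L * dist w v \<le> 3 * (b - t) + 2 * L * (infdist (\<beta> b) Z + A)"
        using Suc.prems t
        by (intro Suc.IH w) (auto intro: continuous_on_subset qi_embedding_on_subset)
      moreover have "L * (6 * L * dist u w) \<le> L * (3 * (t - a))"
        using p d by (simp add: power2_eq_square algebra_simps)
      then have "6 * L * dist u w \<le> 3 * (t - a)"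
        using L by simp
      moreover have "6 * L * dist u v \<le> 6 * L * (dist u w + dist w v)"
        using L by (intro mult_left_mono dist_triangle) auto
      ultimately show ?thesis
        by (simp add: algebra_simps)
    qed
  qed
  obtain n :: nat where "b - a \<le> real n"
    using real_arch_simple by blast
  then show ?thesis
    by (rule *) (use assms in auto)
qed

text \<open>Elapsed time is controlled by the distance of the endpoints, and that distance is
  bounded through the two projections. By \<open>projection_advance\<close> their contribution is
  half of the elapsed time up to end terms, so it is absorbed on the left.\<close>

lemma excursion_duration:
  fixes \<beta> :: "real \<Rightarrow> 'a::metric_space"
  assumes X: "proper_geodesic_space TYPE('a)" and Z: "closed Z" "Z \<noteq> {}"
    and K: "contraction_scale Z L A K"
    and ab: "a \<le> b" and \<beta>: "continuous_on {a..b} \<beta>" "qi_embedding_on L A {a..b} \<beta>"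
    and far: "\<And>t. t \<in> {a..b} \<Longrightarrow> K \<le> infdist (\<beta> t) Z"
  shows "b - a \<le> 2 * L * (2 * A + infdist (\<beta> a) Z + 2 * infdist (\<beta> b) Z)"
proof -
  have L: "L \<ge> 1" and A: "A \<ge> 0"
    using K unfolding contraction_scale_def by blast+
  obtain u v where uv: "u \<in> closest_proj Z (\<beta> a)" "v \<in> closest_proj Z (\<beta> b)"
    using closest_proj_exists[OF X Z] by metis
  have p: "6 * L * dist u v \<le> 3 * (b - a) + 2 * L * (infdist (\<beta> b) Z + A)"
    by (rule projection_advance[OF X Z K ab \<beta> far uv])
  have "dist (\<beta> a) (\<beta> b) \<le> dist (\<beta> a) u + dist u v + dist (\<beta> b) v"
    by metric
  then have "dist (\<beta> a) (\<beta> b) + A \<le> infdist (\<beta> a) Z + dist u v + infdist (\<beta> b) Z + A"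
    using closest_projD[OF uv(1)] closest_projD[OF uv(2)] by simp
  then have "L * (dist (\<beta> a) (\<beta> b) + A) \<le> L * (infdist (\<beta> a) Z + dist u v + infdist (\<beta> b) Z + A)"
    using L by (intro mult_left_mono) auto
  then have "b - a \<le> L * (infdist (\<beta> a) Z + dist u v + infdist (\<beta> b) Z + A)"
    using qi_embedding_onD(2)[OF \<beta>(2) L, of a b] ab by (simp add: dist_real_def)
  then have "6 * (b - a) \<le> 6 * L * (infdist (\<beta> a) Z + infdist (\<beta> b) Z + A)
      + (3 * (b - a) + 2 * L * (infdist (\<beta> b) Z + A))"
    using p by (simp add: algebra_simps)
  moreover have "0 \<le> L * infdist (\<beta> b) Z" "0 \<le> L * A"
    using L A by (auto simp: infdist_nonneg)
  ultimately show ?thesis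
    by (simp add: algebra_simps)
qed

text \<open>Compactness gives a last time with value at most \<open>K\<close>, and the intermediate
  value theorem forces equality there. It marks the beginning of an excursion beyond level
  \<open>K\<close>.\<close>

lemma last_crossing:
  fixes f :: "real \<Rightarrow> real"
  assumes "a \<le> b" "continuous_on {a..b} f" "f a \<le> K" "K \<le> f b"
  obtains c where "c \<in> {a..b}" "f c = K" "\<And>t. t \<in> {c..b} \<Longrightarrow> K \<le> f t"
proof -
  define S where "S = {t \<in> {a..b}. f t \<le> K}"
  have "closed S"
    unfolding S_def using assms(2) by (intro continuous_on_closed_Collect_le) auto
  then have "compact S"
    using compact_Int_closed[of "{a..b}" S] by (simp add: S_def Int_def conj_ac)
  moreover have "a \<in> S"
    using assms by (simp add: S_def)
  ultimately obtain c where c: "c \<in> S" "\<And>t. t \<in> S \<Longrightarrow> t \<le> c"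
    using compact_attains_sup[of S] by blast
  have after: "K < f t" if t: "t \<in> {c<..b}" for t
  proof (rule ccontr)
    assume "\<not> K < f t"
    then have "t \<in> S"
      using t c(1) by (simp add: S_def)
    then show False
      using c(2)[of t] t by simp
  qed
  have "f c = K"
  proof (rule antisym)
    show "f c \<le> K"
      using c(1) by (simp add: S_def)
    show "K \<le> f c"
    proof (rule ccontr)
      assume "\<not> K \<le> f c"
      moreover have "continuous_on {c..b} f"
        using assms(2) c(1) by (auto simp: S_def intro: continuous_on_subset)
      ultimately obtain t where "c \<le> t" "t \<le> b" "f t = K"
        using IVT'[of f c K b] assms(4) c(1) by (auto simp: S_def)
      then show False
        using after[of t] \<open>\<not> K \<le> f c\<close> by (cases "t = c") auto
    qed
  qed
  show thesis
  proof (rule that)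
    show "K \<le> f t" if "t \<in> {c..b}" for t
      using after[of t] that \<open>f c = K\<close> by (cases "t = c") auto
  qed (use c(1) \<open>f c = K\<close> in \<open>auto simp: S_def\<close>)
qed

lemma first_crossing:
  fixes f :: "real \<Rightarrow> real"
  assumes "a \<le> b" "continuous_on {a..b} f" "K \<le> f a" "f b \<le> K"
  obtains c where "c \<in> {a..b}" "f c = K" "\<And>t. t \<in> {a..c} \<Longrightarrow> K \<le> f t"
proof -
  have "continuous_on {-b..-a} (\<lambda>t. f (- t))"
    by (rule continuous_on_compose2[OF assms(2)]) (auto intro!: continuous_intros)
  then obtain c where c: "c \<in> {-b..-a}" "f (- c) = K" "\<And>t. t \<in> {c..-a} \<Longrightarrow> K \<le> f (- t)"
    using last_crossing[of "-b" "-a" "\<lambda>t. f (- t)" K] assms by auto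
  show thesis
  proof (rule that[of "- c"])
    show "K \<le> f t" if "t \<in> {a..-c}" for t
      using c(3)[of "- t"] that by auto
  qed (use c in auto)
qed

text \<open>A time beyond level \<open>K\<close> lies in an excursion that begins and ends at
  distance exactly \<open>K\<close>; its duration, hence the displacement during it, is bounded by
  \<open>K\<close>, \<open>L\<close> and \<open>A\<close> alone.\<close>

lemma quasi_geodesic_stays_near:
  fixes \<beta> :: "real \<Rightarrow> 'a::metric_space"
  assumes X: "proper_geodesic_space TYPE('a)" and Z: "closed Z" "Z \<noteq> {}"
    and K: "contraction_scale Z L A K"
    and \<beta>: "continuous_on {0..b} \<beta>" "qi_embedding_on L A {0..b} \<beta>"
    and ends: "infdist (\<beta> 0) Z \<le> K" "infdist (\<beta> b) Z \<le> K" and t: "t \<in> {0..b}"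
  shows "infdist (\<beta> t) Z \<le> K + L * (2 * L * (2 * A + 3 * K)) + A"
proof (cases "infdist (\<beta> t) Z \<le> K")
  case True
  have "L \<ge> 1" "A \<ge> 0" "K \<ge> 3 * A"
    using K unfolding contraction_scale_def by blast+
  then have "0 \<le> L * (2 * L * (2 * A + 3 * K)) + A"
    by simp
  then show ?thesis
    using True by linarith
next
  case False
  have L: "L \<ge> 1"
    using K unfolding contraction_scale_def by blast
  have cont: "continuous_on {0..b} (\<lambda>t. infdist (\<beta> t) Z)"
    by (intro continuous_intros \<beta>)
  obtain c where c: "c \<in> {0..t}" "infdist (\<beta> c) Z = K" "\<And>s. s \<in> {c..t} \<Longrightarrow> K \<le> infdist (\<beta> s) Z"
    using last_crossing[of 0 t "\<lambda>t. infdist (\<beta> t) Z" K] False t ends continuous_on_subset[OF cont, of "{0..t}"]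
    by auto
  obtain e where e: "e \<in> {t..b}" "infdist (\<beta> e) Z = K" "\<And>s. s \<in> {t..e} \<Longrightarrow> K \<le> infdist (\<beta> s) Z"
    using first_crossing[of t b "\<lambda>t. infdist (\<beta> t) Z" K] False t ends continuous_on_subset[OF cont, of "{t..b}"]
    by auto
  have far: "K \<le> infdist (\<beta> s) Z" if "s \<in> {c..e}" for s
    using c(3)[of s] e(3)[of s] that by (cases "s \<le> t") auto
  have "e - c \<le> 2 * L * (2 * A + infdist (\<beta> c) Z + 2 * infdist (\<beta> e) Z)"
    using c e t by (intro excursion_duration[OF X Z K _ _ _ far] continuous_on_subset[OF \<beta>(1)]
        qi_embedding_on_subset[OF \<beta>(2)]) auto
  also have "\<dots> = 2 * L * (2 * A + 3 * K)"
    using c(2) e(2) by simp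
  finally have "t - c \<le> 2 * L * (2 * A + 3 * K)"
    using e(1) by simp
  then have "L * (t - c) \<le> L * (2 * L * (2 * A + 3 * K))"
    using L by (intro mult_left_mono) auto
  moreover have "dist (\<beta> t) (\<beta> c) \<le> L * (t - c) + A"
    using qi_embedding_onD(1)[OF \<beta>(2) L, of t c] c t by (simp add: dist_real_def)
  ultimately show ?thesis
    using infdist_triangle[of "\<beta> t" Z "\<beta> c"] c(2) by linarith
qed

text \<open>Recurrence within \<open>H\<close> only serves to bring the ray back to level
  \<open>K\<close>; the resulting bound does not contain \<open>H\<close>. This makes the nearness
  uniform over all such rays with the same constants.\<close>

lemma recurrent_ray_stays_near:
  fixes \<beta> :: "real \<Rightarrow> 'a::metric_space"
  assumes X: "proper_geodesic_space TYPE('a)" and Z: "closed Z" "Z \<noteq> {}"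
    and K: "contraction_scale Z L A K"
    and \<beta>: "continuous_on {0..} \<beta>" "qi_embedding_on L A {0..} \<beta>"
    and start: "infdist (\<beta> 0) Z \<le> K" and rec: "\<And>T. \<exists>t\<ge>T. infdist (\<beta> t) Z \<le> H" and t: "t \<ge> 0"
  shows "infdist (\<beta> t) Z \<le> K + L * (2 * L * (2 * A + 3 * K)) + A"
proof -
  have "\<exists>b\<ge>t. infdist (\<beta> b) Z \<le> K"
  proof (rule ccontr)
    assume "\<not> ?thesis"
    then have far: "K < infdist (\<beta> s) Z" if "s \<ge> t" for s
      using that by force
    have cont: "continuous_on {0..t} (\<lambda>t. infdist (\<beta> t) Z)"
      by (intro continuous_intros continuous_on_subset[OF \<beta>(1)]) auto
    obtain c where c: "c \<in> {0..t}" "infdist (\<beta> c) Z = K" "\<And>s. s \<in> {c..t} \<Longrightarrow> K \<le> infdist (\<beta> s) Z"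
      using last_crossing[OF t cont, of K] start far[of t] by auto
    \<comment> \<open>One more than the longest possible excursion from level \<open>K\<close> to
      level \<open>H\<close>.\<close>
    obtain b where b: "b \<ge> max t (c + 2 * L * (2 * A + K + 2 * H) + 1)" "infdist (\<beta> b) Z \<le> H"
      using rec by blast
    have "b - c \<le> 2 * L * (2 * A + infdist (\<beta> c) Z + 2 * infdist (\<beta> b) Z)"
    proof (rule excursion_duration[OF X Z K])
      show "K \<le> infdist (\<beta> s) Z" if "s \<in> {c..b}" for s
        using c(3)[of s] far[of s] that by (cases "s \<le> t") auto
    qed (use b c in \<open>auto intro: continuous_on_subset[OF \<beta>(1)] qi_embedding_on_subset[OF \<beta>(2)]\<close>)
    also have "\<dots> \<le> 2 * L * (2 * A + K + 2 * H)"
      using K b(2) c(2) unfolding contraction_scale_def by (intro mult_left_mono) auto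
    finally show False
      using b(1) by simp
  qed
  then obtain b where "b \<ge> t" "infdist (\<beta> b) Z \<le> K"
    by blast
  then show ?thesis
    using t start by (intro quasi_geodesic_stays_near[OF X Z K, of b] continuous_on_subset[OF \<beta>(1)]
        qi_embedding_on_subset[OF \<beta>(2)]) auto
qed


section \<open>Boundary points and their neighbourhoods\<close>

lemma hausdorff_distance_finite_iff:
  "hausdorff_distance S T < \<infinity> \<longleftrightarrow> (\<exists>D. hausdorff_within D S T)"
proof
  assume "hausdorff_distance S T < \<infinity>"
  then obtain C where "0 \<le> C" "S \<subseteq> (\<Union>y\<in>T. cball y C)" "T \<subseteq> (\<Union>x\<in>S. cball x C)"
    unfolding hausdorff_distance_def Inf_less_iff by blast
  then have "hausdorff_within C S T"
    unfolding hausdorff_within_def by (force simp: dist_commute)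
  then show "\<exists>D. hausdorff_within D S T" ..
next
  assume "\<exists>D. hausdorff_within D S T"
  then obtain D where D: "hausdorff_within D S T" ..
  have "S \<subseteq> (\<Union>y\<in>T. cball y (max D 0))" "T \<subseteq> (\<Union>x\<in>S. cball x (max D 0))"
    using D unfolding hausdorff_within_def by (force simp: dist_commute le_max_iff_disj)+
  then have "hausdorff_distance S T \<le> ereal (max D 0)"
    unfolding hausdorff_distance_def by (intro Inf_lower CollectI exI[of _ "max D 0"] conjI refl) simp_all
  then show "hausdorff_distance S T < \<infinity>"
    by (rule order.strict_trans1) (simp add: max_def)
qed

lemma hausdorff_within_refl: "hausdorff_within 0 S S"
  unfolding hausdorff_within_def by force

lemma ray_rel_iff: "(\<beta>, \<gamma>) \<in> ray_rel p \<longleftrightarrow> \<beta> \<in> contracting_rays p \<and> \<gamma> \<in> contracting_rays p \<and>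
    (\<exists>D. hausdorff_within D (\<beta> ` {0..}) (\<gamma> ` {0..}))"
  unfolding ray_rel_def hausdorff_distance_finite_iff by simp

lemma equiv_ray_rel: "equiv (contracting_rays p) (ray_rel p)"
proof (rule equivI)
  show "ray_rel p \<subseteq> contracting_rays p \<times> contracting_rays p"
    by (auto simp: ray_rel_iff)
  show "refl_on (contracting_rays p) (ray_rel p)"
    using hausdorff_within_refl by (auto simp: refl_on_def ray_rel_iff)
  show "sym (ray_rel p)"
    using hausdorff_within_sym by (auto simp: sym_def ray_rel_iff)
  show "trans (ray_rel p)"
    using hausdorff_within_trans by (auto simp: trans_def ray_rel_iff) blast
qed

lemma boundary_eq_class:
  assumes "\<zeta> \<in> contracting_boundary p" "\<gamma> \<in> \<zeta>"
  shows "\<zeta> = ray_rel p `` {\<gamma>}" "\<gamma> \<in> contracting_rays p"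
proof -
  obtain \<beta> where "\<beta> \<in> contracting_rays p" "\<zeta> = ray_rel p `` {\<beta>}"
    using assms(1) unfolding contracting_boundary_def by (auto elim: quotientE)
  then show "\<zeta> = ray_rel p `` {\<gamma>}" "\<gamma> \<in> contracting_rays p"
    using assms(2) equiv_class_eq[OF equiv_ray_rel, of \<beta> \<gamma>] by (auto simp: ray_rel_iff)
qed

lemma class_in_boundary:
  assumes "\<gamma> \<in> contracting_rays p"
  shows "ray_rel p `` {\<gamma>} \<in> contracting_boundary p" "\<gamma> \<in> ray_rel p `` {\<gamma>}"
  using assms equiv_class_self[OF equiv_ray_rel]
  by (auto simp: contracting_boundary_def intro: quotientI)

lemma boundary_mem_iff:
  assumes "\<zeta> \<in> contracting_boundary p" "\<gamma> \<in> \<zeta>"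
  shows "\<beta> \<in> \<zeta> \<longleftrightarrow> \<beta> \<in> contracting_rays p \<and> (\<exists>D. hausdorff_within D (\<gamma> ` {0..}) (\<beta> ` {0..}))"
  using boundary_eq_class[OF assms] by (auto simp: ray_rel_iff)

text \<open>Contraction of \<open>\<beta>\<close> is inherited from \<open>\<gamma>\<close> through
  the finite Hausdorff distance, so it is never checked separately for a constructed ray.\<close>

lemma boundary_memI:
  assumes X: "proper_geodesic_space TYPE('a::metric_space)"
    and "\<zeta> \<in> contracting_boundary (p::'a)" "\<gamma> \<in> \<zeta>"
    and "L \<ge> 1" "A \<ge> 0" "qi_embedding_on L A {0..} \<beta>" "\<beta> 0 = p"
    and "hausdorff_within D (\<gamma> ` {0..}) (\<beta> ` {0..})"
  shows "\<beta> \<in> \<zeta>"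
proof -
  have "contracting (\<gamma> ` {0..})"
    using boundary_eq_class(2)[OF assms(2,3)] by (simp add: contracting_rays_def)
  then have "contracting (\<beta> ` {0..})"
    using contracting_hausdorff[OF X _ assms(8)] by auto
  then have "\<beta> \<in> contracting_rays p"
    using assms by (auto simp: contracting_rays_def quasi_geodesic_on_def is_interval_ci)
  then show ?thesis
    using boundary_mem_iff[OF assms(2,3)] assms(8) by blast
qed

lemma boundary_point_eqI:
  assumes "\<zeta> \<in> contracting_boundary p" "\<eta> \<in> contracting_boundary p" "\<gamma> \<in> \<zeta>" "\<gamma> \<in> \<eta>"
  shows "\<zeta> = \<eta>"
  using boundary_eq_class[OF assms(1,3)] boundary_eq_class[OF assms(2,4)] by simp

lemma contracting_ray_start: "\<gamma> \<in> contracting_rays p \<Longrightarrow> \<gamma> 0 = p"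
  by (simp add: contracting_rays_def)

lemma geodesic_on_dist: "geodesic_on I \<gamma> \<Longrightarrow> s \<in> I \<Longrightarrow> t \<in> I \<Longrightarrow> dist (\<gamma> s) (\<gamma> t) = \<bar>s - t\<bar>"
  by (simp add: geodesic_on_def dist_real_def)

lemma geodesic_on_imp_qi: "geodesic_on I \<gamma> \<Longrightarrow> qi_embedding_on 1 0 I \<gamma>"
  by (simp add: geodesic_on_def qi_embedding_on_def)

lemma lipschitz_imp_continuous_on:
  assumes "\<And>s t. s \<in> I \<Longrightarrow> t \<in> I \<Longrightarrow> dist (\<gamma> s) (\<gamma> t) \<le> C * dist s t" "C \<ge> 0"
  shows "continuous_on I \<gamma>"
  by (rule lipschitz_on_continuous_on[of C]) (use assms in \<open>auto simp: lipschitz_on_def\<close>)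

lemma geodesic_on_continuous: "geodesic_on I \<gamma> \<Longrightarrow> continuous_on I \<gamma>"
  by (rule lipschitz_imp_continuous_on[of _ _ 1]) (auto simp: geodesic_on_def)

text \<open>Points of the ray near a given point have bounded parameters, so the closure is met
  inside a compact arc. \<open>contracting\<close> refers to the closure, which thereby is the ray
  itself.\<close>

lemma geodesic_ray_closed:
  fixes \<gamma> :: "real \<Rightarrow> 'a::metric_space"
  assumes g: "geodesic_on {0..} \<gamma>"
  shows "closed (\<gamma> ` {0..})"
proof -
  have "x \<in> \<gamma> ` {0..}" if x: "x \<in> closure (\<gamma> ` {0..})" for x
  proof -
    define T where "T = dist x (\<gamma> 0) + 1"
    have "x \<in> closure (\<gamma> ` {0..T})"
      unfolding closure_approachable
    proof (intro allI impI)
      fix e :: real assume "e > 0"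
      then obtain t where t: "t \<ge> 0" "dist (\<gamma> t) x < min e 1"
        using x unfolding closure_approachable by (metis atLeast_iff imageE min_less_iff_conj zero_less_one)
      then have "t \<le> T"
        using geodesic_on_dist[OF g, of t 0] dist_triangle[of "\<gamma> t" "\<gamma> 0" x] by (simp add: T_def)
      then show "\<exists>y\<in>\<gamma> ` {0..T}. dist y x < e"
        using t by auto
    qed
    moreover have "compact (\<gamma> ` {0..T})"
      by (intro compact_continuous_image continuous_on_subset[OF geodesic_on_continuous[OF g]]) auto
    ultimately have "x \<in> \<gamma> ` {0..T}"
      using compact_imp_closed closure_closed by blast
    then show ?thesis
      by auto
  qed
  then show ?thesis
    using closure_subset_eq by blast
qed

text \<open>Both rays start at one point, so a closest \<open>\<alpha> u\<close> to
  \<open>\<gamma> t\<close> has \<open>u\<close> within \<open>D\<close> of \<open>t\<close>.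
  Nearness in one direction thus compares equal parameters and gives both directions.\<close>

lemma geodesic_rays_hausdorff:
  fixes \<alpha> \<gamma> :: "real \<Rightarrow> 'a::metric_space"
  assumes X: "proper_geodesic_space TYPE('a)"
    and g: "geodesic_on {0..} \<alpha>" "geodesic_on {0..} \<gamma>" "\<alpha> 0 = \<gamma> 0"
    and near: "\<And>t. t \<ge> 0 \<Longrightarrow> infdist (\<gamma> t) (\<alpha> ` {0..}) \<le> D"
  shows "hausdorff_within (2 * D) (\<alpha> ` {0..}) (\<gamma> ` {0..})"
proof -
  have "dist (\<alpha> t) (\<gamma> t) \<le> 2 * D" if t: "t \<ge> 0" for t
  proof -
    obtain y where y: "y \<in> closest_proj (\<alpha> ` {0..}) (\<gamma> t)"
      using closest_proj_exists[OF X geodesic_ray_closed[OF g(1)]] by auto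
    then obtain u where u: "u \<ge> 0" "y = \<alpha> u"
      using closest_projD(1) by fastforce
    have d: "dist (\<gamma> t) (\<alpha> u) \<le> D"
      using closest_projD(2)[OF y] near[OF t] u by simp
    have "\<bar>t - u\<bar> \<le> dist (\<gamma> t) (\<alpha> u)"
      using geodesic_on_dist[OF g(1), of u 0] geodesic_on_dist[OF g(2), of t 0] t u(1) g(3)
        dist_triangle[of "\<gamma> t" "\<gamma> 0" "\<alpha> u"] dist_triangle[of "\<alpha> u" "\<gamma> 0" "\<gamma> t"]
      by (simp add: dist_commute)
    then show ?thesis
      using geodesic_on_dist[OF g(1), of t u] t u(1) d dist_triangle[of "\<alpha> t" "\<gamma> t" "\<alpha> u"]
      by (simp add: dist_commute)
  qed
  then show ?thesis
    unfolding hausdorff_within_def by (auto simp: dist_commute)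
qed

section \<open>Geodesic representatives of a boundary point, \<open>rho_bd\<close> and
  \<open>kappa\<close>\<close>

locale geodesic_boundary_point =
  fixes p :: "'a::metric_space" and \<zeta> :: "(real \<Rightarrow> 'a) set" and \<alpha> :: "real \<Rightarrow> 'a"
  assumes X: "proper_geodesic_space TYPE('a)"
    and bd: "\<zeta> \<in> contracting_boundary p" and mem: "\<alpha> \<in> \<zeta>" and geo: "geodesic_on {0..} \<alpha>"
begin

abbreviation Z where "Z \<equiv> \<alpha> ` {0..}"

lemma start: "\<alpha> 0 = p"
  using boundary_eq_class(2)[OF bd mem] by (rule contracting_ray_start)

lemma Z_closed: "closed Z" and Z_ne: "Z \<noteq> {}"
  using geodesic_ray_closed[OF geo] by auto

lemma dist_start: "t \<ge> 0 \<Longrightarrow> dist (\<alpha> t) p = t"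
  using geodesic_on_dist[OF geo, of t 0] start by simp

lemma Z_contracting: "uniformly_contracting {Z}"
proof -
  have "contracting Z"
    using boundary_eq_class(2)[OF bd mem] by (simp add: contracting_rays_def)
  then show ?thesis
    using contracting_imp_uniformly_contracting closure_closed[OF Z_closed] by metis
qed

lemma closest_point:
  obtains t where "t \<ge> 0" "dist x (\<alpha> t) = infdist x Z"
proof -
  obtain y where y: "y \<in> closest_proj Z x"
    using closest_proj_exists[OF X Z_closed Z_ne] by blast
  then obtain t where "t \<ge> 0" "y = \<alpha> t"
    using closest_projD(1) by fastforce
  then show thesis
    using closest_projD(2)[OF y] that by blast
qed

text \<open>The order of quantifiers is the content: \<open>D\<close> comes before the ray and
  before \<open>H\<close>.\<close>

lemma rays_near_uniformly:
  assumes "L \<ge> 1" "A \<ge> 0"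
  shows "\<exists>D\<ge>0. \<forall>(\<beta> :: real \<Rightarrow> 'a) H. continuous_on {0..} \<beta> \<longrightarrow> qi_embedding_on L A {0..} \<beta> \<longrightarrow> \<beta> 0 = p \<longrightarrow>
      (\<forall>T. \<exists>t\<ge>T. infdist (\<beta> t) Z \<le> H) \<longrightarrow> (\<forall>s\<ge>0. infdist (\<beta> s) Z \<le> D)"
proof -
  obtain K where K: "contraction_scale Z L A K"
    using contraction_scale_exists[OF Z_contracting assms] by blast
  then have K0: "K \<ge> 3 * A"
    unfolding contraction_scale_def by blast
  have "infdist (\<beta> s) Z \<le> K + L * (2 * L * (2 * A + 3 * K)) + A"
    if \<beta>: "continuous_on {0..} \<beta>" "qi_embedding_on L A {0..} \<beta>" "\<beta> 0 = p"
      "\<forall>T. \<exists>t\<ge>T. infdist (\<beta> t) Z \<le> H" "s \<ge> 0" for \<beta> :: "real \<Rightarrow> 'a" and H s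
  proof (rule recurrent_ray_stays_near[OF X Z_closed Z_ne K \<beta>(1,2)])
    have "p \<in> Z"
      using start by force
    then show "infdist (\<beta> 0) Z \<le> K"
      using \<beta>(3) K0 assms by simp
  qed (use \<beta> in auto)
  then show ?thesis
    using K0 assms by (intro exI[of _ "K + L * (2 * L * (2 * A + 3 * K)) + A"]) auto
qed

lemma class_near_uniformly:
  assumes "L \<ge> 1" "A \<ge> 0"
  shows "\<exists>D\<ge>0. \<forall>\<beta>\<in>\<zeta>. continuous_on {0..} \<beta> \<longrightarrow> qi_embedding_on L A {0..} \<beta> \<longrightarrow>
      (\<forall>s\<ge>0. infdist (\<beta> s) Z \<le> D)"
proof -
  have rec: "\<beta> 0 = p \<and> (\<exists>H. \<forall>T. \<exists>t\<ge>T. infdist (\<beta> t) Z \<le> H)" if b: "\<beta> \<in> \<zeta>" for \<beta>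
  proof -
    obtain H where H: "hausdorff_within H Z (\<beta> ` {0..})"
      using boundary_mem_iff[OF bd mem] b by blast
    have "infdist (\<beta> t) Z \<le> H" if t: "t \<ge> 0" for t
    proof -
      obtain x where "x \<in> Z" "dist (\<beta> t) x \<le> H"
        using H t unfolding hausdorff_within_def by blast
      then show ?thesis
        by (rule infdist_le2)
    qed
    then have "\<exists>t\<ge>T. infdist (\<beta> t) Z \<le> H" for T
      by (intro exI[of _ "max T 0"]) auto
    then show ?thesis
      using contracting_ray_start[OF boundary_eq_class(2)[OF bd b]] by blast
  qed
  obtain D where "D \<ge> 0" and D: "\<forall>(\<beta> :: real \<Rightarrow> 'a) H. continuous_on {0..} \<beta> \<longrightarrow> qi_embedding_on L A {0..} \<beta> \<longrightarrow>
      \<beta> 0 = p \<longrightarrow> (\<forall>T. \<exists>t\<ge>T. infdist (\<beta> t) Z \<le> H) \<longrightarrow> (\<forall>s\<ge>0. infdist (\<beta> s) Z \<le> D)"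
    using rays_near_uniformly[OF assms] by (elim exE conjE)
  show ?thesis
  proof (intro exI[of _ D] conjI ballI impI)
    fix \<beta> assume b: "\<beta> \<in> \<zeta>" "continuous_on {0..} \<beta>" "qi_embedding_on L A {0..} \<beta>"
    obtain H where "\<beta> 0 = p" "\<forall>T. \<exists>t\<ge>T. infdist (\<beta> t) Z \<le> H"
      using rec[OF b(1)] by (elim exE conjE)
    then show "\<forall>s\<ge>0. infdist (\<beta> s) Z \<le> D"
      using D[THEN spec, of \<beta>, THEN spec, of H] b by simp
  qed (rule \<open>D \<ge> 0\<close>)
qed

text \<open>Used contrapositively: the chosen geodesic of another boundary point eventually stays
  farther than any given \<open>H\<close> from \<open>Z\<close>.\<close>

lemma recurrent_geodesic_mem:
  assumes g: "geodesic_on {0..} \<gamma>" "\<gamma> 0 = p" and rec: "\<And>T. \<exists>t\<ge>T. infdist (\<gamma> t) Z \<le> H"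
  shows "\<gamma> \<in> \<zeta>"
proof -
  obtain K where K: "contraction_scale Z 1 0 K"
    using contraction_scale_exists[OF Z_contracting, of 1 0] by auto
  have "infdist (\<gamma> 0) Z \<le> K"
    using K g(2) start unfolding contraction_scale_def by (metis atLeast_iff image_eqI infdist_zero mult_zero_right order_refl)
  then have "infdist (\<gamma> t) Z \<le> K + 1 * (2 * 1 * (2 * 0 + 3 * K)) + 0" if "t \<ge> 0" for t
    using that rec
    by (intro recurrent_ray_stays_near[OF X Z_closed Z_ne K, of _ H] geodesic_on_continuous
        geodesic_on_imp_qi g) auto
  then have "hausdorff_within (2 * (K + 1 * (2 * 1 * (2 * 0 + 3 * K)) + 0)) Z (\<gamma> ` {0..})"
    using start g by (intro geodesic_rays_hausdorff[OF X geo]) auto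
  then show ?thesis
    using boundary_memI[OF X bd mem _ _ geodesic_on_imp_qi[OF g(1)] g(2)] by simp
qed

text \<open>Applied with constants 1 and 0, class nearness puts all geodesic rays of
  \<open>\<zeta>\<close> within one Hausdorff distance of \<open>Z\<close>. From this come the
  sublinearity of \<open>rho_bd \<zeta>\<close> and the contraction of \<open>Z\<close> with that
  gauge.\<close>

lemma geodesics_uniformly_contracting:
  "uniformly_contracting {\<gamma> ` {0..} | \<gamma>. \<gamma> \<in> \<zeta> \<and> geodesic_on {0..} \<gamma>}"
proof -
  have "\<exists>D\<ge>0. \<forall>\<beta>\<in>\<zeta>. continuous_on {0..} \<beta> \<longrightarrow> qi_embedding_on 1 0 {0..} \<beta> \<longrightarrow>
      (\<forall>s\<ge>0. infdist (\<beta> s) Z \<le> D)"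
    by (rule class_near_uniformly) auto
  then obtain D where D: "\<And>\<beta> s. \<beta> \<in> \<zeta> \<Longrightarrow> continuous_on {0..} \<beta> \<Longrightarrow>
      qi_embedding_on 1 0 {0..} \<beta> \<Longrightarrow> s \<ge> 0 \<Longrightarrow> infdist (\<beta> s) Z \<le> D"
    by blast
  show ?thesis
  proof (rule uniformly_contracting_hausdorff[OF X Z_closed Z_ne Z_contracting])
    fix w assume "w \<in> {\<gamma> ` {0..} | \<gamma>. \<gamma> \<in> \<zeta> \<and> geodesic_on {0..} \<gamma>}"
    then obtain \<gamma> where g: "w = \<gamma> ` {0..}" "\<gamma> \<in> \<zeta>" "geodesic_on {0..} \<gamma>"
      by blast
    show "closed w" "w \<noteq> {}"
      using g geodesic_ray_closed by auto
    have "\<gamma> 0 = p"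
      using boundary_eq_class(2)[OF bd g(2)] by (rule contracting_ray_start)
    then show "hausdorff_within (2 * D) Z w"
      unfolding g(1) using start g
      by (intro geodesic_rays_hausdorff[OF X geo g(3)] D geodesic_on_continuous geodesic_on_imp_qi) auto
  qed
qed

lemma rho_bd_eq_gauge:
  "rho_bd \<zeta> = contraction_gauge {\<gamma> ` {0..} | \<gamma>. \<gamma> \<in> \<zeta> \<and> geodesic_on {0..} \<gamma>}"
proof
  fix r
  show "rho_bd \<zeta> r = contraction_gauge {\<gamma> ` {0..} | \<gamma>. \<gamma> \<in> \<zeta> \<and> geodesic_on {0..} \<gamma>} r"
    unfolding rho_bd_def contraction_gauge_def by (rule arg_cong[where f = Sup]) blast
qed

lemma rho_bd_sublinear: "sublinear (rho_bd \<zeta>)"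
  unfolding rho_bd_eq_gauge
  by (rule contraction_gauge_sublinear[OF geodesics_uniformly_contracting _ Z_ne]) (use mem geo in blast)

lemma rho_bd_contracting:
  assumes "u \<in> closest_proj Z x" "v \<in> closest_proj Z y" "dist x y \<le> infdist x Z"
  shows "dist u v \<le> rho_bd \<zeta> (infdist x Z)"
proof -
  have "dist u v \<le> diameter (closest_proj Z x \<union> closest_proj Z y)"
    using assms by (intro diameter_bounded_bound) (auto simp: bounded_closest_proj)
  also have "\<dots> \<le> rho_bd \<zeta> (infdist x Z)"
    unfolding rho_bd_eq_gauge
    by (rule contraction_gauge_upper[OF geodesics_uniformly_contracting]) (use mem geo assms in auto)
  finally show ?thesis .
qed

lemma kappa_set_nonempty:
  assumes "L \<ge> 1"
  shows "{R. R > 0 \<and> (\<forall>r\<ge>R. 3 * L\<^sup>2 * rho_bd \<zeta> r \<le> r)} \<noteq> {}"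
proof -
  have e: "1 / (3 * L\<^sup>2) > 0"
    using assms by simp
  have "((\<lambda>r. rho_bd \<zeta> r / r) \<longlongrightarrow> 0) at_top"
    using rho_bd_sublinear unfolding sublinear_def by blast
  then have "\<forall>\<^sub>F r in at_top. dist (rho_bd \<zeta> r / r) 0 < 1 / (3 * L\<^sup>2)"
    using e by (rule tendstoD)
  then obtain R where R: "\<And>r. r \<ge> R \<Longrightarrow> dist (rho_bd \<zeta> r / r) 0 < 1 / (3 * L\<^sup>2)"
    unfolding eventually_at_top_linorder by blast
  have "3 * L\<^sup>2 * rho_bd \<zeta> r \<le> r" if r: "r \<ge> max R 1" for r
  proof -
    have "rho_bd \<zeta> r / r < 1 / (3 * L\<^sup>2)"
      using R[of r] r abs_ge_self[of "rho_bd \<zeta> r / r"] unfolding dist_real_def by simp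
    then show ?thesis
      using r assms by (simp add: field_simps)
  qed
  then show ?thesis
    by (intro ex_in_conv[THEN iffD1] exI[of _ "max R 1"]) auto
qed

lemma kappa_lower:
  "kappa \<rho> L A \<ge> 3 * A" "kappa \<rho> L A \<ge> 3 * L\<^sup>2"
  "kappa \<rho> L A \<ge> 1 + Inf {R. R > 0 \<and> (\<forall>r\<ge>R. 3 * L\<^sup>2 * \<rho> r \<le> r)}"
  unfolding kappa_def by (auto intro!: Max_ge)

text \<open>The added 1 in \<open>kappa\<close> matters here: the infimum need not be attained, but
  some admissible threshold lies below \<open>1 + Inf\<close>.\<close>

lemma kappa_scale:
  assumes "L \<ge> 1" "A \<ge> 0"
  shows "contraction_scale Z L A (kappa (rho_bd \<zeta>) L A)"
proof -
  let ?S = "{R. R > 0 \<and> (\<forall>r\<ge>R. 3 * L\<^sup>2 * rho_bd \<zeta> r \<le> r)}"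
  obtain R where R: "R \<in> ?S" "R < 1 + Inf ?S"
    using cInf_lessD[OF kappa_set_nonempty[OF assms(1)], of "1 + Inf ?S"] by auto
  show ?thesis
    unfolding contraction_scale_def
  proof (intro conjI allI ballI impI)
    fix x y u v
    assume uv: "u \<in> closest_proj Z x" "v \<in> closest_proj Z y" and xy: "dist x y \<le> infdist x Z"
      and "kappa (rho_bd \<zeta>) L A \<le> infdist x Z"
    then have "R \<le> infdist x Z"
      using R(2) kappa_lower(3)[of L "rho_bd \<zeta>" A] by linarith
    then have "3 * L\<^sup>2 * rho_bd \<zeta> (infdist x Z) \<le> infdist x Z"
      using R(1) by blast
    moreover have "3 * L\<^sup>2 * dist u v \<le> 3 * L\<^sup>2 * rho_bd \<zeta> (infdist x Z)"
      by (intro mult_left_mono rho_bd_contracting[OF uv xy]) auto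
    ultimately show "3 * L\<^sup>2 * dist u v \<le> infdist x Z"
      by linarith
  qed (use assms kappa_lower in auto)
qed

lemma kappa_mono:
  assumes "1 \<le> L" "L \<le> L'" "A \<le> A'"
  shows "kappa (rho_bd \<zeta>) L A \<le> kappa (rho_bd \<zeta>) L' A'"
proof -
  have L2: "L\<^sup>2 \<le> L'\<^sup>2"
    using assms by (intro power_mono) auto
  have "3 * L\<^sup>2 * rho_bd \<zeta> r \<le> r" if "3 * L'\<^sup>2 * rho_bd \<zeta> r \<le> r" "r > 0" for r
  proof (cases "rho_bd \<zeta> r \<ge> 0")
    case True
    then have "3 * L\<^sup>2 * rho_bd \<zeta> r \<le> 3 * L'\<^sup>2 * rho_bd \<zeta> r"
      using L2 by (intro mult_right_mono) auto
    then show ?thesis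
      using that by linarith
  next
    case False
    then have "3 * L\<^sup>2 * rho_bd \<zeta> r \<le> 0"
      by (simp add: mult_nonneg_nonpos)
    then show ?thesis
      using that by linarith
  qed
  then have "Inf {R. R > 0 \<and> (\<forall>r\<ge>R. 3 * L\<^sup>2 * rho_bd \<zeta> r \<le> r)}
      \<le> Inf {R. R > 0 \<and> (\<forall>r\<ge>R. 3 * L'\<^sup>2 * rho_bd \<zeta> r \<le> r)}"
    using assms by (intro cInf_superset_mono kappa_set_nonempty bdd_belowI[of _ 0]) auto
  then have "1 + Inf {R. R > 0 \<and> (\<forall>r\<ge>R. 3 * L\<^sup>2 * rho_bd \<zeta> r \<le> r)} \<le> kappa (rho_bd \<zeta>) L' A'"
    using kappa_lower(3)[of L' "rho_bd \<zeta>" A'] by linarith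
  moreover have "3 * L\<^sup>2 \<le> kappa (rho_bd \<zeta>) L' A'"
    using L2 kappa_lower(2)[of L' "rho_bd \<zeta>" A'] by linarith
  moreover have "3 * A \<le> kappa (rho_bd \<zeta>) L' A'"
    using assms(3) kappa_lower(1)[of A' "rho_bd \<zeta>" L'] by linarith
  ultimately show ?thesis
    by (subst kappa_def) simp
qed

end

text \<open>The loss of parameter on the geodesic ray when going back from a point within
  \<open>C\<close> of it to one within \<open>K\<close>: \<open>K\<close> and \<open>C\<close> are
  the distances at the two ends, the rest bounds the displacement in between by
  \<open>excursion_duration\<close>.\<close>

definition backtrack :: "real \<Rightarrow> real \<Rightarrow> real \<Rightarrow> real \<Rightarrow> real" where
  "backtrack L A K C = K + C + L * (2 * L * (2 * A + K + 2 * C)) + A"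

lemma backtrack_mono:
  assumes "0 \<le> L" "L \<le> L'" "0 \<le> A" "A \<le> A'" "0 \<le> K" "K \<le> K'" "0 \<le> C"
  shows "backtrack L A K C \<le> backtrack L' A' K' C"
  unfolding backtrack_def using assms by (intro add_mono mult_mono) auto

context geodesic_boundary_point
begin

text \<open>Follow \<open>\<beta>\<close> backwards from \<open>s\<close> to the last time at
  distance \<open>K\<close> from the ray, or stay at \<open>s\<close> if that is near enough. The
  start at \<open>p\<close>, which is on the ray, guarantees such a time.\<close>

lemma enters_neighbourhood_far_out:
  fixes \<beta> :: "real \<Rightarrow> 'a"
  assumes K: "contraction_scale Z L A K" and C: "0 \<le> C"
    and \<beta>: "continuous_on {0..s} \<beta>" "qi_embedding_on L A {0..s} \<beta>" "\<beta> 0 = p"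
    and s: "s \<ge> 0" "t \<ge> 0" "dist (\<beta> s) (\<alpha> t) \<le> C"
  obtains c u where "c \<in> {0..s}" "u \<ge> 0" "u \<ge> t - backtrack L A K C" "dist (\<beta> c) (\<alpha> u) \<le> K"
proof -
  have L: "L \<ge> 1" and A: "A \<ge> 0" and K0: "K \<ge> 3 * A"
    using K unfolding contraction_scale_def by blast+
  have nn: "0 \<le> L * (2 * L * (2 * A + K + 2 * C))"
    using L A K0 C by simp
  have fs: "infdist (\<beta> s) Z \<le> C"
    using s by (intro infdist_le2[of "\<alpha> t"]) auto
  obtain c where c: "c \<in> {0..s}" "infdist (\<beta> c) Z \<le> K"
    "dist (\<beta> c) (\<beta> s) \<le> L * (2 * L * (2 * A + K + 2 * C)) + A"
  proof (cases "infdist (\<beta> s) Z \<le> K")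
    case True
    then show thesis
      using s(1) nn A by (intro that[of s]) auto
  next
    case False
    have "p \<in> Z"
      using start by force
    then have "infdist (\<beta> 0) Z \<le> K"
      using \<beta>(3) K0 A by simp
    moreover have "continuous_on {0..s} (\<lambda>t. infdist (\<beta> t) Z)"
      by (intro continuous_intros \<beta>)
    ultimately obtain c where c: "c \<in> {0..s}" "infdist (\<beta> c) Z = K"
      "\<And>t. t \<in> {c..s} \<Longrightarrow> K \<le> infdist (\<beta> t) Z"
      using last_crossing[of 0 s "\<lambda>t. infdist (\<beta> t) Z" K] s(1) False by auto
    have "s - c \<le> 2 * L * (2 * A + infdist (\<beta> c) Z + 2 * infdist (\<beta> s) Z)"
      using c by (intro excursion_duration[OF X Z_closed Z_ne K] continuous_on_subset[OF \<beta>(1)]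
          qi_embedding_on_subset[OF \<beta>(2)]) auto
    also have "\<dots> \<le> 2 * L * (2 * A + K + 2 * C)"
      using fs c(2) L by (intro mult_left_mono) auto
    finally have "L * (s - c) \<le> L * (2 * L * (2 * A + K + 2 * C))"
      using L by (intro mult_left_mono) auto
    moreover have "dist (\<beta> c) (\<beta> s) \<le> L * (s - c) + A"
      using qi_embedding_onD(1)[OF \<beta>(2) L, of c s] c(1) by (simp add: dist_real_def)
    ultimately show thesis
      using that[of c] c by simp
  qed
  obtain u where u: "u \<ge> 0" "dist (\<beta> c) (\<alpha> u) = infdist (\<beta> c) Z"
    using closest_point by blast
  have "dist (\<alpha> u) (\<alpha> t) \<le> dist (\<beta> c) (\<alpha> u) + dist (\<beta> c) (\<beta> s) + dist (\<beta> s) (\<alpha> t)"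
    by metric
  then have "t - u \<le> backtrack L A K C"
    using geodesic_on_dist[OF geo, of u t] u s(2,3) c unfolding backtrack_def by simp
  then show thesis
    using that[of c u] c u by simp
qed

lemma tail_eq: "r \<ge> 0 \<Longrightarrow> {x \<in> Z. dist x p \<ge> r} = \<alpha> ` {r..}"
  using dist_start by force

end

section \<open>Criteria for membership in the neighbourhoods \<open>FQ_nbhd\<close>\<close>

locale geodesic_boundary =
  fixes p :: "'a::metric_space" and \<alpha> :: "(real \<Rightarrow> 'a) set \<Rightarrow> real \<Rightarrow> 'a"
  assumes X: "proper_geodesic_space TYPE('a)" and choice: "geodesic_choice p \<alpha>"
begin

lemma point: "\<zeta> \<in> contracting_boundary p \<Longrightarrow> geodesic_boundary_point p \<zeta> (\<alpha> \<zeta>)"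
  using X choice by (simp add: geodesic_boundary_point_def geodesic_choice_def)

text \<open>The single pair of constants \<open>(r, r)\<close> and any fixed error \<open>C\<close>
  suffice. The surplus given by \<open>backtrack\<close> is what may be lost in passing from
  \<open>C\<close> to the required \<open>kappa\<close>; by monotonicity it covers all
  \<open>L\<close> and \<open>A\<close> up to \<open>r\<close>.\<close>

lemma FQ_nbhdI:
  assumes \<zeta>: "\<zeta> \<in> contracting_boundary p" and \<eta>: "\<eta> \<in> contracting_boundary p"
    and r: "r \<ge> 1" and C: "C \<ge> 0"
    and near: "\<And>\<beta>. \<beta> \<in> \<eta> \<Longrightarrow> continuous_on {0..} \<beta> \<Longrightarrow> qi_embedding_on r r {0..} \<beta> \<Longrightarrow>
      \<exists>s\<ge>0. \<exists>t\<ge>r + backtrack r r (kappa (rho_bd \<zeta>) r r) C. dist (\<beta> s) (\<alpha> \<zeta> t) \<le> C"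
  shows "\<eta> \<in> FQ_nbhd p \<alpha> \<zeta> r"
proof -
  interpret geodesic_boundary_point p \<zeta> "\<alpha> \<zeta>"
    by (rule point[OF \<zeta>])
  have "setdist (\<beta> ` {0..}) {x \<in> Z. dist x p \<ge> r} \<le> kappa (rho_bd \<zeta>) L A"
    if L: "L \<ge> 1" and A: "A \<ge> 0" and \<beta>: "\<beta> \<in> \<eta>" "continuous_on {0..} \<beta>" "qi_embedding_on L A {0..} \<beta>"
    for L A \<beta>
  proof -
    let ?K = "kappa (rho_bd \<zeta>) L A"
    have b0: "\<beta> 0 = p"
      using boundary_eq_class(2)[OF \<eta> \<beta>(1)] by (rule contracting_ray_start)
    have K: "?K \<ge> 3 * A" "?K \<ge> 3 * L\<^sup>2"
      by (rule kappa_lower)+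
    have L2: "L \<le> L\<^sup>2"
      using L by (simp add: power2_eq_square)
    have "\<exists>s\<ge>0. \<exists>t\<ge>r. dist (\<beta> s) (\<alpha> \<zeta> t) \<le> ?K"
    proof (cases "?K \<ge> r")
      \<comment> \<open>Here the basepoint itself is the witness: it is at distance \<open>r\<close>
        from \<open>\<alpha> \<zeta> r\<close>.\<close>
      case True
      then show ?thesis
        using b0 dist_start[of r] r by (intro exI[of _ 0] exI[of _ r] conjI) (auto simp: dist_commute)
    next
      case False
      then have LA: "L \<le> r" "A \<le> r"
        using K L2 L A by linarith+
      then obtain s t where st: "s \<ge> 0" "t \<ge> r + backtrack r r (kappa (rho_bd \<zeta>) r r) C"
          "dist (\<beta> s) (\<alpha> \<zeta> t) \<le> C"
        using near[OF \<beta>(1,2) qi_embedding_on_mono[OF \<beta>(3) L]] by blast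
      have bt: "backtrack L A ?K C \<le> backtrack r r (kappa (rho_bd \<zeta>) r r) C"
        using L A C LA K kappa_mono[OF L LA] by (intro backtrack_mono) auto
      have "0 \<le> backtrack L A ?K C"
        unfolding backtrack_def using L A C K by simp
      then have "t \<ge> 0"
        using st(2) bt r by linarith
      moreover have "continuous_on {0..s} \<beta>" "qi_embedding_on L A {0..s} \<beta>"
        using continuous_on_subset[OF \<beta>(2), of "{0..s}"] qi_embedding_on_subset[OF \<beta>(3), of "{0..s}"]
        by auto
      ultimately obtain c u where "c \<in> {0..s}" "u \<ge> t - backtrack L A ?K C" "dist (\<beta> c) (\<alpha> \<zeta> u) \<le> ?K"
        using enters_neighbourhood_far_out[OF kappa_scale[OF L A] C _ _ b0 st(1) _ st(3)]
        by blast
      then show ?thesis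
        using st(2) bt by (intro exI[of _ c] conjI exI[of _ u]) auto
    qed
    then obtain s t where "s \<ge> 0" "t \<ge> r" "dist (\<beta> s) (\<alpha> \<zeta> t) \<le> ?K"
      by blast
    then show ?thesis
      using r by (intro order_trans[OF setdist_le_dist[of "\<beta> s" _ "\<alpha> \<zeta> t"]]) (auto simp: tail_eq)
  qed
  then show ?thesis
    unfolding FQ_nbhd_def using \<eta> by blast
qed

text \<open>\<open>setdist\<close> is an infimum that need not be attained, so actual points cost
  the extra 1.\<close>

lemma FQ_nbhdD:
  assumes \<zeta>: "\<zeta> \<in> contracting_boundary p" and \<eta>: "\<eta> \<in> FQ_nbhd p \<alpha> \<zeta> r"
    and r: "r \<ge> 1" and L: "L \<ge> 1" "A \<ge> 0"
    and \<beta>: "\<beta> \<in> \<eta>" "continuous_on {0..} \<beta>" "qi_embedding_on L A {0..} \<beta>"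
  obtains s t where "s \<ge> 0" "t \<ge> r" "dist (\<beta> s) (\<alpha> \<zeta> t) \<le> kappa (rho_bd \<zeta>) L A + 1"
proof -
  interpret geodesic_boundary_point p \<zeta> "\<alpha> \<zeta>"
    by (rule point[OF \<zeta>])
  have "setdist (\<beta> ` {0..}) {x \<in> Z. dist x p \<ge> r} \<le> kappa (rho_bd \<zeta>) L A"
    using \<eta> L \<beta> unfolding FQ_nbhd_def by blast
  then have "setdist (\<beta> ` {0..}) (\<alpha> \<zeta> ` {r..}) < kappa (rho_bd \<zeta>) L A + 1"
    using r by (simp add: tail_eq)
  then obtain x y where "x \<in> \<beta> ` {0..}" "y \<in> \<alpha> \<zeta> ` {r..}" "dist x y < kappa (rho_bd \<zeta>) L A + 1"
    using setdist_ltE[of "\<beta> ` {0..}" "\<alpha> \<zeta> ` {r..}"] by auto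
  then show thesis
    using that by force
qed

text \<open>All continuous rays of the class with constants \<open>r\<close> stay within one
  \<open>D\<close> of the chosen geodesic, and a late enough time on such a ray has its closest
  point as far out as desired.\<close>

lemma FQ_nbhd_self:
  assumes \<zeta>: "\<zeta> \<in> contracting_boundary p" and r: "r \<ge> 1"
  shows "\<zeta> \<in> FQ_nbhd p \<alpha> \<zeta> r"
proof -
  interpret geodesic_boundary_point p \<zeta> "\<alpha> \<zeta>"
    by (rule point[OF \<zeta>])
  have "\<exists>D\<ge>0. \<forall>\<beta>\<in>\<zeta>. continuous_on {0..} \<beta> \<longrightarrow> qi_embedding_on r r {0..} \<beta> \<longrightarrow>
      (\<forall>s\<ge>0. infdist (\<beta> s) Z \<le> D)"
    by (rule class_near_uniformly) (use r in auto)
  then obtain D where D: "D \<ge> 0" "\<And>\<beta> s. \<beta> \<in> \<zeta> \<Longrightarrow> continuous_on {0..} \<beta> \<Longrightarrow>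
      qi_embedding_on r r {0..} \<beta> \<Longrightarrow> s \<ge> 0 \<Longrightarrow> infdist (\<beta> s) Z \<le> D"
    by blast
  show ?thesis
  proof (rule FQ_nbhdI[OF \<zeta> \<zeta> r D(1)])
    fix \<beta> assume \<beta>: "\<beta> \<in> \<zeta>" "continuous_on {0..} \<beta>" "qi_embedding_on r r {0..} \<beta>"
    define T where "T = r + backtrack r r (kappa (rho_bd \<zeta>) r r) D"
    \<comment> \<open>By the lower quasi-geodesic bound the ray is then at least
      \<open>T + D\<close> from \<open>p\<close>, so a point of the geodesic within \<open>D\<close>
      of it has parameter at least \<open>T\<close>.\<close>
    define s where "s = max 0 (r * (T + D + r))"
    have b0: "\<beta> 0 = p"
      using boundary_eq_class(2)[OF \<zeta> \<beta>(1)] by (rule contracting_ray_start)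
    obtain t where t: "t \<ge> 0" "dist (\<beta> s) (\<alpha> \<zeta> t) = infdist (\<beta> s) Z"
      using closest_point by blast
    have le: "dist (\<beta> s) (\<alpha> \<zeta> t) \<le> D"
      using D(2)[OF \<beta>, of s] t(2) by (simp add: s_def)
    have "r * (T + D + r) \<le> s"
      by (simp add: s_def)
    also have "s \<le> r * (dist (\<beta> s) p + r)"
      using qi_embedding_onD(2)[OF \<beta>(3) r, of s 0] b0 by (simp add: s_def)
    finally have "T + D \<le> dist (\<beta> s) p"
      using r by simp
    then have "t \<ge> T"
      using dist_triangle[of "\<beta> s" p "\<alpha> \<zeta> t"] le dist_start[OF t(1)] by linarith
    then show "\<exists>s\<ge>0. \<exists>t\<ge>r + backtrack r r (kappa (rho_bd \<zeta>) r r) D. dist (\<beta> s) (\<alpha> \<zeta> t) \<le> D"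
      using le unfolding T_def[symmetric] by (intro exI[of _ s] conjI exI[of _ t]) (auto simp: s_def)
  qed
qed

end


section \<open>Neighbourhoods contain open sets\<close>

lemma qi_embedding_on_real_intervalI:
  fixes f :: "real \<Rightarrow> 'a::metric_space"
  assumes "L \<ge> 1"
    and "\<And>s t. s \<in> S \<Longrightarrow> t \<in> S \<Longrightarrow> s \<le> t \<Longrightarrow> dist (f s) (f t) \<le> L * (t - s) + A"
    and "\<And>s t. s \<in> S \<Longrightarrow> t \<in> S \<Longrightarrow> s \<le> t \<Longrightarrow> t - s \<le> L * (dist (f s) (f t) + A)"
  shows "qi_embedding_on L A S f"
proof (rule qi_embedding_onI[OF assms(1)])
  fix s t assume "s \<in> S" "t \<in> S"
  then show "dist (f s) (f t) \<le> L * dist s t + A" "dist s t \<le> L * (dist (f s) (f t) + A)"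
    using assms(2,3)[of s t] assms(2,3)[of t s]
    by (cases "s \<le> t"; simp add: dist_real_def dist_commute)+
qed

text \<open>The hypothesis \<open>away\<close> keeps the continuation from doubling back. If
  \<open>\<beta> s\<close> and \<open>c u\<close> are at distance \<open>d\<close>, it gives
  \<open>u \<le> d + 1\<close>, hence \<open>\<beta> s\<close> and \<open>\<beta> b\<close> are
  within \<open>2 * d + 1\<close>; the constant \<open>2 * L + 1\<close> collects both
  contributions.\<close>

lemma splice_quasi_geodesic:
  fixes \<beta> c :: "real \<Rightarrow> 'a::metric_space"
  assumes L: "L \<ge> 1" and A: "A \<ge> 0" and b: "b \<ge> 0"
    and \<beta>: "continuous_on {0..b} \<beta>" "qi_embedding_on L A {0..b} \<beta>"
    and c: "c 0 = \<beta> b" "\<And>u v. 0 \<le> u \<Longrightarrow> u \<le> v \<Longrightarrow> dist (c u) (c v) \<le> v - u"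
      "\<And>u v. 0 \<le> u \<Longrightarrow> u \<le> v \<Longrightarrow> v - u - 1 \<le> dist (c u) (c v)"
    and away: "\<And>s u. s \<in> {0..b} \<Longrightarrow> 0 \<le> u \<Longrightarrow> u - 1 \<le> dist (\<beta> s) (c u)"
  defines "\<gamma> \<equiv> \<lambda>t. if t \<le> b then \<beta> t else c (t - b)"
  shows "continuous_on {0..} \<gamma>" "qi_embedding_on (2 * L + 1) (A + 1) {0..} \<gamma>"
proof -
  have cc: "continuous_on {0..} c"
  proof (rule lipschitz_imp_continuous_on[of _ _ 1])
    show "dist (c s) (c t) \<le> 1 * dist s t" if "s \<in> {0..}" "t \<in> {0..}" for s t
      using c(2)[of s t] c(2)[of t s] that by (cases "s \<le> t") (auto simp: dist_real_def dist_commute)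
  qed simp
  have "continuous_on ({0..b} \<union> {b..}) \<gamma>"
    unfolding \<gamma>_def
  proof (rule continuous_on_cases)
    show "continuous_on {b..} (\<lambda>t. c (t - b))"
      by (rule continuous_on_compose2[OF cc]) (auto intro!: continuous_intros)
    show "\<forall>t. t \<in> {0..b} \<and> \<not> t \<le> b \<or> t \<in> {b..} \<and> t \<le> b \<longrightarrow> \<beta> t = c (t - b)"
      using c(1) by auto
  qed (use \<beta> in auto)
  moreover have "{0..b} \<union> {b..} = {0..}"
    using b by auto
  ultimately show "continuous_on {0..} \<gamma>"
    by simp
  show "qi_embedding_on (2 * L + 1) (A + 1) {0..} \<gamma>"
  proof (rule qi_embedding_on_real_intervalI)
    fix s t :: real assume st: "s \<in> {0..}" "t \<in> {0..}" "s \<le> t"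
    define d where "d = dist (\<gamma> s) (\<gamma> t)"
    have d0: "0 \<le> d" "0 \<le> L * d" "0 \<le> L * A" "0 \<le> L * (t - s)"
      using L A st(3) by (simp_all add: d_def)
    have expand: "L * (2 * d + 1 + A) = 2 * (L * d) + L + L * A"
      by (simp add: algebra_simps)
    have main: "d \<le> L * (t - s) + (t - s) + A \<and> t - s \<le> L * (2 * d + 1 + A) + d + 1"
    proof (cases "t \<le> b")
      case True
      then have mem: "s \<in> {0..b}" "t \<in> {0..b}"
        using st by auto
      have "d \<le> L * (t - s) + A" "t - s \<le> L * (d + A)"
        using qi_embedding_onD[OF \<beta>(2) L mem] st True by (auto simp: d_def \<gamma>_def dist_real_def)
      then show ?thesis
        using d0 st(3) L unfolding expand distrib_left by linarith
    next
      case False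
      show ?thesis
      proof (cases "s \<le> b")
        case True
        define u where "u = t - b"
        have u: "u \<ge> 0" "d = dist (\<beta> s) (c u)"
          using False True by (auto simp: u_def d_def \<gamma>_def)
        have mem: "s \<in> {0..b}" "b \<in> {0..b}"
          using st True by auto
        have sb: "dist (\<beta> s) (\<beta> b) \<le> L * (b - s) + A" "b - s \<le> L * (dist (\<beta> s) (\<beta> b) + A)"
          using qi_embedding_onD[OF \<beta>(2) L mem] True by (auto simp: dist_real_def)
        have ud: "u \<le> d + 1"
          using away[OF mem(1) u(1)] u(2) by simp
        have cu: "dist (\<beta> b) (c u) \<le> u"
          using c(1) c(2)[of 0 u] u(1) by simp
        have "dist (\<beta> s) (\<beta> b) \<le> 2 * d + 1"
          using dist_triangle[of "\<beta> s" "\<beta> b" "c u"] cu ud u(2) by (simp add: dist_commute)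
        then have "L * (dist (\<beta> s) (\<beta> b) + A) \<le> L * (2 * d + 1 + A)"
          using L by (intro mult_left_mono) auto
        then have lo: "t - s \<le> L * (2 * d + 1 + A) + d + 1"
          using sb(2) ud by (simp add: u_def)
        have "d \<le> L * (b - s) + A + u"
          using dist_triangle[of "\<beta> s" "c u" "\<beta> b"] cu sb(1) u(2) by simp
        moreover have "L * (b - s) \<le> L * (t - s)"
          using L False by (intro mult_left_mono) auto
        ultimately show ?thesis
          using lo True by (simp add: u_def)
      next
        case False
        then have "d \<le> t - s" "t - s - 1 \<le> d"
          using c(2)[of "s - b" "t - b"] c(3)[of "s - b" "t - b"] \<open>\<not> t \<le> b\<close> st
          by (auto simp: d_def \<gamma>_def)
        then show ?thesis
          using d0 A L unfolding expand by linarith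
      qed
    qed
    then show "dist (\<gamma> s) (\<gamma> t) \<le> (2 * L + 1) * (t - s) + (A + 1)"
      using d0 unfolding d_def[symmetric] by (simp add: algebra_simps)
    show "t - s \<le> (2 * L + 1) * (dist (\<gamma> s) (\<gamma> t) + (A + 1))"
    proof -
      have "(2 * L + 1) * (d + (A + 1)) = 2 * (L * d) + 2 * (L * A) + 2 * L + d + A + 1"
        by (simp add: algebra_simps)
      then show ?thesis
        using main d0 L A unfolding d_def[symmetric] expand by linarith
    qed
  qed (use L in auto)
qed

text \<open>Below, \<open>F s y\<close> approximates the Busemann function of \<open>\<alpha> \<eta>\<close> at \<open>\<beta> s\<close>. Cutting \<open>\<beta>\<close> at an
  almost minimum \<open>b\<close> makes the continuation, which decreases \<open>F\<close> at unit speed, move away from the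
  part of \<open>\<beta>\<close> before \<open>b\<close>.\<close>

context geodesic_boundary
begin

lemma FQ_nbhd_neighbourhood:
  assumes \<zeta>: "\<zeta> \<in> contracting_boundary p" and r: "r \<ge> 1"
  obtains r2 where "r2 \<ge> 1"
    "\<And>\<eta>. \<eta> \<in> FQ_nbhd p \<alpha> \<zeta> r2 \<Longrightarrow> \<exists>R\<ge>1. FQ_nbhd p \<alpha> \<eta> R \<subseteq> FQ_nbhd p \<alpha> \<zeta> r"
proof -
  interpret z: geodesic_boundary_point p \<zeta> "\<alpha> \<zeta>"
    by (rule point[OF \<zeta>])
  \<comment> \<open>\<open>2 * r + 1\<close> and \<open>r + 1\<close> are the constants of a splice
    with \<open>L = A = r\<close>. Neither \<open>C\<close> nor \<open>r2\<close> depends on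
    \<open>\<eta>\<close>.\<close>
  define C where "C = kappa (rho_bd \<zeta>) (2 * r + 1) (r + 1) + 1"
  have C0: "C \<ge> 0"
    using z.kappa_lower(1)[of "r + 1" "rho_bd \<zeta>" "2 * r + 1"] r by (simp add: C_def)
  have bt0: "0 \<le> backtrack r r (kappa (rho_bd \<zeta>) r r) C"
    using z.kappa_lower(1)[of r "rho_bd \<zeta>" r] r C0 by (simp add: backtrack_def)
  define r2 where "r2 = r + backtrack r r (kappa (rho_bd \<zeta>) r r) C"
  have r2: "r2 \<ge> 1"
    using r bt0 by (simp add: r2_def)
  have "\<exists>R\<ge>1. FQ_nbhd p \<alpha> \<eta> R \<subseteq> FQ_nbhd p \<alpha> \<zeta> r" if \<eta>: "\<eta> \<in> FQ_nbhd p \<alpha> \<zeta> r2" for \<eta>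
  \<comment> \<open>The main case needs the two chosen geodesics to diverge.\<close>
  proof (cases "\<eta> = \<zeta>")
    case True
    then show ?thesis
      using r by blast
  next
    case False
    have \<eta>b: "\<eta> \<in> contracting_boundary p"
      using \<eta> by (simp add: FQ_nbhd_def)
    interpret e: geodesic_boundary_point p \<eta> "\<alpha> \<eta>"
      by (rule point[OF \<eta>b])
    \<comment> \<open>\<open>Ce\<close> is the error with which \<open>\<beta>\<close> meets the ray
      of \<open>\<eta>\<close>, \<open>N1\<close> bounds the distance of \<open>\<beta>\<close> to
      that ray up to the meeting, \<open>N2\<close> that of a bridge from \<open>\<beta>\<close> to
      the ray. They may depend on \<open>\<eta>\<close>, since \<open>R\<close> is chosen after
      \<open>\<eta>\<close>.\<close>
    define Ce where "Ce = kappa (rho_bd \<eta>) r r + 1"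
    obtain K where "contraction_scale e.Z r r K"
      using contraction_scale_exists[OF e.Z_contracting r order_trans[OF zero_le_one r]] by blast
    then have K1: "contraction_scale e.Z r r (max K Ce)"
      by (rule contraction_scale_mono) simp
    define N1 where "N1 = max K Ce + r * (2 * r * (2 * r + 3 * max K Ce)) + r"
    obtain K' where "contraction_scale e.Z 1 0 K'"
      using contraction_scale_exists[OF e.Z_contracting order_refl order_refl] by blast
    then have K2: "contraction_scale e.Z 1 0 (max K' N1)"
      by (rule contraction_scale_mono) simp
    define N2 where "N2 = max K' N1 + 1 * (2 * 1 * (2 * 0 + 3 * max K' N1)) + 0"
    have K20: "max K' N1 \<ge> 3 * 0"
      using K2 unfolding contraction_scale_def by blast
    have "\<exists>T0. \<forall>t\<ge>T0. C + N2 < infdist (\<alpha> \<eta> t) z.Z"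
    proof (rule ccontr)
      assume "\<not> ?thesis"
      then have "\<And>T. \<exists>t\<ge>T. infdist (\<alpha> \<eta> t) z.Z \<le> C + N2"
        by (meson not_less)
      then have "\<alpha> \<eta> \<in> \<zeta>"
        by (rule z.recurrent_geodesic_mem[OF e.geo e.start])
      then show False
        using boundary_point_eqI[OF \<eta>b \<zeta> e.mem] False by blast
    qed
    then obtain T0 where T0: "\<And>t. t \<ge> T0 \<Longrightarrow> C + N2 < infdist (\<alpha> \<eta> t) z.Z"
      by blast
    \<comment> \<open>Far enough out that every point of the continuation is near a point of the ray
      of \<open>\<eta>\<close> with parameter at least \<open>T0\<close>.\<close>
    define R where "R = max 1 (max T0 0 + Ce + 1 + N2)"
    have "\<xi> \<in> FQ_nbhd p \<alpha> \<zeta> r" if \<xi>: "\<xi> \<in> FQ_nbhd p \<alpha> \<eta> R" for \<xi>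
    proof (rule FQ_nbhdI[OF \<zeta> _ r C0])
      show \<xi>b: "\<xi> \<in> contracting_boundary p"
        using \<xi> by (simp add: FQ_nbhd_def)
      fix \<beta> assume \<beta>: "\<beta> \<in> \<xi>" "continuous_on {0..} \<beta>" "qi_embedding_on r r {0..} \<beta>"
      have b0: "\<beta> 0 = p"
        using boundary_eq_class(2)[OF \<xi>b \<beta>(1)] by (rule contracting_ray_start)
      have R1: "R \<ge> 1"
        by (simp add: R_def)
      obtain bb t0 where bb: "bb \<ge> 0" "t0 \<ge> R" "dist (\<beta> bb) (\<alpha> \<eta> t0) \<le> Ce"
        using FQ_nbhdD[OF \<eta>b \<xi> R1 r _ \<beta>] r unfolding Ce_def by auto
      have Ce0: "Ce \<ge> 0"
        using order_trans[OF zero_le_dist bb(3)] .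
      define F where "F = (\<lambda>s y. dist (\<beta> s) (\<alpha> \<eta> y) - y)"
      \<comment> \<open>One infimum over both parameters chooses the cut \<open>b\<close> and the
        landing point \<open>T\<close> together. It need not be attained, so 1 is conceded; this is
        the 1 in the hypotheses of the splice.\<close>
      define V where "V = {F s y | s y. s \<in> {0..bb} \<and> y \<ge> 0}"
      have F_low: "- (r * bb + r) \<le> F s y" if "s \<in> {0..bb}" "y \<ge> 0" for s y
      proof -
        have "dist (\<beta> s) p \<le> r * s + r"
          using qi_embedding_onD(1)[OF \<beta>(3) r, of s 0] that b0 by simp
        also have "\<dots> \<le> r * bb + r"
          using that r by simp
        finally show ?thesis
          using dist_triangle[of "\<alpha> \<eta> y" p "\<beta> s"] e.dist_start[OF that(2)]
          by (simp add: F_def dist_commute)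
      qed
      then have V: "bdd_below V" "V \<noteq> {}"
        unfolding V_def bdd_below_def using bb(1) by force+
      obtain b T where bT: "b \<in> {0..bb}" "T \<ge> 0" "F b T < Inf V + 1"
        using cInf_lessD[OF V(2), of "Inf V + 1"] unfolding V_def by auto
      have min: "F b T - 1 \<le> F s y" if "s \<in> {0..bb}" "y \<ge> 0" for s y
        using cInf_lower[OF _ V(1), of "F s y"] that bT(3) by (force simp: V_def)
      define l where "l = dist (\<beta> b) (\<alpha> \<eta> T)"
      have FbT: "F b T = l - T"
        by (simp add: F_def l_def)
      have l0: "l \<ge> 0"
        by (simp add: l_def)
      have t00: "t0 \<ge> 0"
        using bb(2) by (simp add: R_def)
      \<comment> \<open>Comparison with the known meeting at \<open>bb\<close> and \<open>t0\<close>
        shows that the bridge, of length \<open>l\<close>, lands far out relative to its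
        length.\<close>
      have "F b T - 1 \<le> Ce - t0"
        using min[of bb t0] bb t00 by (simp add: F_def)
      then have lT: "l \<le> T - t0 + Ce + 1"
        using FbT by simp
      obtain g where g: "geodesic_on {0..l} g" "g 0 = \<beta> b" "g l = \<alpha> \<eta> T"
        using geodesic_segment[OF X, of "\<beta> b" "\<alpha> \<eta> T"] unfolding l_def by blast
      define c where "c = (\<lambda>u. if u \<le> l then g u else \<alpha> \<eta> (T + u - l))"
      have gd: "dist (g u) (g v) = \<bar>u - v\<bar>" if "u \<in> {0..l}" "v \<in> {0..l}" for u v
        using geodesic_on_dist[OF g(1) that] .
      have ad: "dist (\<alpha> \<eta> u) (\<alpha> \<eta> v) = \<bar>u - v\<bar>" if "u \<ge> 0" "v \<ge> 0" for u v
        using geodesic_on_dist[OF e.geo] that by simp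
      have cont: "continuous_on {0..b} \<beta>" and qib: "qi_embedding_on r r {0..b} \<beta>"
        using continuous_on_subset[OF \<beta>(2)] qi_embedding_on_subset[OF \<beta>(3)] by auto
      have cu: "dist (c u) (c v) \<le> v - u" "v - u - 1 \<le> dist (c u) (c v)"
        if uv: "0 \<le> u" "u \<le> v" for u v
      proof -
        have "dist (c u) (c v) \<le> v - u \<and> v - u - 1 \<le> dist (c u) (c v)"
        proof (cases "v \<le> l")
          case True
          then show ?thesis
            using gd[of u v] uv by (simp add: c_def)
        next
          case False
          define y where "y = T + v - l"
          have y: "y \<ge> T" "c v = \<alpha> \<eta> y"
            using False by (auto simp: y_def c_def)
          show ?thesis
          proof (cases "u \<le> l")
            case True
            have cu: "c u = g u" "dist (g u) (\<alpha> \<eta> T) = l - u" "dist (\<beta> b) (g u) = u"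
              using gd[of u l] gd[of 0 u] g True uv l0 by (auto simp: c_def)
            have "dist (g u) (\<alpha> \<eta> y) \<le> v - u"
              using dist_triangle[of "g u" "\<alpha> \<eta> y" "\<alpha> \<eta> T"] cu ad[of T y] y bT(2)
              by (simp add: y_def)
            \<comment> \<open>Minimality over \<open>y\<close> at the cut itself: following the ray
              after the bridge gains distance from \<open>\<beta> b\<close> at unit speed, up to a
              total loss of 1.\<close>
            moreover have "l - T - 1 \<le> dist (\<beta> b) (\<alpha> \<eta> y) - y"
              using min[of b y] bT(1,2) y FbT by (simp add: F_def)
            then have "v - u - 1 \<le> dist (g u) (\<alpha> \<eta> y)"
              using dist_triangle[of "\<beta> b" "\<alpha> \<eta> y" "g u"] cu by (simp add: y_def)
            ultimately show ?thesis
              using cu y by simp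
          next
            case False
            then show ?thesis
              using ad[of "T + u - l" y] y bT(2) uv by (simp add: c_def y_def)
          qed
        qed
        then show "dist (c u) (c v) \<le> v - u" "v - u - 1 \<le> dist (c u) (c v)"
          by auto
      qed
      \<comment> \<open>Minimality over \<open>s\<close>: no earlier point of \<open>\<beta>\<close>
        is nearer to the continuation than the cut is, up to 1.\<close>
      have away: "u - 1 \<le> dist (\<beta> s) (c u)" if s: "s \<in> {0..b}" and u: "0 \<le> u" for s u
      proof -
        have s': "s \<in> {0..bb}"
          using s bT(1) by auto
        show ?thesis
        proof (cases "u \<le> l")
          case True
          have "l - T - 1 \<le> dist (\<beta> s) (\<alpha> \<eta> T) - T"
            using min[OF s' bT(2)] FbT by (simp add: F_def)
          moreover have "dist (g u) (\<alpha> \<eta> T) = l - u"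
            using gd[of u l] g True u l0 by simp
          ultimately show ?thesis
            using dist_triangle[of "\<beta> s" "\<alpha> \<eta> T" "g u"] True by (simp add: c_def)
        next
          case False
          then have "l - T - 1 \<le> dist (\<beta> s) (\<alpha> \<eta> (T + u - l)) - (T + u - l)"
            using min[OF s', of "T + u - l"] bT(2) FbT by (simp add: F_def)
          then show ?thesis
            using False by (simp add: c_def)
        qed
      qed
      define \<gamma> where "\<gamma> = (\<lambda>t. if t \<le> b then \<beta> t else c (t - b))"
      have c0: "c 0 = \<beta> b"
        using g(2) l0 by (simp add: c_def)
      have bge: "b \<ge> 0" and rge: "r \<ge> 0"
        using bT(1) r by auto
      have \<gamma>: "continuous_on {0..} \<gamma>" "qi_embedding_on (2 * r + 1) (r + 1) {0..} \<gamma>"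
        unfolding \<gamma>_def
        by (rule splice_quasi_geodesic[OF r rge bge cont qib c0 cu away]; assumption)+
      have \<gamma>0: "\<gamma> 0 = p"
        using b0 bge by (simp add: \<gamma>_def)
      \<comment> \<open>Only the finiteness of this bound matters: it puts the spliced ray into the
        class \<open>\<eta>\<close>.\<close>
      define D where "D = (2 * r + 1) * (b + l) + (r + 1) + T"
      have D0: "D \<ge> 0" "D \<ge> T"
        using r bge l0 bT(2) by (auto simp: D_def intro!: add_nonneg_nonneg mult_nonneg_nonneg)
      have tail: "\<gamma> (b + l + w) = \<alpha> \<eta> (T + w)" if "w \<ge> 0" for w
        using that l0 g c0 by (cases "w = 0"; cases "l = 0") (auto simp: \<gamma>_def c_def)
      have "hausdorff_within D e.Z (\<gamma> ` {0..})"
        unfolding hausdorff_within_def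
      proof (intro conjI ballI)
        fix x assume "x \<in> e.Z"
        then obtain t where t: "t \<ge> 0" "x = \<alpha> \<eta> t"
          by auto
        show "\<exists>y\<in>\<gamma> ` {0..}. dist x y \<le> D"
        proof (cases "t \<le> T")
          case True
          then have "dist x (\<gamma> 0) \<le> D"
            using t e.dist_start[OF t(1)] \<gamma>0 D0 by simp
          then show ?thesis
            by auto
        next
          case False
          then have "x = \<gamma> (b + l + (t - T))"
            using tail[of "t - T"] t by simp
          then show ?thesis
            using False bge l0 D0 by (intro bexI[of _ x]) auto
        qed
      next
        fix x assume "x \<in> \<gamma> ` {0..}"
        then obtain t where t: "t \<ge> 0" "x = \<gamma> t"
          by auto
        show "\<exists>y\<in>e.Z. dist x y \<le> D"
        proof (cases "t \<le> b + l")
          case True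
          have "dist x p \<le> (2 * r + 1) * t + (r + 1)"
            using qi_embedding_onD(1)[OF \<gamma>(2), of t 0] t \<gamma>0 r by simp
          also have "\<dots> \<le> (2 * r + 1) * (b + l) + (r + 1)"
            using True r by (intro add_right_mono mult_left_mono) auto
          finally have "dist x (\<alpha> \<eta> 0) \<le> D"
            using bT(2) e.start by (simp add: D_def)
          then show ?thesis
            by auto
        next
          case False
          then have "x = \<alpha> \<eta> (T + (t - b - l))"
            using tail[of "t - b - l"] t by (simp add: algebra_simps)
          then show ?thesis
            using False bT(2) D0 by (intro bexI[of _ x]) auto
        qed
      qed
      then have "\<gamma> \<in> \<eta>"
        using r by (intro boundary_memI[OF X \<eta>b e.mem _ _ \<gamma>(2) \<gamma>0]) auto
      then obtain s t where st: "s \<ge> 0" "t \<ge> r2" "dist (\<gamma> s) (\<alpha> \<zeta> t) \<le> C"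
        using FQ_nbhdD[OF \<zeta> \<eta> r2 _ _ _ \<gamma>] r unfolding C_def by auto
      have tz: "\<alpha> \<zeta> t \<in> z.Z"
        using st(2) r2 by simp
      \<comment> \<open>The point found near the ray of \<open>\<zeta>\<close> cannot lie on the
        continuation, which stays within \<open>N2\<close> of the part of the ray of
        \<open>\<eta>\<close> beyond \<open>T0\<close>; that part is farther than
        \<open>C + N2\<close> from the ray of \<open>\<zeta>\<close>.\<close>
      have "s \<le> b"
      proof (rule ccontr)
        assume "\<not> s \<le> b"
        define u where "u = s - b"
        have u: "u > 0" "\<gamma> s = c u"
          using \<open>\<not> s \<le> b\<close> by (auto simp: u_def \<gamma>_def)
        have TT: "T \<ge> T0" "t0 - Ce - 1 - N2 \<ge> T0"
          using lT l0 bb(2) K20 by (auto simp: R_def N2_def)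
        have "\<exists>y\<ge>T0. y \<ge> 0 \<and> dist (c u) (\<alpha> \<eta> y) \<le> N2"
        proof (cases "u \<le> l")
          case True
          have near: "infdist (\<beta> b) e.Z \<le> N1"
            unfolding N1_def
          proof (rule quasi_geodesic_stays_near[OF X e.Z_closed e.Z_ne K1])
            show "continuous_on {0..bb} \<beta>" "qi_embedding_on r r {0..bb} \<beta>"
              using continuous_on_subset[OF \<beta>(2)] qi_embedding_on_subset[OF \<beta>(3)] by auto
            have "p \<in> e.Z"
              using e.start by force
            then show "infdist (\<beta> 0) e.Z \<le> max K Ce"
              using b0 Ce0 by simp
            have "infdist (\<beta> bb) e.Z \<le> Ce"
              using bb(3) t00 by (intro infdist_le2[of "\<alpha> \<eta> t0"]) auto
            then show "infdist (\<beta> bb) e.Z \<le> max K Ce"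
              by simp
          qed (rule bT(1))
          have "infdist (g u) e.Z \<le> N2"
            unfolding N2_def
          proof (rule quasi_geodesic_stays_near[OF X e.Z_closed e.Z_ne K2])
            show "continuous_on {0..l} g" "qi_embedding_on 1 0 {0..l} g"
              using geodesic_on_continuous[OF g(1)] geodesic_on_imp_qi[OF g(1)] by auto
            show "infdist (g 0) e.Z \<le> max K' N1"
              using near g(2) by simp
            have "g l \<in> e.Z"
              using g(3) bT(2) by simp
            then show "infdist (g l) e.Z \<le> max K' N1"
              using K20 by simp
          qed (use u True in auto)
          then obtain y where y: "y \<ge> 0" "dist (g u) (\<alpha> \<eta> y) \<le> N2"
            using e.closest_point[of "g u"] by metis
          have "dist (g u) (\<alpha> \<eta> T) = l - u"
            using gd[of u l] g True u l0 by simp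
          then have "dist (\<alpha> \<eta> y) (\<alpha> \<eta> T) \<le> N2 + l"
            using dist_triangle[of "\<alpha> \<eta> y" "\<alpha> \<eta> T" "g u"] y(2) u by (simp add: dist_commute)
          then have "y \<ge> T - N2 - l"
            using ad[OF y(1) bT(2)] by linarith
          then have "y \<ge> T0"
            using lT TT by linarith
          then show ?thesis
            using y True by (auto simp: c_def)
        next
          case False
          then show ?thesis
            using TT bT(2) K20 by (intro exI[of _ "T + u - l"]) (auto simp: c_def N2_def)
        qed
        then obtain y where y: "y \<ge> T0" "y \<ge> 0" "dist (c u) (\<alpha> \<eta> y) \<le> N2"
          by blast
        have "infdist (\<alpha> \<eta> y) z.Z \<le> dist (\<alpha> \<eta> y) (\<alpha> \<zeta> t)"
          by (rule infdist_le[OF tz])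
        also have "\<dots> \<le> N2 + C"
          using dist_triangle[of "\<alpha> \<eta> y" "\<alpha> \<zeta> t" "c u"] y(3) st(3) u(2) by (simp add: dist_commute)
        finally show False
          using T0[OF y(1)] by simp
      qed
      then show "\<exists>s\<ge>0. \<exists>t\<ge>r + backtrack r r (kappa (rho_bd \<zeta>) r r) C. dist (\<beta> s) (\<alpha> \<zeta> t) \<le> C"
        using st unfolding r2_def \<gamma>_def by auto
    qed
    then show ?thesis
      by (intro exI[of _ R]) (auto simp: R_def)
  qed
  then show thesis
    using that[OF r2] by blast
qed

end

text \<open>\<open>FQ_nbhd\<close> tests continuous rays only, whereas composing with
  \<open>\<phi>\<close> or lifting through it can destroy continuity. Joining the values at integers
  by geodesics of length at most \<open>L + A\<close> gives a Lipschitz path with the same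
  multiplicative constant and the same start.\<close>

lemma tame_quasi_geodesic:
  fixes \<gamma> :: "real \<Rightarrow> 'a::metric_space"
  assumes X: "proper_geodesic_space TYPE('a)"
    and L: "L \<ge> 1" and A: "A \<ge> 0" and qi: "qi_embedding_on L A {0..} \<gamma>"
  obtains \<gamma>' where "continuous_on {0..} \<gamma>'" "\<gamma>' 0 = \<gamma> 0"
    "\<And>t. t \<ge> 0 \<Longrightarrow> dist (\<gamma>' t) (\<gamma> t) \<le> 2 * (L + A)"
    "qi_embedding_on L (A + 4 * (L + A)) {0..} \<gamma>'"
proof -
  define M where "M = L + A"
  have M: "M \<ge> 0"
    using L A by (simp add: M_def)
  have "\<exists>h. h 0 = \<gamma> (real n) \<and> h 1 = \<gamma> (real (Suc n)) \<and>
      (\<forall>s\<in>{0..1}. \<forall>t\<in>{0..1}. dist (h s) (h t) \<le> M * \<bar>s - t\<bar>)" for n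
  proof -
    define d where "d = dist (\<gamma> (real n)) (\<gamma> (real (Suc n)))"
    obtain g where g: "geodesic_on {0..d} g" "g 0 = \<gamma> (real n)" "g d = \<gamma> (real (Suc n))"
      using geodesic_segment[OF X] unfolding d_def by blast
    have d: "0 \<le> d" "d \<le> M"
      using qi_embedding_onD(1)[OF qi L, of "real n" "real (Suc n)"]
      by (auto simp: d_def M_def dist_real_def)
    have "dist (g (s * d)) (g (t * d)) \<le> M * \<bar>s - t\<bar>" if "s \<in> {0..1}" "t \<in> {0..1}" for s t
    proof -
      have "s * d \<in> {0..d}" "t * d \<in> {0..d}"
        using that d mult_right_mono[of s 1 d] mult_right_mono[of t 1 d] by auto
      then have "dist (g (s * d)) (g (t * d)) = \<bar>s - t\<bar> * d"
        using geodesic_on_dist[OF g(1)] d by (simp add: abs_mult flip: left_diff_distrib)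
      also have "\<dots> \<le> \<bar>s - t\<bar> * M"
        using d by (intro mult_left_mono) auto
      finally show ?thesis
        by (simp add: mult.commute)
    qed
    then show ?thesis
      using g by (intro exI[of _ "\<lambda>s. g (s * d)"]) auto
  qed
  then obtain h where h: "\<And>n. h n 0 = \<gamma> (real n)" "\<And>n. h n 1 = \<gamma> (real (Suc n))"
      "\<And>n s t. s \<in> {0..1} \<Longrightarrow> t \<in> {0..1} \<Longrightarrow> dist (h n s) (h n t) \<le> M * \<bar>s - t\<bar>"
    by metis
  define \<gamma>' where "\<gamma>' = (\<lambda>t. h (nat \<lfloor>t\<rfloor>) (t - real (nat \<lfloor>t\<rfloor>)))"
  have nat_le: "real (nat \<lfloor>t\<rfloor>) \<le> t" "t < real (nat \<lfloor>t\<rfloor>) + 1" if "t \<ge> 0" for t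
    using that by (auto simp: of_nat_nat)
  have at_nat: "\<gamma>' (real n) = \<gamma> (real n)" for n
    by (simp add: \<gamma>'_def h(1))
  have piece: "dist (\<gamma>' s) (\<gamma>' t) \<le> M * (t - s)"
    if "real n \<le> s" "s \<le> t" "t \<le> real (Suc n)" for n s t
  proof -
    \<comment> \<open>At the right endpoint \<open>\<gamma>'\<close> already uses the next piece;
      the pieces agree there.\<close>
    have eq: "\<gamma>' u = h n (u - real n)" if u: "real n \<le> u" "u \<le> real (Suc n)" for u
    proof (cases "u = real (Suc n)")
      case True
      then show ?thesis
        using at_nat[of "Suc n"] h(2)[of n] by simp
    next
      case False
      then have "\<lfloor>u\<rfloor> = int n"
        using u by (intro floor_unique) auto
      then show ?thesis
        by (simp add: \<gamma>'_def)
    qed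
    show ?thesis
      using eq[of s] eq[of t] h(3)[of "s - real n" "t - real n" n] that by simp
  qed
  have near: "dist (\<gamma>' t) (\<gamma> t) \<le> 2 * M" if t: "t \<ge> 0" for t
  proof -
    define n where "n = nat \<lfloor>t\<rfloor>"
    have n: "real n \<le> t" "t \<le> real (Suc n)"
      using nat_le[OF t] unfolding n_def of_nat_Suc by linarith+
    have "dist (\<gamma>' (real n)) (\<gamma>' t) \<le> M * (t - real n)"
      using piece[of n "real n" t] n by simp
    also have "\<dots> \<le> M * 1"
      using n M by (intro mult_left_mono) auto
    finally have 1: "dist (\<gamma> (real n)) (\<gamma>' t) \<le> M"
      using at_nat by simp
    have "dist (\<gamma> (real n)) (\<gamma> t) \<le> L * (t - real n) + A"
      using qi_embedding_onD(1)[OF qi L, of "real n" t] n t by (simp add: dist_real_def)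
    also have "\<dots> \<le> L * 1 + A"
      using n L by (intro add_right_mono mult_left_mono) auto
    finally show ?thesis
      using 1 dist_triangle[of "\<gamma>' t" "\<gamma> t" "\<gamma> (real n)"] by (simp add: dist_commute M_def)
  qed
  have ints: "dist (\<gamma>' (real m)) (\<gamma>' (real (m + k))) \<le> M * real k" for m k
  proof (induction k)
    case (Suc k)
    have "dist (\<gamma>' (real (m + k))) (\<gamma>' (real (m + Suc k))) \<le> M"
      using piece[of "m + k" "real (m + k)" "real (m + Suc k)"] by simp
    then show ?case
      using Suc dist_triangle[of "\<gamma>' (real m)" "\<gamma>' (real (m + Suc k))" "\<gamma>' (real (m + k))"]
      by (simp add: algebra_simps)
  qed simp
  have lip: "dist (\<gamma>' s) (\<gamma>' t) \<le> M * (t - s)" if st: "0 \<le> s" "s \<le> t" for s t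
  proof -
    define m n where "m = nat \<lfloor>s\<rfloor>" and "n = nat \<lfloor>t\<rfloor>"
    have mn: "real m \<le> s" "s \<le> real (Suc m)" "real n \<le> t" "t \<le> real (Suc n)"
      using nat_le[of s] nat_le[of t] st unfolding m_def n_def of_nat_Suc by linarith+
    have "m \<le> n"
      unfolding m_def n_def using st by (intro nat_mono floor_mono)
    show ?thesis
    proof (cases "m = n")
      case True
      then show ?thesis
        using piece[of m s t] mn st by simp
    next
      case False
      then obtain k where k: "n = Suc m + k"
        using \<open>m \<le> n\<close> less_eq_Suc_le le_iff_add by (metis order_neq_le_trans)
      have "dist (\<gamma>' s) (\<gamma>' (real (Suc m))) \<le> M * (real (Suc m) - s)"
        using piece[of m s "real (Suc m)"] mn by simp
      moreover have "dist (\<gamma>' (real (Suc m))) (\<gamma>' (real n)) \<le> M * real k"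
        using ints[of "Suc m" k] k by simp
      moreover have "dist (\<gamma>' (real n)) (\<gamma>' t) \<le> M * (t - real n)"
        using piece[of n "real n" t] mn by simp
      moreover have "dist (\<gamma>' s) (\<gamma>' t) \<le> dist (\<gamma>' s) (\<gamma>' (real (Suc m)))
          + dist (\<gamma>' (real (Suc m))) (\<gamma>' (real n)) + dist (\<gamma>' (real n)) (\<gamma>' t)"
        by metric
      ultimately have "dist (\<gamma>' s) (\<gamma>' t) \<le> M * (real (Suc m) - s) + M * real k + M * (t - real n)"
        by linarith
      also have "\<dots> = M * (t - s)"
        using k by (simp add: algebra_simps)
      finally show ?thesis .
    qed
  qed
  show thesis
  proof (rule that[of \<gamma>'])
    show "continuous_on {0..} \<gamma>'"
    proof (rule lipschitz_imp_continuous_on[OF _ M])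
      show "dist (\<gamma>' s) (\<gamma>' t) \<le> M * dist s t" if "s \<in> {0..}" "t \<in> {0..}" for s t
        using lip[of s t] lip[of t s] that by (cases "s \<le> t") (auto simp: dist_real_def dist_commute)
    qed
    show "\<gamma>' 0 = \<gamma> 0"
      using at_nat[of 0] by simp
    show "dist (\<gamma>' t) (\<gamma> t) \<le> 2 * (L + A)" if "t \<ge> 0" for t
      using near[OF that] by (simp add: M_def)
    show "qi_embedding_on L (A + 4 * (L + A)) {0..} \<gamma>'"
    proof (rule qi_embedding_onI[OF L])
      fix s t :: real assume st: "s \<in> {0..}" "t \<in> {0..}"
      have q: "dist (\<gamma> s) (\<gamma> t) \<le> L * dist s t + A" "dist s t \<le> L * (dist (\<gamma> s) (\<gamma> t) + A)"
        using qi_embedding_onD[OF qi L st] .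
      have n: "dist (\<gamma>' s) (\<gamma> s) \<le> 2 * M" "dist (\<gamma>' t) (\<gamma> t) \<le> 2 * M"
        using near st by auto
      have "dist (\<gamma>' s) (\<gamma>' t) \<le> dist (\<gamma>' s) (\<gamma> s) + dist (\<gamma> s) (\<gamma> t) + dist (\<gamma>' t) (\<gamma> t)"
        by metric
      then show "dist (\<gamma>' s) (\<gamma>' t) \<le> L * dist s t + (A + 4 * (L + A))"
        using n q(1) unfolding M_def by linarith
      have "dist (\<gamma> s) (\<gamma> t) \<le> dist (\<gamma>' s) (\<gamma> s) + dist (\<gamma>' s) (\<gamma>' t) + dist (\<gamma>' t) (\<gamma> t)"
        by metric
      then have "dist (\<gamma> s) (\<gamma> t) + A \<le> dist (\<gamma>' s) (\<gamma>' t) + (A + 4 * (L + A))"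
        using n unfolding M_def by linarith
      then show "dist s t \<le> L * (dist (\<gamma>' s) (\<gamma>' t) + (A + 4 * (L + A)))"
        using q(2) L by (meson mult_left_mono order_trans zero_le_one)
    qed
  qed
qed


section \<open>The boundary map\<close>

lemma qi_embedding_on_compose:
  assumes L: "L \<ge> 1" "L' \<ge> 1" "A' \<ge> 0"
    and f: "qi_embedding_on L A UNIV f" and g: "qi_embedding_on L' A' S g" and A: "A \<ge> 0"
  shows "qi_embedding_on (L * L') (L * A' + A) S (f \<circ> g)"
proof (rule qi_embedding_onI)
  show "1 \<le> L * L'"
    using mult_mono[of 1 L 1 L'] L by simp
  fix x y assume xy: "x \<in> S" "y \<in> S"
  note gx = qi_embedding_onD[OF g L(2) xy]
  note fx = qi_embedding_onD[OF f L(1) UNIV_I UNIV_I, of "g x" "g y"]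
  have "L * dist (g x) (g y) \<le> L * (L' * dist x y + A')"
    using gx(1) L by (intro mult_left_mono) auto
  then show "dist ((f \<circ> g) x) ((f \<circ> g) y) \<le> L * L' * dist x y + (L * A' + A)"
    using fx(1) by (simp add: algebra_simps)
  have "A' \<le> L * A'"
    using mult_right_mono[OF L(1) L(3)] by simp
  then have "dist (g x) (g y) + A' \<le> L * (dist (f (g x)) (f (g y)) + (A + A'))"
    using fx(2) by (simp add: algebra_simps)
  also have "\<dots> \<le> L * (dist (f (g x)) (f (g y)) + (L * A' + A))"
    using \<open>A' \<le> L * A'\<close> L by (intro mult_left_mono) auto
  finally have "L' * (dist (g x) (g y) + A') \<le> L' * (L * (dist (f (g x)) (f (g y)) + (L * A' + A)))"
    using L by (intro mult_left_mono) auto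
  then show "dist x y \<le> L * L' * (dist ((f \<circ> g) x) ((f \<circ> g) y) + (L * A' + A))"
    using gx(2) by (simp add: mult_ac)
qed

lemma hausdorff_within_image:
  assumes f: "qi_embedding_on L A UNIV f" and L: "L \<ge> 1" and D: "hausdorff_within D S T"
  shows "hausdorff_within (L * D + A) (f ` S) (f ` T)"
proof -
  have "dist (f x) (f y) \<le> L * D + A" if "dist x y \<le> D" for x y
    using qi_embedding_onD(1)[OF f L UNIV_I UNIV_I, of x y] mult_left_mono[OF that, of L] L by linarith
  then show ?thesis
    using D unfolding hausdorff_within_def by blast
qed

lemma hausdorff_within_preimage:
  assumes f: "qi_embedding_on L A UNIV f" and L: "L \<ge> 1" and D: "hausdorff_within D (f ` S) (f ` T)"
  shows "hausdorff_within (L * (D + A)) S T"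
proof -
  have "dist x y \<le> L * (D + A)" if "dist (f x) (f y) \<le> D" for x y
    using qi_embedding_onD(2)[OF f L UNIV_I UNIV_I, of x y]
      mult_left_mono[OF add_right_mono[OF that], of L A] L by linarith
  then show ?thesis
    using D unfolding hausdorff_within_def by blast
qed

text \<open>The setting common to both halves of the theorem. The assumption \<open>rays\<close>
  comes from preservation in one half and from contraction of \<open>range \<phi>\<close> in the
  other.\<close>

locale boundary_embedding =
  dom: geodesic_boundary p \<alpha> + cod: geodesic_boundary "\<phi> p" \<alpha>'
  for \<phi> :: "'a::metric_space \<Rightarrow> 'b::metric_space" and p \<alpha> \<alpha>' +
  fixes L A :: real
  assumes L: "L \<ge> 1" and A: "A \<ge> 0" and qi: "qi_embedding_on L A UNIV \<phi>"
    and rays: "\<And>\<gamma>. \<gamma> \<in> contracting_rays p \<Longrightarrow> \<phi> \<circ> \<gamma> \<in> contracting_rays (\<phi> p)"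
begin

lemma up: "dist (\<phi> x) (\<phi> y) \<le> L * dist x y + A" and lo: "dist x y \<le> L * (dist (\<phi> x) (\<phi> y) + A)"
  using qi_embedding_onD[OF qi L] by auto

abbreviation bmap where "bmap \<equiv> boundary_map p \<phi>"

lemma ray_rel_image:
  assumes "(\<beta>, \<gamma>) \<in> ray_rel p"
  shows "(\<phi> \<circ> \<beta>, \<phi> \<circ> \<gamma>) \<in> ray_rel (\<phi> p)"
  using assms rays hausdorff_within_image[OF qi L] unfolding ray_rel_iff image_comp[symmetric] by blast

lemma boundary_map_class:
  assumes "\<gamma> \<in> contracting_rays p"
  shows "bmap (ray_rel p `` {\<gamma>}) = ray_rel (\<phi> p) `` {\<phi> \<circ> \<gamma>}"
proof -
  have "ray_rel (\<phi> p) `` {\<phi> \<circ> \<beta>} = ray_rel (\<phi> p) `` {\<phi> \<circ> \<gamma>}" if "\<beta> \<in> ray_rel p `` {\<gamma>}" for \<beta>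
    using ray_rel_image[of \<gamma> \<beta>] that equiv_class_eq[OF equiv_ray_rel] by blast
  then show ?thesis
    unfolding boundary_map_def using class_in_boundary(2)[OF assms] by blast
qed

lemma induces: "induces_boundary_map p \<phi>"
  unfolding induces_boundary_map_def using rays boundary_map_class by blast

lemma boundary_map_point:
  assumes "\<zeta> \<in> contracting_boundary p"
  shows "bmap \<zeta> \<in> contracting_boundary (\<phi> p)" and "\<gamma> \<in> \<zeta> \<Longrightarrow> \<phi> \<circ> \<gamma> \<in> bmap \<zeta>"
proof -
  have *: "bmap \<zeta> = ray_rel (\<phi> p) `` {\<phi> \<circ> \<gamma>}" "\<phi> \<circ> \<gamma> \<in> contracting_rays (\<phi> p)" if "\<gamma> \<in> \<zeta>" for \<gamma>
    using boundary_eq_class[OF assms that] boundary_map_class rays by auto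
  show "\<phi> \<circ> \<gamma> \<in> bmap \<zeta>" if "\<gamma> \<in> \<zeta>"
    using *[OF that] class_in_boundary(2) by simp
  have "\<alpha> \<zeta> \<in> \<zeta>"
    using dom.choice assms by (simp add: geodesic_choice_def)
  then show "bmap \<zeta> \<in> contracting_boundary (\<phi> p)"
    using * class_in_boundary(1) by metis
qed

text \<open>The lower bound for \<open>\<phi>\<close> pulls a finite Hausdorff distance between
  image rays back to the rays themselves.\<close>

lemma boundary_map_inj: "inj_on bmap (contracting_boundary p)"
proof (rule inj_onI)
  fix \<zeta> \<eta> assume b: "\<zeta> \<in> contracting_boundary p" "\<eta> \<in> contracting_boundary p" and eq: "bmap \<zeta> = bmap \<eta>"
  have mem: "\<alpha> \<zeta> \<in> \<zeta>" "\<alpha> \<eta> \<in> \<eta>"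
    using dom.choice b by (auto simp: geodesic_choice_def)
  have "\<phi> \<circ> \<alpha> \<zeta> \<in> bmap \<zeta>" "\<phi> \<circ> \<alpha> \<eta> \<in> bmap \<zeta>"
    using boundary_map_point(2)[OF b(1) mem(1)] boundary_map_point(2)[OF b(2) mem(2)] eq by auto
  then obtain D where "hausdorff_within D ((\<phi> \<circ> \<alpha> \<zeta>) ` {0..}) ((\<phi> \<circ> \<alpha> \<eta>) ` {0..})"
    using boundary_mem_iff[OF boundary_map_point(1)[OF b(1)]] by blast
  then have "hausdorff_within (L * (D + A)) (\<alpha> \<zeta> ` {0..}) (\<alpha> \<eta> ` {0..})"
    unfolding image_comp[symmetric] by (rule hausdorff_within_preimage[OF qi L])
  then have "\<alpha> \<eta> \<in> \<zeta>"
    using boundary_mem_iff[OF b(1) mem(1)] boundary_eq_class(2)[OF b(2) mem(2)] by blast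
  then show "\<zeta> = \<eta>"
    using boundary_point_eqI[OF b _ mem(2)] by blast
qed

lemma image_ray_near:
  assumes "\<zeta> \<in> contracting_boundary p"
  obtains D where "D \<ge> 0" "hausdorff_within D (\<phi> ` \<alpha> \<zeta> ` {0..}) (\<alpha>' (bmap \<zeta>) ` {0..})"
proof -
  have "\<alpha> \<zeta> \<in> \<zeta>"
    using dom.choice assms by (simp add: geodesic_choice_def)
  moreover have "\<alpha>' (bmap \<zeta>) \<in> bmap \<zeta>"
    using cod.choice boundary_map_point(1)[OF assms] by (simp add: geodesic_choice_def)
  ultimately obtain D where D: "hausdorff_within D ((\<phi> \<circ> \<alpha> \<zeta>) ` {0..}) (\<alpha>' (bmap \<zeta>) ` {0..})"
    using boundary_mem_iff[OF boundary_map_point(1)[OF assms]] boundary_map_point(2)[OF assms] by blast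
  then obtain x where "dist (\<phi> (\<alpha> \<zeta> 0)) x \<le> D"
    unfolding hausdorff_within_def by force
  then have "D \<ge> 0"
    using order_trans[OF zero_le_dist] by blast
  then show thesis
    using D that by (simp add: image_comp)
qed

section \<open>Openness onto the image\<close>

text \<open>A ray of \<open>\<eta>\<close> is pushed forward and made continuous; its meeting with
  the ray of \<open>bmap \<zeta>\<close> is carried back by the lower bound for
  \<open>\<phi>\<close>. No error depends on \<open>\<eta>\<close>, so \<open>R\<close> can be
  chosen first.\<close>

lemma preimage_of_neighbourhood:
  assumes \<zeta>: "\<zeta> \<in> contracting_boundary p" and r: "r \<ge> 1"
  obtains R where "R \<ge> 1" "\<And>\<eta>. \<eta> \<in> contracting_boundary p \<Longrightarrow>
    bmap \<eta> \<in> FQ_nbhd (\<phi> p) \<alpha>' (bmap \<zeta>) R \<Longrightarrow> \<eta> \<in> FQ_nbhd p \<alpha> \<zeta> r"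
proof -
  interpret z: geodesic_boundary_point p \<zeta> "\<alpha> \<zeta>"
    by (rule dom.point[OF \<zeta>])
  have \<zeta>': "bmap \<zeta> \<in> contracting_boundary (\<phi> p)"
    by (rule boundary_map_point(1)[OF \<zeta>])
  interpret z': geodesic_boundary_point "\<phi> p" "bmap \<zeta>" "\<alpha>' (bmap \<zeta>)"
    by (rule cod.point[OF \<zeta>'])
  obtain D where D: "D \<ge> 0" "hausdorff_within D (\<phi> ` z.Z) z'.Z"
    using image_ray_near[OF \<zeta>] by blast
  define Lb Ab M where "Lb = L * r" and "Ab = L * r + A" and "M = 2 * (Lb + Ab)"
  have r0: "r \<ge> 0"
    using r by simp
  have Lb: "Lb \<ge> 1" and Ab: "Ab \<ge> 0"
    using mult_mono[of 1 L 1 r] L A r by (auto simp: Lb_def Ab_def)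
  have M: "M \<ge> 0"
    using Lb Ab by (simp add: M_def)
  define K' where "K' = kappa (rho_bd (bmap \<zeta>)) Lb (Ab + 4 * (Lb + Ab)) + 1"
  have K': "K' \<ge> 0"
    using z'.kappa_lower(1)[of "Ab + 4 * (Lb + Ab)" "rho_bd (bmap \<zeta>)" Lb] Lb Ab by (simp add: K'_def)
  define C where "C = L * (M + K' + D + A)"
  have C: "C \<ge> 0"
    using L M K' D A by (simp add: C_def)
  define T where "T = r + backtrack r r (kappa (rho_bd \<zeta>) r r) C"
  \<comment> \<open>Parameters transfer by \<open>t \<le> D + L * t1 + A\<close>, so
    \<open>t \<ge> R\<close> forces \<open>t1 \<ge> T\<close>.\<close>
  define R where "R = max 1 (L * T + D + A)"
  have R1: "R \<ge> 1"
    by (simp add: R_def)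
  have "\<eta> \<in> FQ_nbhd p \<alpha> \<zeta> r"
    if \<eta>: "\<eta> \<in> contracting_boundary p" and \<eta>': "bmap \<eta> \<in> FQ_nbhd (\<phi> p) \<alpha>' (bmap \<zeta>) R" for \<eta>
  proof (rule dom.FQ_nbhdI[OF \<zeta> \<eta> r C])
    fix \<beta> assume \<beta>: "\<beta> \<in> \<eta>" "continuous_on {0..} \<beta>" "qi_embedding_on r r {0..} \<beta>"
    have "qi_embedding_on Lb Ab {0..} (\<phi> \<circ> \<beta>)"
      unfolding Lb_def Ab_def by (rule qi_embedding_on_compose[OF L r r0 qi \<beta>(3) A])
    then obtain \<beta>' where \<beta>': "continuous_on {0..} \<beta>'" "\<beta>' 0 = (\<phi> \<circ> \<beta>) 0"
      "\<And>t. t \<ge> 0 \<Longrightarrow> dist (\<beta>' t) ((\<phi> \<circ> \<beta>) t) \<le> M"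
      "qi_embedding_on Lb (Ab + 4 * (Lb + Ab)) {0..} \<beta>'"
      using tame_quasi_geodesic[OF cod.X Lb Ab] unfolding M_def by metis
    have "hausdorff_within M ((\<phi> \<circ> \<beta>) ` {0..}) (\<beta>' ` {0..})"
      unfolding hausdorff_within_def using \<beta>'(3) by (auto simp: dist_commute)
    moreover have "\<beta> 0 = p"
      using boundary_eq_class(2)[OF \<eta> \<beta>(1)] by (rule contracting_ray_start)
    ultimately have mem: "\<beta>' \<in> bmap \<eta>"
      using Lb Ab \<beta>'(2)
      by (intro boundary_memI[OF cod.X boundary_map_point(1)[OF \<eta>]
            boundary_map_point(2)[OF \<eta> \<beta>(1)] Lb _ \<beta>'(4)]) auto
    obtain s t where st: "s \<ge> 0" "t \<ge> R" "dist (\<beta>' s) (\<alpha>' (bmap \<zeta>) t) \<le> K'"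
      using cod.FQ_nbhdD[OF \<zeta>' \<eta>' R1 Lb _ mem \<beta>'(1,4)] Lb Ab unfolding K'_def by auto
    have t0: "t \<ge> 0"
      using st(2) R1 by simp
    obtain t1 where t1: "t1 \<ge> 0" "dist (\<alpha>' (bmap \<zeta>) t) (\<phi> (\<alpha> \<zeta> t1)) \<le> D"
      using D(2) t0 unfolding hausdorff_within_def by auto
    have "dist (\<phi> (\<beta> s)) (\<phi> (\<alpha> \<zeta> t1)) \<le> dist (\<beta>' s) (\<phi> (\<beta> s)) + dist (\<beta>' s) (\<alpha>' (bmap \<zeta>) t)
        + dist (\<alpha>' (bmap \<zeta>) t) (\<phi> (\<alpha> \<zeta> t1))"
      by metric
    also have "\<dots> \<le> M + K' + D"
      using \<beta>'(3)[OF st(1)] st(3) t1(2) by simp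
    finally have "L * (dist (\<phi> (\<beta> s)) (\<phi> (\<alpha> \<zeta> t1)) + A) \<le> C"
      unfolding C_def using L by (intro mult_left_mono) auto
    then have close: "dist (\<beta> s) (\<alpha> \<zeta> t1) \<le> C"
      using lo order_trans by blast
    have "t \<le> dist (\<alpha>' (bmap \<zeta>) t) (\<phi> (\<alpha> \<zeta> t1)) + dist (\<phi> (\<alpha> \<zeta> t1)) (\<phi> p)"
      using z'.dist_start[OF t0] dist_triangle[of "\<alpha>' (bmap \<zeta>) t" "\<phi> p" "\<phi> (\<alpha> \<zeta> t1)"] by simp
    also have "\<dots> \<le> D + L * t1 + A"
      using t1(2) up[of "\<alpha> \<zeta> t1" p] z.dist_start[OF t1(1)] by simp
    finally have "L * T \<le> L * t1"
      using st(2) by (simp add: R_def)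
    then have "T \<le> t1"
      using L by simp
    then show "\<exists>s\<ge>0. \<exists>t\<ge>r + backtrack r r (kappa (rho_bd \<zeta>) r r) C. dist (\<beta> s) (\<alpha> \<zeta> t) \<le> C"
      unfolding T_def[symmetric] using st(1) close by blast
  qed
  then show thesis
    using that[OF R1] by blast
qed

lemma boundary_map_open:
  "open_map (FQ_topology p \<alpha>)
     (subtopology (FQ_topology (\<phi> p) \<alpha>') (bmap ` contracting_boundary p)) bmap"
  unfolding open_map_def
proof (intro allI impI)
  fix U assume "openin (FQ_topology p \<alpha>) U"
  then have U: "U \<subseteq> contracting_boundary p" "\<And>\<zeta>. \<zeta> \<in> U \<Longrightarrow> \<exists>r\<ge>1. FQ_nbhd p \<alpha> \<zeta> r \<subseteq> U"
    by (auto simp: openin_FQ_topology[OF dom.choice] FQ_open_def)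
  let ?I = "bmap ` contracting_boundary p"
  \<comment> \<open>Every boundary point of the target with a neighbourhood whose trace on the image
    lies in the image of \<open>U\<close>, whether or not the point itself is in the image. That
    \<open>V\<close> is open is the use of \<open>FQ_nbhd_neighbourhood\<close>.\<close>
  define V where "V = {\<eta> \<in> contracting_boundary (\<phi> p).
      \<exists>R\<ge>1. FQ_nbhd (\<phi> p) \<alpha>' \<eta> R \<inter> ?I \<subseteq> bmap ` U}"
  have "\<exists>r\<ge>1. FQ_nbhd (\<phi> p) \<alpha>' \<eta> r \<subseteq> V" if \<eta>: "\<eta> \<in> V" for \<eta>
  proof -
    obtain R where R: "\<eta> \<in> contracting_boundary (\<phi> p)" "R \<ge> 1" "FQ_nbhd (\<phi> p) \<alpha>' \<eta> R \<inter> ?I \<subseteq> bmap ` U"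
      using \<eta> unfolding V_def by blast
    obtain r where r: "r \<ge> 1"
      "\<And>\<xi>. \<xi> \<in> FQ_nbhd (\<phi> p) \<alpha>' \<eta> r \<Longrightarrow> \<exists>R'\<ge>1. FQ_nbhd (\<phi> p) \<alpha>' \<xi> R' \<subseteq> FQ_nbhd (\<phi> p) \<alpha>' \<eta> R"
      using cod.FQ_nbhd_neighbourhood[OF R(1,2)] by blast
    have "FQ_nbhd (\<phi> p) \<alpha>' \<eta> r \<subseteq> V"
    proof
      fix \<xi> assume x: "\<xi> \<in> FQ_nbhd (\<phi> p) \<alpha>' \<eta> r"
      then have "\<xi> \<in> contracting_boundary (\<phi> p)"
        by (simp add: FQ_nbhd_def)
      then show "\<xi> \<in> V"
        using r(2)[OF x] R(3) unfolding V_def by blast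
    qed
    then show ?thesis
      using r(1) by blast
  qed
  then have "openin (FQ_topology (\<phi> p) \<alpha>') V"
    unfolding openin_FQ_topology[OF cod.choice] FQ_open_def V_def by blast
  moreover have "bmap ` U = V \<inter> ?I"
  proof
    show "V \<inter> ?I \<subseteq> bmap ` U"
      using cod.FQ_nbhd_self unfolding V_def by blast
    show "bmap ` U \<subseteq> V \<inter> ?I"
    proof
      fix \<zeta>' assume "\<zeta>' \<in> bmap ` U"
      then obtain \<zeta> where \<zeta>: "\<zeta> \<in> U" "\<zeta>' = bmap \<zeta>"
        by blast
      obtain r where r: "r \<ge> 1" "FQ_nbhd p \<alpha> \<zeta> r \<subseteq> U"
        using U(2)[OF \<zeta>(1)] by blast
      have \<zeta>b: "\<zeta> \<in> contracting_boundary p"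
        using \<zeta>(1) U(1) by blast
      obtain R where R: "R \<ge> 1" "\<And>\<eta>. \<eta> \<in> contracting_boundary p \<Longrightarrow>
          bmap \<eta> \<in> FQ_nbhd (\<phi> p) \<alpha>' (bmap \<zeta>) R \<Longrightarrow> \<eta> \<in> FQ_nbhd p \<alpha> \<zeta> r"
        using preimage_of_neighbourhood[OF \<zeta>b r(1)] by blast
      then have "FQ_nbhd (\<phi> p) \<alpha>' \<zeta>' R \<inter> ?I \<subseteq> bmap ` U"
        using r(2) \<zeta>(2) by blast
      then show "\<zeta>' \<in> V \<inter> ?I"
        unfolding V_def using R(1) \<zeta>(2) \<zeta>b boundary_map_point(1)[OF \<zeta>b] by blast
    qed
  qed
  ultimately show "openin (subtopology (FQ_topology (\<phi> p) \<alpha>') ?I) (bmap ` U)"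
    unfolding openin_subtopology by blast
qed

section \<open>Continuity for a contracting image\<close>

text \<open>A quasi-geodesic ray in the class \<open>bmap \<eta>\<close> keeps returning near
  \<open>range \<phi>\<close>, because the class comes from the source. Contraction of that set then
  bounds its distance independently of \<open>\<eta>\<close>, so choosing nearby image points yields
  a quasi-geodesic of the source with controlled constants.\<close>

lemma image_of_neighbourhood:
  assumes im: "contracting (range \<phi>)" and \<zeta>: "\<zeta> \<in> contracting_boundary p" and R: "R \<ge> 1"
  obtains r where "r \<ge> 1" "\<And>\<eta>. \<eta> \<in> FQ_nbhd p \<alpha> \<zeta> r \<Longrightarrow> bmap \<eta> \<in> FQ_nbhd (\<phi> p) \<alpha>' (bmap \<zeta>) R"
proof -
  interpret z: geodesic_boundary_point p \<zeta> "\<alpha> \<zeta>"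
    by (rule dom.point[OF \<zeta>])
  have \<zeta>': "bmap \<zeta> \<in> contracting_boundary (\<phi> p)"
    by (rule boundary_map_point(1)[OF \<zeta>])
  interpret z': geodesic_boundary_point "\<phi> p" "bmap \<zeta>" "\<alpha>' (bmap \<zeta>)"
    by (rule cod.point[OF \<zeta>'])
  obtain D where D: "D \<ge> 0" "hausdorff_within D (\<phi> ` z.Z) z'.Z"
    using image_ray_near[OF \<zeta>] by blast
  have R0: "R \<ge> 0"
    using R by simp
  define I where "I = closure (range \<phi>)"
  have I: "closed I" "I \<noteq> {}"
    by (auto simp: I_def)
  obtain K where K: "contraction_scale I R R K"
    using contraction_scale_exists[OF contracting_imp_uniformly_contracting[OF im] R R0]
    unfolding I_def by blast
  have K0: "K \<ge> 3 * R"
    using K unfolding contraction_scale_def by blast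
  \<comment> \<open>Independent of the ray to be lifted, which lets \<open>r\<close> be chosen
    before \<open>\<eta>\<close>.\<close>
  define N where "N = K + R * (2 * R * (2 * R + 3 * K)) + R"
  have N: "N \<ge> 0"
    using K0 R by (simp add: N_def)
  define Lg Ag M where "Lg = L * R" and "Ag = L * (R + 2 * N + 2 + A)" and "M = 2 * (Lg + Ag)"
  have Lg: "Lg \<ge> 1" and Ag: "Ag \<ge> 0"
    using mult_mono[of 1 L 1 R] L A R N by (auto simp: Lg_def Ag_def)
  have M: "M \<ge> 0"
    using Lg Ag by (simp add: M_def)
  define k where "k = kappa (rho_bd \<zeta>) Lg (Ag + 4 * (Lg + Ag)) + 1"
  have k: "k \<ge> 0"
    using z.kappa_lower(1)[of "Ag + 4 * (Lg + Ag)" "rho_bd \<zeta>" Lg] Lg Ag by (simp add: k_def)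
  define C where "C = N + 1 + (L * (k + M) + A) + D"
  have C: "C \<ge> 0"
    using N L k M A D(1) by (simp add: C_def)
  define T where "T = R + backtrack R R (kappa (rho_bd (bmap \<zeta>)) R R) C"
  \<comment> \<open>Parameters transfer by \<open>t \<le> L * (t1 + A + D)\<close>, so
    \<open>t \<ge> r\<close> gives \<open>t1 \<ge> T\<close>.\<close>
  define r where "r = max 1 (L * (T + A + D))"
  have r1: "r \<ge> 1"
    by (simp add: r_def)
  have "bmap \<eta> \<in> FQ_nbhd (\<phi> p) \<alpha>' (bmap \<zeta>) R" if \<eta>: "\<eta> \<in> FQ_nbhd p \<alpha> \<zeta> r" for \<eta>
  proof -
    have \<eta>b: "\<eta> \<in> contracting_boundary p"
      using \<eta> by (simp add: FQ_nbhd_def)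
    have \<eta>': "bmap \<eta> \<in> contracting_boundary (\<phi> p)"
      by (rule boundary_map_point(1)[OF \<eta>b])
    interpret e: geodesic_boundary_point p \<eta> "\<alpha> \<eta>"
      by (rule dom.point[OF \<eta>b])
    show ?thesis
    proof (rule cod.FQ_nbhdI[OF \<zeta>' \<eta>' R C])
      fix \<beta> assume \<beta>: "\<beta> \<in> bmap \<eta>" "continuous_on {0..} \<beta>" "qi_embedding_on R R {0..} \<beta>"
      have b0: "\<beta> 0 = \<phi> p"
        using boundary_eq_class(2)[OF \<eta>' \<beta>(1)] by (rule contracting_ray_start)
      obtain H where H: "hausdorff_within H ((\<phi> \<circ> \<alpha> \<eta>) ` {0..}) (\<beta> ` {0..})"
        using boundary_mem_iff[OF \<eta>' boundary_map_point(2)[OF \<eta>b e.mem]] \<beta>(1) by blast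
      have "infdist (\<beta> t) I \<le> H" if t: "t \<ge> 0" for t
      proof -
        obtain s where "dist (\<beta> t) (\<phi> (\<alpha> \<eta> s)) \<le> H"
          using H t unfolding hausdorff_within_def by fastforce
        then show ?thesis
          using closure_subset[of "range \<phi>"] by (intro infdist_le2[of "\<phi> (\<alpha> \<eta> s)"]) (auto simp: I_def)
      qed
      then have rec: "\<exists>t\<ge>T. infdist (\<beta> t) I \<le> H" for T
        by (intro exI[of _ "max T 0"]) auto
      have "\<beta> 0 \<in> I"
        using b0 closure_subset[of "range \<phi>"] by (auto simp: I_def)
      then have "infdist (\<beta> 0) I \<le> K"
        using K0 R by simp
      then have near: "infdist (\<beta> t) I \<le> N" if "t \<ge> 0" for t
        unfolding N_def using that rec
        by (intro recurrent_ray_stays_near[OF cod.X I K \<beta>(2,3)]) auto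
      \<comment> \<open>The lift must start exactly at \<open>p\<close> to be a ray of the class,
        hence the special value at time 0.\<close>
      have "\<exists>x. dist (\<phi> x) (\<beta> t) \<le> N + 1 \<and> (t = 0 \<longrightarrow> x = p)" if t: "t \<ge> 0" for t
      proof (cases "t = 0")
        case True
        then show ?thesis
          using b0 N by (intro exI[of _ p]) auto
      next
        case False
        obtain y where y: "y \<in> closest_proj I (\<beta> t)"
          using closest_proj_exists[OF cod.X I] by blast
        then have "y \<in> closure (range \<phi>)"
          using closest_projD(1) by (auto simp: I_def)
        then obtain x where "dist (\<phi> x) y \<le> 1"
          using closure_within_one[of y "range \<phi>"] by auto
        then have "dist (\<phi> x) (\<beta> t) \<le> N + 1"
          using closest_projD(2)[OF y] near[OF t] dist_triangle[of "\<phi> x" "\<beta> t" y] by (simp add: dist_commute)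
        then show ?thesis
          using False by blast
      qed
      then obtain \<gamma> where \<gamma>: "\<And>t. t \<ge> 0 \<Longrightarrow> dist (\<phi> (\<gamma> t)) (\<beta> t) \<le> N + 1" "\<gamma> 0 = p"
        by (metis order_refl)
      have "qi_embedding_on Lg Ag {0..} \<gamma>"
      proof (rule qi_embedding_onI[OF Lg])
        fix s t :: real assume st: "s \<in> {0..}" "t \<in> {0..}"
        have q: "dist (\<beta> s) (\<beta> t) \<le> R * dist s t + R" "dist s t \<le> R * (dist (\<beta> s) (\<beta> t) + R)"
          using qi_embedding_onD[OF \<beta>(3) R st] .
        have n: "dist (\<phi> (\<gamma> s)) (\<beta> s) \<le> N + 1" "dist (\<phi> (\<gamma> t)) (\<beta> t) \<le> N + 1"
          using \<gamma>(1) st by auto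
        have "dist (\<phi> (\<gamma> s)) (\<phi> (\<gamma> t)) \<le> dist (\<phi> (\<gamma> s)) (\<beta> s) + dist (\<beta> s) (\<beta> t) + dist (\<phi> (\<gamma> t)) (\<beta> t)"
          by metric
        then have "L * (dist (\<phi> (\<gamma> s)) (\<phi> (\<gamma> t)) + A) \<le> L * (R * dist s t + (R + 2 * N + 2 + A))"
          using n q(1) L by (intro mult_left_mono) auto
        also have "\<dots> = Lg * dist s t + Ag"
          by (simp add: Lg_def Ag_def algebra_simps)
        finally show "dist (\<gamma> s) (\<gamma> t) \<le> Lg * dist s t + Ag"
          using lo order_trans by blast
        have "dist (\<beta> s) (\<beta> t) \<le> dist (\<phi> (\<gamma> s)) (\<beta> s) + dist (\<phi> (\<gamma> s)) (\<phi> (\<gamma> t)) + dist (\<phi> (\<gamma> t)) (\<beta> t)"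
          by metric
        then have "dist (\<beta> s) (\<beta> t) + R \<le> L * dist (\<gamma> s) (\<gamma> t) + (R + 2 * N + 2 + A)"
          using n up[of "\<gamma> s" "\<gamma> t"] by simp
        also have "\<dots> \<le> L * dist (\<gamma> s) (\<gamma> t) + L * (R + 2 * N + 2 + A)"
          using mult_right_mono[OF L, of "R + 2 * N + 2 + A"] R N A by simp
        also have "\<dots> \<le> L * (dist (\<gamma> s) (\<gamma> t) + Ag)"
          using L Ag mult_right_mono[OF L Ag] unfolding Ag_def[symmetric] by (simp add: algebra_simps)
        finally have "R * (dist (\<beta> s) (\<beta> t) + R) \<le> R * (L * (dist (\<gamma> s) (\<gamma> t) + Ag))"
          using R by (intro mult_left_mono) auto
        then show "dist s t \<le> Lg * (dist (\<gamma> s) (\<gamma> t) + Ag)"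
          using q(2) by (simp add: Lg_def mult_ac)
      qed
      then obtain \<gamma>' where \<gamma>': "continuous_on {0..} \<gamma>'" "\<gamma>' 0 = \<gamma> 0"
        "\<And>t. t \<ge> 0 \<Longrightarrow> dist (\<gamma>' t) (\<gamma> t) \<le> M"
        "qi_embedding_on Lg (Ag + 4 * (Lg + Ag)) {0..} \<gamma>'"
        using tame_quasi_geodesic[OF dom.X Lg Ag] unfolding M_def by metis
      have match: "dist (\<alpha> \<eta> s) (\<gamma>' t) \<le> L * (H + N + 1 + A) + M"
        if "t \<ge> 0" "dist (\<phi> (\<alpha> \<eta> s)) (\<beta> t) \<le> H" for s t
      proof -
        have "dist (\<phi> (\<alpha> \<eta> s)) (\<phi> (\<gamma> t)) \<le> H + N + 1"
          using dist_triangle[of "\<phi> (\<alpha> \<eta> s)" "\<phi> (\<gamma> t)" "\<beta> t"] \<gamma>(1)[OF that(1)] that(2)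
          by (simp add: dist_commute)
        then have "L * (dist (\<phi> (\<alpha> \<eta> s)) (\<phi> (\<gamma> t)) + A) \<le> L * (H + N + 1 + A)"
          using L by (intro mult_left_mono) auto
        then have "dist (\<alpha> \<eta> s) (\<gamma> t) \<le> L * (H + N + 1 + A)"
          using lo order_trans by blast
        then show ?thesis
          using \<gamma>'(3)[OF that(1)] dist_triangle[of "\<alpha> \<eta> s" "\<gamma>' t" "\<gamma> t"] by (simp add: dist_commute)
      qed
      \<comment> \<open>\<open>H\<close> depends on the ray \<open>\<beta>\<close>, which is
        harmless: here only membership in the class \<open>\<eta>\<close> is at stake.\<close>
      have "hausdorff_within (L * (H + N + 1 + A) + M) e.Z (\<gamma>' ` {0..})"
        unfolding hausdorff_within_def
      proof (intro conjI ballI)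
        fix x assume "x \<in> e.Z"
        then obtain s where s: "s \<ge> 0" "x = \<alpha> \<eta> s"
          by auto
        then obtain t where "t \<ge> 0" "dist (\<phi> (\<alpha> \<eta> s)) (\<beta> t) \<le> H"
          using H unfolding hausdorff_within_def by fastforce
        then show "\<exists>y\<in>\<gamma>' ` {0..}. dist x y \<le> L * (H + N + 1 + A) + M"
          using match s by auto
      next
        fix x assume "x \<in> \<gamma>' ` {0..}"
        then obtain t where t: "t \<ge> 0" "x = \<gamma>' t"
          by auto
        then obtain s where "s \<ge> 0" "dist (\<beta> t) (\<phi> (\<alpha> \<eta> s)) \<le> H"
          using H unfolding hausdorff_within_def by fastforce
        then show "\<exists>y\<in>e.Z. dist x y \<le> L * (H + N + 1 + A) + M"
          using match[of t s] t by (intro bexI[of _ "\<alpha> \<eta> s"]) (auto simp: dist_commute)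
      qed
      then have "\<gamma>' \<in> \<eta>"
        using \<gamma>'(2) \<gamma>(2) Lg Ag by (intro boundary_memI[OF dom.X \<eta>b e.mem Lg _ \<gamma>'(4)]) auto
      then obtain s t where st: "s \<ge> 0" "t \<ge> r" "dist (\<gamma>' s) (\<alpha> \<zeta> t) \<le> k"
        using dom.FQ_nbhdD[OF \<zeta> \<eta> r1 Lg _ _ \<gamma>'(1,4)] Lg Ag unfolding k_def by auto
      have t0: "t \<ge> 0"
        using st(2) r1 by simp
      obtain t1 where t1: "t1 \<ge> 0" "dist (\<phi> (\<alpha> \<zeta> t)) (\<alpha>' (bmap \<zeta>) t1) \<le> D"
        using D(2) t0 unfolding hausdorff_within_def by auto
      have "dist (\<gamma> s) (\<alpha> \<zeta> t) \<le> k + M"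
        using st(3) \<gamma>'(3)[OF st(1)] dist_triangle[of "\<gamma> s" "\<alpha> \<zeta> t" "\<gamma>' s"] by (simp add: dist_commute)
      then have "L * dist (\<gamma> s) (\<alpha> \<zeta> t) \<le> L * (k + M)"
        using L by (intro mult_left_mono) auto
      then have "dist (\<phi> (\<gamma> s)) (\<phi> (\<alpha> \<zeta> t)) \<le> L * (k + M) + A"
        using up[of "\<gamma> s" "\<alpha> \<zeta> t"] by linarith
      moreover have "dist (\<beta> s) (\<alpha>' (bmap \<zeta>) t1) \<le> dist (\<phi> (\<gamma> s)) (\<beta> s)
          + dist (\<phi> (\<gamma> s)) (\<phi> (\<alpha> \<zeta> t)) + dist (\<phi> (\<alpha> \<zeta> t)) (\<alpha>' (bmap \<zeta>) t1)"
        by metric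
      ultimately have close: "dist (\<beta> s) (\<alpha>' (bmap \<zeta>) t1) \<le> C"
        unfolding C_def using \<gamma>(1)[OF st(1)] t1(2) by linarith
      have "dist (\<phi> (\<alpha> \<zeta> t)) (\<phi> p) \<le> D + t1"
        using dist_triangle[of "\<phi> (\<alpha> \<zeta> t)" "\<phi> p" "\<alpha>' (bmap \<zeta>) t1"] z'.dist_start[OF t1(1)] t1(2) by simp
      then have "L * (dist (\<phi> (\<alpha> \<zeta> t)) (\<phi> p) + A) \<le> L * (t1 + A + D)"
        using L by (intro mult_left_mono) auto
      then have "t \<le> L * (t1 + A + D)"
        using lo[of "\<alpha> \<zeta> t" p] z.dist_start[OF t0] by linarith
      then have "L * (T + A + D) \<le> L * (t1 + A + D)"
        using st(2) by (simp add: r_def)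
      then have "T \<le> t1"
        using L by simp
      then show "\<exists>s\<ge>0. \<exists>t\<ge>R + backtrack R R (kappa (rho_bd (bmap \<zeta>)) R R) C.
          dist (\<beta> s) (\<alpha>' (bmap \<zeta>) t) \<le> C"
        unfolding T_def[symmetric] using st(1) close by blast
    qed
  qed
  then show thesis
    using that[OF r1] by blast
qed

lemma boundary_map_continuous:
  assumes im: "contracting (range \<phi>)"
  shows "continuous_map (FQ_topology p \<alpha>) (FQ_topology (\<phi> p) \<alpha>') bmap"
  unfolding continuous_map_def topspace_FQ_topology[OF dom.choice] topspace_FQ_topology[OF cod.choice]
    openin_FQ_topology[OF dom.choice] openin_FQ_topology[OF cod.choice]
proof (intro conjI allI impI)
  show "bmap \<in> contracting_boundary p \<rightarrow> contracting_boundary (\<phi> p)"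
    using boundary_map_point(1) by blast
next
  fix V assume V: "FQ_open (\<phi> p) \<alpha>' V"
  show "FQ_open p \<alpha> {\<zeta> \<in> contracting_boundary p. bmap \<zeta> \<in> V}"
    unfolding FQ_open_def
  proof (intro conjI ballI)
    fix \<zeta> assume \<zeta>: "\<zeta> \<in> {\<zeta> \<in> contracting_boundary p. bmap \<zeta> \<in> V}"
    then obtain R where R: "R \<ge> 1" "FQ_nbhd (\<phi> p) \<alpha>' (bmap \<zeta>) R \<subseteq> V"
      using V unfolding FQ_open_def by blast
    obtain r where r: "r \<ge> 1" "\<And>\<eta>. \<eta> \<in> FQ_nbhd p \<alpha> \<zeta> r \<Longrightarrow> bmap \<eta> \<in> FQ_nbhd (\<phi> p) \<alpha>' (bmap \<zeta>) R"
      using image_of_neighbourhood[OF im _ R(1)] \<zeta> by blast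
    then have "FQ_nbhd p \<alpha> \<zeta> r \<subseteq> {\<zeta> \<in> contracting_boundary p. bmap \<zeta> \<in> V}"
      using R(2) by (auto simp: FQ_nbhd_def)
    then show "\<exists>r\<ge>1. FQ_nbhd p \<alpha> \<zeta> r \<subseteq> {\<zeta> \<in> contracting_boundary p. bmap \<zeta> \<in> V}"
      using r(1) by blast
  qed auto
qed

end

theorem theorem6p1:
  fixes \<phi> :: "'a::metric_space \<Rightarrow> 'b::metric_space"
    and p :: 'a
    and \<alpha> :: "(real \<Rightarrow> 'a) set \<Rightarrow> real \<Rightarrow> 'a"
    and \<alpha>' :: "(real \<Rightarrow> 'b) set \<Rightarrow> real \<Rightarrow> 'b"
  assumes "proper_geodesic_space TYPE('a)"
    and "proper_geodesic_space TYPE('b)"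
    and "geodesic_choice p \<alpha>"
    and "geodesic_choice (\<phi> p) \<alpha>'"
    and "quasi_isometric_embedding \<phi>"
  shows "(preserves_contracting_quasi_geodesics \<phi> \<longrightarrow>
            induces_boundary_map p \<phi> \<and>
            boundary_map p \<phi> ` contracting_boundary p \<subseteq> contracting_boundary (\<phi> p) \<and>
            inj_on (boundary_map p \<phi>) (contracting_boundary p) \<and>
            open_map (FQ_topology p \<alpha>)
              (subtopology (FQ_topology (\<phi> p) \<alpha>') (boundary_map p \<phi> ` contracting_boundary p))
              (boundary_map p \<phi>)) \<and>
         (contracting (range \<phi>) \<longrightarrow>
            induces_boundary_map p \<phi> \<and>
            continuous_map (FQ_topology p \<alpha>) (FQ_topology (\<phi> p) \<alpha>') (boundary_map p \<phi>))"
proof -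
  obtain L A where LA: "L \<ge> 1" "A \<ge> 0" "qi_embedding_on L A UNIV \<phi>"
    using assms(5) unfolding quasi_isometric_embedding_def by blast
  have embedding: "boundary_embedding \<phi> p \<alpha> \<alpha>' L A"
    if "\<And>\<gamma>. \<gamma> \<in> contracting_rays p \<Longrightarrow> \<phi> \<circ> \<gamma> \<in> contracting_rays (\<phi> p)"
    using assms LA that by unfold_locales
  show ?thesis
  proof (intro conjI impI)
    assume pres: "preserves_contracting_quasi_geodesics \<phi>"
    have "\<phi> \<circ> \<gamma> \<in> contracting_rays (\<phi> p)" if "\<gamma> \<in> contracting_rays p" for \<gamma>
      using pres that unfolding preserves_contracting_quasi_geodesics_def contracting_rays_def by auto
    then interpret boundary_embedding \<phi> p \<alpha> \<alpha>' L A
      by (rule embedding)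
    show "induces_boundary_map p \<phi>"
      by (rule induces)
    show "boundary_map p \<phi> ` contracting_boundary p \<subseteq> contracting_boundary (\<phi> p)"
      using boundary_map_point(1) by blast
    show "inj_on (boundary_map p \<phi>) (contracting_boundary p)"
      by (rule boundary_map_inj)
    show "open_map (FQ_topology p \<alpha>)
        (subtopology (FQ_topology (\<phi> p) \<alpha>') (boundary_map p \<phi> ` contracting_boundary p))
        (boundary_map p \<phi>)"
      by (rule boundary_map_open)
  next
    assume im: "contracting (range \<phi>)"
    have "\<phi> \<circ> \<gamma> \<in> contracting_rays (\<phi> p)" if g: "\<gamma> \<in> contracting_rays p" for \<gamma>
    proof -
      obtain L' A' where \<gamma>: "L' \<ge> 1" "A' \<ge> 0" "qi_embedding_on L' A' {0..} \<gamma>" "\<gamma> 0 = p"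
          "contracting (\<gamma> ` {0..})"
        using g unfolding contracting_rays_def quasi_geodesic_on_def by blast
      have "contracting ((\<phi> \<circ> \<gamma>) ` {0..})"
        using contracting_image[OF assms(1,2) LA im \<gamma>(5)] by (simp add: image_comp)
      moreover have "qi_embedding_on (L * L') (L * A' + A) {0..} (\<phi> \<circ> \<gamma>)"
        by (rule qi_embedding_on_compose[OF LA(1) \<gamma>(1,2) LA(3) \<gamma>(3) LA(2)])
      moreover have "L * L' \<ge> 1" "L * A' + A \<ge> 0"
        using mult_mono[of 1 L 1 L'] LA \<gamma> by auto
      ultimately show ?thesis
        using \<gamma>(4) unfolding contracting_rays_def quasi_geodesic_on_def by (auto simp: is_interval_ci)
    qed
    then interpret boundary_embedding \<phi> p \<alpha> \<alpha>' L A
      by (rule embedding)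
    show "induces_boundary_map p \<phi>"
      by (rule induces)
    show "continuous_map (FQ_topology p \<alpha>) (FQ_topology (\<phi> p) \<alpha>') (boundary_map p \<phi>)"
      by (rule boundary_map_continuous[OF im])
  qed
qed

end
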